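(* Let $D<-4$ be the discriminant of an imaginary quadratic field, $N=|D|$, $\chi=\chi_D$, $h=h(D)$, and let $B>1$ be an integer with $\gcd(B,N)=1$. Then $$\sum_{k=0}^{\left[\frac B2\right]-1}(B-1-2k)\,E_k(B)=(B-\chi(B))\,h.$$ Moreover, if $B=B_1B_2$ is a factorization into positive integers with $1<B_1<B$, then $$\sum_{k=0}^{\left[\frac{B_1}{2}\right]-1}(B_1-1-2k)\sum_{j=0}^{B_2-1}E_{kB_2+j}(B)=(B_1-\chi(B_1))\,h.$$
   Context: $[t]$ denotes the greatest integer $\le t$. Discriminant and character: let $K=\mathbb{Q}(\sqrt m)$ with $m$ a negative square-free integer. Its discriminant is $D=m$ if $m\equiv 1\pmod 4$ and $D=4m$ otherwise. $h(D)$ is the order of the ideal class group of $K$. The quadratic character $\chi_D:\mathbb{Z}\to\{0,1,-1\}$ modulo $N=|D|$ satisfies $\chi_D(x)=0$ if $\gcd(x,N)>1$, and for $\gcd(x,N)=1$ it is given by: $\chi_D(x)=\left(\frac{x}{|m|}\right)$ (Jacobi symbol) if $D=m\equiv1\pmod 4$; and for $D=4m$: $\chi_D(x)=\chi_4(x)\left(\frac{x}{|m|}\right)$ if $m\equiv3\pmod4$; $\chi_D(x)=\chi_8(x)\left(\frac{x}{|n|}\right)$ if $m=2n$, $n\equiv1\pmod4$; $\chi_D(x)=\chi_4(x)\chi_8(x)\left(\frac{x}{|n|}\right)$ if $m=2n$, $n\equiv3\pmod4$. Here, for odd $x$, $\chi_4(x)=(-1)^{(x-1)/2}$ and $\chi_8(x)=(-1)^{(x^2-1)/8}$.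 It is an odd character: $\chi_D(-1)=-1$. Let $X=\{x\in\mathbb{Z}:1\le x\le N,\ \gcd(x,N)=1\}$. For $0\le k\le B-1$ set $X_k(B)=\{x\in X:\frac{kN}{B}<x<\frac{(k+1)N}{B}\}$ and $E_k(B)=\sum_{x\in X_k(B)}\chi(x)$. *)

theory Defs
  imports
    "HOL-Computational_Algebra.Computational_Algebra"
    "HOL-Number_Theory.Number_Theory"
    "HOL-Algebra.Algebra"
begin

(* Throughout, m is the square-free negative integer determining the field Q(sqrt m);
   the discriminant, the character and the class number are functions of m. *)

definition quad_field :: "int \<Rightarrow> complex ring" where
  "quad_field m =
     \<lparr>carrier = {of_rat a + of_rat b * csqrt (of_int m) | a b. True},
      monoid.mult = (*), one = 1, ring.zero = 0, add = (+)\<rparr>"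

definition quad_integers :: "int \<Rightarrow> complex ring" where
  "quad_integers m =
     (quad_field m)\<lparr>carrier := {z \<in> carrier (quad_field m). algebraic_int z}\<rparr>"

definition fractional_ideal :: "int \<Rightarrow> complex set \<Rightarrow> bool" where
  "fractional_ideal m J \<longleftrightarrow>
     J \<subseteq> carrier (quad_field m) \<and> J \<noteq> {0} \<and>
     (\<exists>d \<in> carrier (quad_integers m). d \<noteq> 0 \<and> ideal ((\<lambda>x. d * x) ` J) (quad_integers m))"

(* The set produced by ideal_prod depends only on the ring operations, so it may be applied to
   fractional ideals inside the field: it is the set of finite sums of products. *)
definition fractional_ideal_group :: "int \<Rightarrow> complex set monoid" where
  "fractional_ideal_group m =
     \<lparr>carrier = {J. fractional_ideal m J},
      monoid.mult = ideal_prod (quad_field m),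
      one = carrier (quad_integers m)\<rparr>"

definition principal_fractional_ideals :: "int \<Rightarrow> complex set set" where
  "principal_fractional_ideals m =
     {(\<lambda>x. a * x) ` carrier (quad_integers m) | a. a \<in> carrier (quad_field m) \<and> a \<noteq> 0}"

definition ideal_class_group :: "int \<Rightarrow> complex set set monoid" where
  "ideal_class_group m = fractional_ideal_group m Mod principal_fractional_ideals m"

definition class_number :: "int \<Rightarrow> nat" where
  "class_number m = Coset.order (ideal_class_group m)"

definition quad_disc :: "int \<Rightarrow> int" where
  "quad_disc m = (if m mod 4 = 1 then m else 4 * m)"

(* Used only for odd positive n. *)
definition jacobi :: "int \<Rightarrow> int \<Rightarrow> int" where
  "jacobi x n = (\<Prod>p\<in>#prime_factorization n. Legendre x p)"

(* The absolute value keeps the parity of the exponent and allows negative x. *)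
definition chi4 :: "int \<Rightarrow> int" where
  "chi4 x = (- 1) ^ nat \<bar>(x - 1) div 2\<bar>"

definition chi8 :: "int \<Rightarrow> int" where
  "chi8 x = (- 1) ^ nat ((x\<^sup>2 - 1) div 8)"

definition quad_char :: "int \<Rightarrow> int \<Rightarrow> int" where
  "quad_char m x =
     (if gcd x \<bar>quad_disc m\<bar> > 1 then 0
      else if m mod 4 = 1 then jacobi x \<bar>m\<bar>
      else if m mod 4 = 3 then chi4 x * jacobi x \<bar>m\<bar>
      else if (m div 2) mod 4 = 1 then chi8 x * jacobi x \<bar>m div 2\<bar>
      else chi4 x * chi8 x * jacobi x \<bar>m div 2\<bar>)"

definition reduced_residues :: "int \<Rightarrow> int set" where
  "reduced_residues N = {x \<in> {1..N}. gcd x N = 1}"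

definition residues_part :: "int \<Rightarrow> int \<Rightarrow> int \<Rightarrow> int set" where
  "residues_part N B k =
     {x \<in> reduced_residues N.
        real_of_int (k * N) / real_of_int B < real_of_int x \<and>
        real_of_int x < real_of_int ((k + 1) * N) / real_of_int B}"

definition E_sum :: "int \<Rightarrow> int \<Rightarrow> int \<Rightarrow> int" where
  "E_sum m B k = (\<Sum>x \<in> residues_part \<bar>quad_disc m\<bar> B k. quad_char m x)"

end

theory Submission
  imports Defs "HOL-Analysis.Analysis"
begin

text \<open>
Both identities follow from Dirichlet's class number formula N h = - (sum of x chi(x) over the reduced
residues x). The sum E_k collects those x with floor(B x / N) = k, and
N floor(B x / N) = B x - (B x mod N). Weighting with chi, and using that multiplication by B permutes the
reduced residues, evaluates the sum of all k E_k; since chi is odd, E_(B-1-k) = - E_k, and the sum folds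
onto k < B/2 (\<open>weighted_E_sums\<close>). If B = B1 B2, then B2 consecutive sums E_k(B) add up to one sum
E_k(B1) (\<open>E_sum_merge\<close>), so the second identity is the first one for B1.

The class number formula comes from the behaviour, as t tends to 0 from above, of the series Z(t) with
terms exp(- t Norm(J)), where J runs over the nonzero ideals. It has the form C/t + c + o(1), and the
formula is the equality of two expressions for the constant term c (which is the value of the zeta function
of the field at 0). Working there instead of with the residue at 1 avoids Gauss sums, and in particular
their sign. The combination Z(t) - 4 Z(4t) removes the term C/t and tends to - 3c.

First expression. The ideals of one class are the alpha I, where alpha runs over the nonzero elements of
the lattice of all alpha with alpha I integral, and alpha is determined up to sign because D < -4 leaves
only the units 1 and -1 (\<open>unit_pm1\<close>). So the class contributes (Theta(t) - 1) / 2 with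
a two-dimensional theta series Theta (\<open>class_theta\<close>). Splitting the lattice L into the four
cosets of 2L, whose sums all have the same asymptotics, gives Theta(t) - 4 Theta(4t) = o(1)
(\<open>theta2_limit\<close>). Hence every class contributes 3/2 to the limit.

Second expression. An ideal is k (a Z + (b + omega) Z) with a dividing the norm f(b) of b + omega, and its
norm is k^2 a. Counting roots of f modulo prime powers, by Hensel lifting and quadratic reciprocity, shows
that there are as many ideals of norm n as the sum of chi(d) over d dividing n (\<open>ideal_count\<close>).
Hence Z(t) is the Lambert series of the chi(d) / (exp(d t) - 1), and Z(t) - 2 Z(2t) is the sum of the
chi(d) / (exp(d t) + 1), whose limit is - (sum of x chi(x)) / (2 N) by comparison with a telescoping sum
(\<open>fermi_limit\<close>). Finiteness of the class group, by reduction of ideals of least norm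
(\<open>finite_ideal_classes\<close>), makes the comparison of the two limits legitimate.
\<close>

hide_const (open) Divisibility.prime Henstock_Kurzweil_Integration.content

section \<open>Legendre symbols at -1 and 2\<close>

lemma Legendre_values: "Legendre a p \<in> {-1, 0, 1}"
  by (auto simp: Legendre_def)

lemma Legendre_cong: "[a = b] (mod p) \<Longrightarrow> Legendre a p = Legendre b p"
proof -
  assume "[a = b] (mod p)"
  then have "[a = 0] (mod p) = [b = 0] (mod p)" "\<And>y. [y = a] (mod p) = [y = b] (mod p)"
    by (simp_all add: Cong.cong_def)
  then show ?thesis unfolding Legendre_def QuadRes_def by presburger
qed

lemma odd_prime_int_gt_2: "prime p \<Longrightarrow> odd p \<Longrightarrow> 2 < p" for p :: int
  using prime_ge_2_int[of p] by (cases "p = 2") auto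

text \<open>Symbols take the values -1, 0, 1 only, so for p > 2 an identity between them can be checked modulo p, where Euler's criterion turns it into an identity of powers.\<close>

lemma eq_if_cong_small:
  fixes u v p :: int
  assumes "[u = v] (mod p)" "u \<in> {-1, 0, 1}" "v \<in> {-1, 0, 1}" "2 < p"
  shows "u = v"
proof (rule ccontr)
  assume "u \<noteq> v"
  have "p dvd u - v" using assms(1) by (simp add: cong_iff_dvd_diff)
  then have "\<bar>p\<bar> \<le> \<bar>u - v\<bar>" using \<open>u \<noteq> v\<close> by (intro dvd_imp_le_int) simp_all
  moreover have "\<bar>u - v\<bar> \<le> 2" using assms(2,3) by (elim insertE emptyE) simp_all
  ultimately show False using assms(4) by linarith
qed

lemma Legendre_euler:
  fixes p :: int
  assumes "prime p" "odd p"
  shows "[Legendre a p = a ^ nat ((p - 1) div 2)] (mod p)"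
proof -
  have p2: "2 < p" using assms odd_prime_int_gt_2 by auto
  have "[Legendre a (int (nat p)) = a ^ ((nat p - 1) div 2)] (mod int (nat p))"
    by (rule euler_criterion) (use assms p2 in auto)
  moreover have "(nat p - 1) div 2 = nat ((p - 1) div 2)" using p2 by auto
  ultimately show ?thesis using p2 by auto
qed

lemma Legendre_mult:
  fixes p :: int
  assumes "prime p" "odd p"
  shows "Legendre (a * b) p = Legendre a p * Legendre b p"
proof (rule eq_if_cong_small[of _ _ p])
  let ?e = "nat ((p - 1) div 2)"
  have "[Legendre a p * Legendre b p = a ^ ?e * b ^ ?e] (mod p)"
    by (intro cong_mult Legendre_euler assms)
  moreover have "[Legendre (a * b) p = (a * b) ^ ?e] (mod p)"
    by (intro Legendre_euler assms)
  ultimately show "[Legendre (a * b) p = Legendre a p * Legendre b p] (mod p)"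
    by (metis cong_sym cong_trans power_mult_distrib)
  show "2 < p" using assms odd_prime_int_gt_2 by auto
  show "Legendre a p * Legendre b p \<in> {-1, 0, 1}"
    using Legendre_values[of a p] Legendre_values[of b p] by (elim insertE emptyE) simp_all
qed (rule Legendre_values)

lemma chi4_odd: "odd x \<Longrightarrow> chi4 x = (if x mod 4 = 1 then 1 else -1)"
proof -
  assume "odd x"
  then have "x mod 4 = 1 \<or> x mod 4 = 3" by presburger
  moreover have "even (nat \<bar>(x - 1) div 2\<bar>) \<longleftrightarrow> even ((x-1) div 2)"
    by (simp add: even_nat_iff)
  moreover have "even ((x-1) div 2) \<longleftrightarrow> x mod 4 = 1"
    using \<open>odd x\<close> by presburger
  ultimately show ?thesis unfolding chi4_def by auto
qed

lemma chi8_odd: "odd x \<Longrightarrow> chi8 x = (if x mod 8 = 1 \<or> x mod 8 = 7 then 1 else -1)"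
proof -
  assume o: "odd x"
  define q r where "q = x div 8" and "r = x mod 8"
  have x: "x = 8 * q + r" unfolding q_def r_def by simp
  have r: "r = 1 \<or> r = 3 \<or> r = 5 \<or> r = 7" unfolding r_def using o by presburger
  have "x\<^sup>2 - 1 = 8 * (8 * q\<^sup>2 + 2 * q * r) + (r\<^sup>2 - 1)"
    unfolding x by (simp add: power2_eq_square algebra_simps)
  then have e: "(x\<^sup>2 - 1) div 8 = 8 * q\<^sup>2 + 2 * q * r + (r\<^sup>2 - 1) div 8" by simp
  have "even ((x\<^sup>2 - 1) div 8) \<longleftrightarrow> r = 1 \<or> r = 7"
    unfolding e using r by auto
  moreover have "x\<^sup>2 \<ge> 1" using o by (cases "x = 0") (auto simp: int_one_le_iff_zero_less)
  then have "(x\<^sup>2 - 1) div 8 \<ge> 0" by simp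
  ultimately show ?thesis unfolding chi8_def r_def[symmetric] using even_nat_iff by auto
qed

lemma odd_mult_mod_4: "odd x \<Longrightarrow> odd y \<Longrightarrow> (x * y) mod 4 = 1 \<longleftrightarrow> (x mod 4 = 1 \<longleftrightarrow> y mod 4 = 1)" for x y :: int
proof -
  assume "odd x" "odd y"
  then have "x mod 4 = 1 \<or> x mod 4 = 3" "y mod 4 = 1 \<or> y mod 4 = 3" by presburger+
  moreover have "(x * y) mod 4 = ((x mod 4) * (y mod 4)) mod 4" by (simp add: mod_mult_eq)
  ultimately show ?thesis by auto
qed

lemma chi4_mult: "odd x \<Longrightarrow> odd y \<Longrightarrow> chi4 (x * y) = chi4 x * chi4 y"
  using odd_mult_mod_4[of x y] by (simp add: chi4_odd)

lemma chi8_mult: "odd x \<Longrightarrow> odd y \<Longrightarrow> chi8 (x * y) = chi8 x * chi8 y"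
proof -
  assume o: "odd x" "odd y"
  then have "x mod 8 \<in> {1, 3, 5, 7}" "y mod 8 \<in> {1, 3, 5, 7}" by (simp; presburger)+
  moreover have "(x * y) mod 8 = ((x mod 8) * (y mod 8)) mod 8" by (simp add: mod_mult_eq)
  ultimately have "(x * y mod 8 \<in> {1, 7}) = ((x mod 8 \<in> {1, 7}) = (y mod 8 \<in> {1, 7}))"
    by (elim insertE emptyE) (simp_all only:, simp_all)
  then show ?thesis using o by (simp add: chi8_odd)
qed

lemma Legendre_minus1:
  fixes p :: int
  assumes "prime p" "odd p"
  shows "Legendre (-1) p = chi4 p"
proof (rule eq_if_cong_small[of _ _ p])
  show "2 < p" using assms odd_prime_int_gt_2 by auto
  then show "[Legendre (-1) p = chi4 p] (mod p)"
    unfolding chi4_def using Legendre_euler[OF assms, of "-1"] by simp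
  show "chi4 p \<in> {- 1, 0, 1}" using assms by (auto simp: chi4_odd)
qed (rule Legendre_values)

text \<open>This is the count in Gauss's lemma for the multiplier 2: the products 2 x with x in the lower half of the residues are already reduced, so those in the upper half are the even numbers between p/2 and p.\<close>

lemma card_even_upper_half:
  fixes p :: int
  assumes "odd p" "2 < p"
  shows "even (card {y. even y \<and> (p - 1) div 2 < y \<and> y \<le> p - 1}) \<longleftrightarrow> p mod 8 = 1 \<or> p mod 8 = 7"
proof -
  obtain k where k: "p = 2 * k + 1" using \<open>odd p\<close> by (elim oddE)
  then have k': "(p - 1) div 2 = k" "(p - 1) div 4 = k div 2" by simp_all
  have half: "k div 2 < x \<and> x \<le> k \<longleftrightarrow> k < 2 * x \<and> 2 * x \<le> 2 * k" for x :: int by presburger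
  have "bij_betw (\<lambda>x. 2 * x) {(p - 1) div 4<..(p - 1) div 2} {y. even y \<and> (p - 1) div 2 < y \<and> y \<le> p - 1}"
    unfolding k'
  proof (rule bij_betwI')
    fix y assume "y \<in> {y. even y \<and> k < y \<and> y \<le> p - 1}"
    then obtain x where "y = 2 * x" "k < 2 * x \<and> 2 * x \<le> 2 * k" using k by (auto elim!: evenE)
    then show "\<exists>x\<in>{k div 2<..k}. y = 2 * x" using half[of x] by (intro bexI[of _ x]) simp_all
  next
    fix x assume "x \<in> {k div 2<..k}"
    then show "2 * x \<in> {y. even y \<and> k < y \<and> y \<le> p - 1}" using half[of x] k by simp
  qed simp
  from bij_betw_same_card[OF this, symmetric]
  have "card {y. even y \<and> (p - 1) div 2 < y \<and> y \<le> p - 1} = card {(p - 1) div 4<..(p - 1) div 2}" .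
  also have "\<dots> = nat ((p - 1) div 2 - (p - 1) div 4)" by simp
  finally have *: "card {y. even y \<and> (p - 1) div 2 < y \<and> y \<le> p - 1} = nat ((p - 1) div 2 - (p - 1) div 4)" .
  have "(p - 1) div 2 - (p - 1) div 4 \<ge> 0" using assms(2) k unfolding k' by linarith
  then have "even (nat ((p - 1) div 2 - (p - 1) div 4)) \<longleftrightarrow> even ((p - 1) div 2 - (p - 1) div 4)"
    by (simp add: even_nat_iff)
  also have "\<dots> \<longleftrightarrow> p mod 8 = 1 \<or> p mod 8 = 7" unfolding k' unfolding k by presburger
  finally show ?thesis using * by simp
qed

lemma Legendre_2:
  fixes p :: int
  assumes "prime p" "odd p"
  shows "Legendre 2 p = chi8 p"
proof -
  have p2: "2 < p" using assms odd_prime_int_gt_2 by auto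
  interpret G: GAUSS "nat p" 2
  proof
    show "\<not> [2 = 0] (mod int (nat p))"
      using p2 by (auto simp: Cong.cong_def)
  qed (use assms p2 in auto)
  have [simp]: "int (nat p) = p" using p2 by simp
  obtain k where k: "p = 2 * k + 1" using \<open>odd p\<close> by (elim oddE)
  have half: "(p - 1) div 2 = k" "(int (nat p) - 1) div 2 = k" using k p2 by simp_all
  have B: "G.B = (\<lambda>x. x * 2) ` {0<..k}"
    unfolding G.B_def G.A_def half ..
  have "G.C = (\<lambda>x. x) ` G.B"
    unfolding G.C_def
  proof (rule image_cong[OF refl])
    fix y assume "y \<in> G.B"
    then obtain x where "y = x * 2" "0 < x" "x \<le> k" unfolding B by auto
    then have "0 \<le> y" "y < int (nat p)" unfolding \<open>int (nat p) = p\<close> using k by linarith+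
    then show "y mod int (nat p) = y" by simp
  qed
  then have C: "G.C = (\<lambda>x. x * 2) ` {0<..k}" unfolding B by simp
  have "G.E = {y. even y \<and> (p - 1) div 2 < y \<and> y \<le> p - 1}"
    unfolding G.E_def C half
  proof (intro equalityI subsetI)
    fix y assume y: "y \<in> {y. even y \<and> k < y \<and> y \<le> p - 1}"
    then obtain x where "y = x * 2" by (auto elim!: evenE)
    then show "y \<in> (\<lambda>x. x * 2) ` {0<..k} \<inter> {k<..}" using y k p2 by (intro IntI image_eqI[of _ _ x]) simp_all
  next
    fix y assume "y \<in> (\<lambda>x. x * 2) ` {0<..k} \<inter> {k<..}"
    then obtain x where "y = x * 2" "x \<le> k" "k < y" by auto
    then show "y \<in> {y. even y \<and> k < y \<and> y \<le> p - 1}" using k by simp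
  qed
  then have "Legendre 2 p = (-1) ^ card {y. even y \<and> (p - 1) div 2 < y \<and> y \<le> p - 1}"
    using G.gauss_lemma by (simp only: \<open>int (nat p) = p\<close>)
  also have "\<dots> = chi8 p"
    using card_even_upper_half[OF \<open>odd p\<close> p2] chi8_odd[OF \<open>odd p\<close>]
    by (cases "even (card {y. even y \<and> (p - 1) div 2 < y \<and> y \<le> p - 1})") simp_all
  finally show ?thesis .
qed

lemma odd_prime_factor:
  fixes n p :: int
  assumes "odd n" "p \<in># prime_factorization n"
  shows "prime p" "odd p" "p dvd n"
proof -
  show "prime p" "p dvd n" using assms(2) by (auto intro: in_prime_factors_imp_prime in_prime_factors_imp_dvd)
  then show "odd p" using assms(1) dvd_trans by blast
qed

section \<open>The Jacobi symbol and its reciprocity law\<close>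

lemma not_is_unit_2: "\<not> is_unit (2 :: int)" by simp

lemma jacobi_mult:
  assumes "odd n"
  shows "jacobi (x * y) n = jacobi x n * jacobi y n"
proof -
  have "jacobi (x * y) n = (\<Prod>p\<in>#prime_factorization n. Legendre x p * Legendre y p)"
    unfolding jacobi_def
    by (intro arg_cong[where f = prod_mset] image_mset_cong Legendre_mult odd_prime_factor[OF assms])
  then show ?thesis unfolding jacobi_def by (simp add: prod_mset.distrib)
qed

lemma jacobi_cong:
  assumes "[x = y] (mod n)"
  shows "jacobi x n = jacobi y n"
  unfolding jacobi_def
proof (intro arg_cong[where f = prod_mset] image_mset_cong Legendre_cong)
  fix p assume "p \<in># prime_factorization n"
  then have "p dvd n" by (rule in_prime_factors_imp_dvd)
  then show "[x = y] (mod p)" using assms by (rule cong_dvd_modulus[rotated])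
qed

lemma prod_mset_unit:
  fixes f :: "'a \<Rightarrow> int"
  assumes "\<And>p. p \<in># M \<Longrightarrow> f p \<in> {-1, 1}"
  shows "(\<Prod>p\<in>#M. f p) \<in> {-1, 1}"
  using assms
proof (induction M)
  case (add x M)
  then have "f x \<in> {-1, 1}" "(\<Prod>p\<in>#M. f p) \<in> {-1, 1}" by simp_all
  then show ?case by (elim insertE emptyE) simp_all
qed simp

lemma Legendre_unit: "\<not> p dvd a \<Longrightarrow> Legendre a p \<in> {-1, 1}"
  by (simp add: Legendre_def cong_0_iff)

lemma jacobi_unit:
  assumes "coprime x n" 
  shows "jacobi x n \<in> {-1, 1}"
  unfolding jacobi_def
proof (rule prod_mset_unit, rule Legendre_unit)
  fix p assume p: "p \<in># prime_factorization n"
  then have "p dvd n" "prime p" by (auto intro: in_prime_factors_imp_prime in_prime_factors_imp_dvd)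
  then show "\<not> p dvd x" using assms by (meson coprime_common_divisor not_prime_unit)
qed

lemma prod_mset_prime_factorization_pos: "0 < n \<Longrightarrow> prod_mset (prime_factorization n) = n" for n :: int
  by (simp add: prod_mset_prime_factorization_int)

text \<open>The passage from prime moduli to composite ones: the characters modulo 4 and 8 agree with the product of their values at the prime factors.\<close>

lemma prod_mset_odd_mult:
  fixes g :: "int \<Rightarrow> int"
  assumes g: "g 1 = 1" "\<And>x y. odd x \<Longrightarrow> odd y \<Longrightarrow> g (x * y) = g x * g y" and n: "odd n" "0 < n"
  shows "(\<Prod>p\<in>#prime_factorization n. g p) = g n"
proof -
  have "(\<And>p. p \<in># M \<Longrightarrow> odd p) \<Longrightarrow> odd (prod_mset M) \<and> (\<Prod>p\<in>#M. g p) = g (prod_mset M)" for M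
  proof (induction M)
    case (add x M)
    then show ?case using g(2)[of x "prod_mset M"] by simp
  qed (simp add: g)
  from this[of "prime_factorization n"] show ?thesis
    using odd_prime_factor(2)[OF n(1)] prod_mset_prime_factorization_pos[OF n(2)] by metis
qed

lemma prod_mset_chi4: "odd n \<Longrightarrow> 0 < n \<Longrightarrow> (\<Prod>p\<in>#prime_factorization n. chi4 p) = chi4 n"
  by (rule prod_mset_odd_mult[OF _ chi4_mult]) (simp_all add: chi4_odd)

lemma jacobi_minus1:
  assumes "odd n" "0 < n"
  shows "jacobi (-1) n = chi4 n"
proof -
  have "jacobi (-1) n = (\<Prod>p\<in>#prime_factorization n. chi4 p)"
    unfolding jacobi_def
    by (intro arg_cong[where f = prod_mset] image_mset_cong Legendre_minus1 odd_prime_factor[OF assms(1)])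
  then show ?thesis using prod_mset_chi4[OF assms] by simp
qed

lemma jacobi_2:
  assumes "odd n" "0 < n"
  shows "jacobi 2 n = chi8 n"
proof -
  have "jacobi 2 n = (\<Prod>p\<in>#prime_factorization n. chi8 p)"
    unfolding jacobi_def
    by (intro arg_cong[where f = prod_mset] image_mset_cong Legendre_2 odd_prime_factor[OF assms(1)])
  also have "\<dots> = chi8 n" by (rule prod_mset_odd_mult[OF _ chi8_mult assms]) (simp add: chi8_odd)
  finally show ?thesis .
qed

lemma Legendre_reciprocity:
  fixes p q :: int
  assumes "prime p" "odd p" "prime q" "odd q" "p \<noteq> q"
  shows "Legendre p q = (if p mod 4 = 1 then 1 else chi4 q) * Legendre q p"
proof -
  have gt: "2 < p" "2 < q" using assms odd_prime_int_gt_2 by auto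
  have "Legendre p q * Legendre q p = (-1) ^ nat ((p - 1) div 2 * ((q - 1) div 2))"
    by (rule Quadratic_Reciprocity_int) (use assms gt in simp_all)
  also have "\<dots> = (if p mod 4 = 1 then 1 else chi4 q)"
  proof -
    have nn: "0 \<le> (p - 1) div 2 * ((q - 1) div 2)" using gt by simp
    have "even (nat ((p - 1) div 2 * ((q - 1) div 2))) \<longleftrightarrow> even ((p - 1) div 2) \<or> even ((q - 1) div 2)"
      using even_nat_iff[OF nn] by simp
    moreover have "even ((p - 1) div 2) \<longleftrightarrow> p mod 4 = 1" using \<open>odd p\<close> by presburger
    moreover have "even ((q - 1) div 2) \<longleftrightarrow> q mod 4 = 1" using \<open>odd q\<close> by presburger
    ultimately have "even (nat ((p - 1) div 2 * ((q - 1) div 2))) \<longleftrightarrow> p mod 4 = 1 \<or> q mod 4 = 1" by simp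
    then show ?thesis using chi4_odd[OF \<open>odd q\<close>] 
      by (cases "p mod 4 = 1"; cases "q mod 4 = 1") (simp_all add: minus_one_power_iff)
  qed
  finally have *: "Legendre p q * Legendre q p = (if p mod 4 = 1 then 1 else chi4 q)" .
  have "\<not> p dvd q" using assms primes_dvd_imp_eq by blast
  then have "Legendre q p \<in> {-1, 1}" by (rule Legendre_unit)
  then have "Legendre q p * Legendre q p = 1" by (elim insertE emptyE) simp_all
  then show ?thesis unfolding *[symmetric] by (simp add: mult.assoc)
qed

lemma Legendre_1: "1 < p \<Longrightarrow> Legendre 1 p = 1" for p :: int
proof -
  assume p: "1 < p"
  have "[1\<^sup>2 = 1] (mod p)" by simp
  then have "QuadRes p 1" unfolding QuadRes_def by blast
  moreover have "\<not> [1 = 0] (mod p)" using p by (simp add: Cong.cong_def)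
  ultimately show ?thesis by (simp add: Legendre_def)
qed

text \<open>With a prime upper entry, the law follows from the one for primes factor by factor.\<close>

lemma jacobi_reciprocity:
  fixes p n :: int
  assumes p: "prime p" "odd p" and n: "odd n" "0 < n" "\<not> p dvd n"
  shows "jacobi p n = (if p mod 4 = 1 then 1 else chi4 n) * Legendre n p"
proof -
  have p1: "1 < p" using p(1) prime_gt_1_int by blast
  have "(\<And>q. q \<in># M \<Longrightarrow> prime q \<and> odd q \<and> p \<noteq> q) \<Longrightarrow>
    (\<Prod>q\<in>#M. Legendre p q) = (if p mod 4 = 1 then 1 else \<Prod>q\<in>#M. chi4 q) * Legendre (prod_mset M) p" for M
  proof (induction M)
    case (add q M)
    have "(\<Prod>q\<in>#add_mset q M. Legendre p q) = Legendre p q * (\<Prod>q\<in>#M. Legendre p q)" by simp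
    also have "(\<Prod>q\<in>#M. Legendre p q) = (if p mod 4 = 1 then 1 else \<Prod>q\<in>#M. chi4 q) * Legendre (prod_mset M) p"
      using add by simp
    also have "Legendre p q = (if p mod 4 = 1 then 1 else chi4 q) * Legendre q p"
      using add.prems[of q] by (intro Legendre_reciprocity p) simp_all
    finally show ?case using Legendre_mult[OF p, of q "prod_mset M"] by simp
  qed (simp add: Legendre_1[OF p1])
  from this[of "prime_factorization n"]
  have "jacobi p n = (if p mod 4 = 1 then 1 else \<Prod>q\<in>#prime_factorization n. chi4 q) * Legendre n p"
    unfolding jacobi_def using odd_prime_factor[OF n(1)] n prod_mset_prime_factorization_pos[OF n(2)] by metis
  moreover have "(\<Prod>q\<in>#prime_factorization n. chi4 q) = chi4 n" by (rule prod_mset_chi4[OF n(1,2)])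
  ultimately show ?thesis by simp
qed

section \<open>The quadratic character\<close>

locale imaginary_quadratic =
  fixes m :: int
  assumes m_neg: "m < 0" and sqf: "squarefree m" and disc_lt: "quad_disc m < -4"
begin

definition D where "D = quad_disc m"
definition N where "N = \<bar>D\<bar>"
abbreviation "chi \<equiv> quad_char m"

lemma m_mod_4: "m mod 4 = 1 \<or> m mod 4 = 3 \<or> (m mod 4 = 2 \<and> odd (m div 2))"
proof -
  have "\<not> 4 dvd m"
  proof
    assume "4 dvd m"
    then have "2\<^sup>2 dvd m" by simp
    then have "is_unit (2 :: int)" using sqf unfolding squarefree_def by blast
    then show False by simp
  qed
  then show ?thesis by presburger
qed

lemma N_pos: "0 < N" and N_gt: "4 < N" and N_eq: "N = - D"
  using disc_lt by (simp_all add: N_def D_def)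

text \<open>The odd part of the absolute value of m; it is the modulus of the Jacobi symbol in each of the four cases of the character.\<close>

definition n0 :: int where "n0 = (if even m then \<bar>m div 2\<bar> else \<bar>m\<bar>)"

lemma n0: "odd n0" "0 < n0" "n0 dvd N" "even m \<Longrightarrow> 2 * n0 = - m" "odd m \<Longrightarrow> n0 = - m"
proof -
  show e: "even m \<Longrightarrow> 2 * n0 = - m" "odd m \<Longrightarrow> n0 = - m" using m_neg unfolding n0_def by auto
  show "odd n0"
  proof (cases "even m")
    case True
    then show ?thesis using m_mod_4 e(1) by presburger
  next
    case False
    then show ?thesis using e(2) by simp
  qed
  show "0 < n0" using e m_neg by (cases "even m") linarith+
  have "n0 dvd - m" by (cases "even m") (use e in \<open>metis dvd_triv_right dvd_refl\<close>)+
  then have "n0 dvd m" by simp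
  then show "n0 dvd N" by (simp add: N_def D_def quad_disc_def)
qed

text \<open>The case distinction of the definition of the character, with the facts about N and the residue of n0 modulo 4 that each case entails. The multiplicativity, periodicity and parity below are read off case by case.\<close>

lemma N_cases:
  obtains "m mod 4 = 1" "odd m" "n0 mod 4 = 3" "N = n0" "\<And>x. chi x = (if coprime x N then jacobi x n0 else 0)"
  | "m mod 4 = 3" "odd m" "n0 mod 4 = 1" "4 * n0 = N" "even N" "4 dvd N" "\<And>x. chi x = (if coprime x N then chi4 x * jacobi x n0 else 0)"
  | "even m" "n0 mod 4 = 3" "8 * n0 = N" "even N" "4 dvd N" "8 dvd N" "\<And>x. chi x = (if coprime x N then chi8 x * jacobi x n0 else 0)"
  | "even m" "n0 mod 4 = 1" "8 * n0 = N" "even N" "4 dvd N" "8 dvd N" "\<And>x. chi x = (if coprime x N then chi4 x * chi8 x * jacobi x n0 else 0)"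
proof -
  have g: "gcd x \<bar>quad_disc m\<bar> > 1 \<longleftrightarrow> \<not> coprime x N" for x
  proof -
    have "gcd x N > 0" using N_pos by simp
    then show ?thesis unfolding N_def[symmetric] D_def[symmetric] coprime_iff_gcd_eq_1 by linarith
  qed
  consider "m mod 4 = 1" | "m mod 4 = 3" | "m mod 4 = 2" "(m div 2) mod 4 = 1" | "m mod 4 = 2" "(m div 2) mod 4 = 3"
  proof -
    have "(m div 2) mod 4 = 1 \<or> (m div 2) mod 4 = 3" if "odd (m div 2)" using that by presburger
    then show ?thesis using that m_mod_4 by blast
  qed
  then show ?thesis
  proof cases
    case 1
    then have "odd m" by presburger
    then have n: "n0 = - m" using n0(5) by simp
    have "(- m) mod 4 = 3" using 1 by presburger
    moreover have "N = n0" using 1 m_neg by (simp add: n N_def D_def quad_disc_def)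
    moreover have "\<bar>m\<bar> = n0" using n m_neg by simp
    then have "chi x = (if coprime x N then jacobi x n0 else 0)" for x
      unfolding quad_char_def g using 1 by presburger
    ultimately show ?thesis using 1 \<open>odd m\<close> n by (intro that(1)) presburger+
  next
    case 2
    then have "odd m" by presburger
    then have n: "n0 = - m" using n0(5) by simp
    have "(- m) mod 4 = 1" using 2 by presburger
    moreover have N: "N = 4 * (- m)" using 2 m_neg by (simp add: N_def D_def quad_disc_def)
    moreover have "even N" "4 dvd N" unfolding N by simp_all
    moreover have a: "\<bar>m\<bar> = n0" using n m_neg by simp
    moreover have "chi x = (if coprime x N then chi4 x * jacobi x n0 else 0)" for x
      unfolding quad_char_def g a using 2 by simp
    ultimately show ?thesis using 2 \<open>odd m\<close> n by (intro that(2)) presburger+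
  next
    case 3
    then have "even m" by presburger
    then obtain a where a: "m = 2 * a" by (elim evenE)
    then have n: "n0 = - a" using n0(4)[OF \<open>even m\<close>] by linarith
    have "m div 2 = a" using a by simp
    then have "a mod 4 = 1" using 3(2) by simp
    then have "(- a) mod 4 = 3" by (simp add: zmod_zminus1_eq_if)
    moreover have "N = 4 * (- m)" using 3 m_neg by (simp add: N_def D_def quad_disc_def)
    then have N: "N = 8 * (- a)" using a by linarith
    moreover have "even N" "4 dvd N" "8 dvd N" unfolding N by simp_all
    moreover have "a < 0" using a m_neg by linarith
    moreover from this have b: "\<bar>m div 2\<bar> = n0" unfolding \<open>m div 2 = a\<close> n by simp
    have "8 * n0 = N" using n N by linarith
    moreover have "chi x = (if coprime x N then chi8 x * jacobi x n0 else 0)" for x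
      unfolding quad_char_def g b using 3 by simp
    ultimately show ?thesis using 3 \<open>even m\<close> n \<open>8 * n0 = N\<close> \<open>(- a) mod 4 = 3\<close> by (intro that(3)) (assumption | simp only:)+
  next
    case 4
    then have "even m" by presburger
    then obtain a where a: "m = 2 * a" by (elim evenE)
    then have n: "n0 = - a" using n0(4)[OF \<open>even m\<close>] by linarith
    have "m div 2 = a" using a by simp
    then have "a mod 4 = 3" using 4(2) by simp
    then have "(- a) mod 4 = 1" by (simp add: zmod_zminus1_eq_if)
    moreover have "N = 4 * (- m)" using 4 m_neg by (simp add: N_def D_def quad_disc_def)
    then have N: "N = 8 * (- a)" using a by linarith
    moreover have "even N" "4 dvd N" "8 dvd N" unfolding N by simp_all
    moreover have "a < 0" using a m_neg by linarith
    moreover from this have b: "\<bar>m div 2\<bar> = n0" unfolding \<open>m div 2 = a\<close> n by simp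
    have "8 * n0 = N" using n N by linarith
    moreover have "chi x = (if coprime x N then chi4 x * chi8 x * jacobi x n0 else 0)" for x
      unfolding quad_char_def g b using 4 by simp
    ultimately show ?thesis using 4 \<open>even m\<close> n \<open>8 * n0 = N\<close> \<open>(- a) mod 4 = 1\<close> by (intro that(4)) (assumption | simp only:)+
  qed
qed

lemma chi_mult: "chi (x * y) = chi x * chi y"
proof (cases "coprime x N \<and> coprime y N")
  case True
  then have "coprime (x * y) N" by simp
  show ?thesis
  proof (cases rule: N_cases)
    case 1
    then show ?thesis using True \<open>coprime (x * y) N\<close> by (simp add: jacobi_mult n0(1))
  next
    case 2
    then have "odd x" "odd y" using True by (meson coprime_common_divisor not_is_unit_2)+
    then show ?thesis using True \<open>coprime (x * y) N\<close> 2 by (simp add: jacobi_mult n0(1) chi4_mult)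
  next
    case 3
    then have "odd x" "odd y" using True by (meson coprime_common_divisor not_is_unit_2)+
    then show ?thesis using True \<open>coprime (x * y) N\<close> 3 by (simp add: jacobi_mult n0(1) chi8_mult)
  next
    case 4
    then have "odd x" "odd y" using True by (meson coprime_common_divisor not_is_unit_2)+
    then show ?thesis using True \<open>coprime (x * y) N\<close> 4 by (simp add: jacobi_mult n0(1) chi8_mult chi4_mult)
  qed
next
  case False
  then have "\<not> coprime (x * y) N" by simp
  then show ?thesis using False by (cases rule: N_cases) auto
qed

lemma chi_cong:
  assumes "[x = y] (mod N)"
  shows "chi x = chi y"
proof -
  have c: "coprime x N \<longleftrightarrow> coprime y N"
    using assms by (metis cong_imp_coprime cong_sym)
  have j: "jacobi x n0 = jacobi y n0" by (rule jacobi_cong, rule cong_dvd_modulus[OF assms n0(3)])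
  have e4: "chi4 x = chi4 y" if "4 dvd N" "odd x" "odd y"
    using cong_dvd_modulus[OF assms that(1)] that by (simp add: chi4_odd Cong.cong_def)
  have e8: "chi8 x = chi8 y" if "8 dvd N" "odd x" "odd y"
    using cong_dvd_modulus[OF assms that(1)] that by (simp add: chi8_odd Cong.cong_def)
  show ?thesis
  proof (cases "coprime x N")
    case True
    have o: "odd x" "odd y" if "even N"
      using True c that by (meson coprime_common_divisor not_is_unit_2)+
    show ?thesis using True c j e4 e8 o by (cases rule: N_cases) simp_all
  next
    case False
    then show ?thesis using c by (cases rule: N_cases) simp_all
  qed
qed

text \<open>The cases are designed so that the sign chi4(n0) contributed by the Jacobi symbol and the value of the factor chi4 at -1 always multiply to -1.\<close>

lemma chi_minus1: "chi (-1) = -1"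
  using n0(1,2) by (cases rule: N_cases) (simp_all add: jacobi_minus1 chi4_odd chi8_odd)

lemma chi_minus: "chi (- x) = - chi x"
  using chi_mult[of "-1" x] chi_minus1 by simp

lemma chi_not_coprime: "\<not> coprime x N \<Longrightarrow> chi x = 0"
  by (cases rule: N_cases) simp_all

lemma chi_coprime:
  assumes "coprime x N"
  shows "chi x \<in> {-1, 1}"
proof -
  have "coprime x n0" using assms n0(3) by (meson coprime_divisors dvd_refl)
  then have j: "jacobi x n0 \<in> {-1, 1}" by (rule jacobi_unit)
  have *: "chi4 x \<in> {-1, 1}" "chi8 x \<in> {-1, 1}" if "even N"
  proof -
    have "odd x" using assms that by (meson coprime_common_divisor not_is_unit_2)+
    then show "chi4 x \<in> {-1, 1}" "chi8 x \<in> {-1, 1}" by (simp_all add: chi4_odd chi8_odd)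
  qed
  have m: "u * v \<in> {-1, 1}" if "u \<in> {-1, 1}" "v \<in> {-1, 1}" for u v :: int
    using that by (elim insertE emptyE) simp_all
  have "chi4 x * jacobi x n0 \<in> {-1, 1}" "chi8 x * jacobi x n0 \<in> {-1, 1}" "chi4 x * chi8 x * jacobi x n0 \<in> {-1, 1}"
    if "even N" using j * that by (intro m; simp)+
  then show ?thesis using j assms by (cases rule: N_cases) (simp_all only: if_True)
qed

lemma chi_1: "chi 1 = 1"
  using chi_coprime[of 1] chi_mult[of 1 1] by auto

text \<open>This is where quadratic reciprocity enters: it exchanges the prime with the discriminant, so that chi decides how the prime splits.\<close>

lemma chi_odd_prime:
  assumes p: "prime p" "odd p" "\<not> p dvd N"
  shows "chi p = Legendre m p"
proof -
  have cop: "coprime p N" using p by (meson prime_imp_coprime)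
  have pn: "\<not> p dvd n0" using p n0(3) dvd_trans by blast
  have r: "jacobi p n0 = (if p mod 4 = 1 then 1 else chi4 n0) * Legendre n0 p"
    by (rule jacobi_reciprocity[OF p(1,2) n0(1,2) pn])
  have neg: "Legendre (- n0) p = chi4 p * Legendre n0 p"
    using Legendre_mult[OF p(1,2), of "-1" n0] Legendre_minus1[OF p(1,2)] by simp
  have L2: "Legendre (2 * (- n0)) p = chi8 p * (chi4 p * Legendre n0 p)"
    using Legendre_mult[OF p(1,2), of 2 "-n0"] Legendre_2[OF p(1,2)] neg by simp
  have c4: "chi4 p = (if p mod 4 = 1 then 1 else -1)" "chi4 n0 = (if n0 mod 4 = 1 then 1 else -1)"
    using chi4_odd p(2) n0(1) by blast+
  have Lo: "Legendre m p = chi4 p * Legendre n0 p" if "odd m" 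
  proof -
    have "m = - n0" using n0(5)[OF that] by linarith
    then show ?thesis using neg by metis
  qed
  have Le: "Legendre m p = chi8 p * (chi4 p * Legendre n0 p)" if "even m" 
  proof -
    have "m = 2 * (- n0)" using n0(4)[OF that] by linarith
    then show ?thesis using L2 by metis
  qed
  show ?thesis
    using Lo Le r cop c4
    by (cases rule: N_cases) simp_all
qed

text \<open>At the prime 2, splitting depends on D modulo 8, which is what the second supplement to the reciprocity law expresses.\<close>

lemma chi_2:
  assumes "odd D"
  shows "chi 2 = (if D mod 8 = 1 then 1 else -1)"
proof (cases rule: N_cases)
  case 1
  have "coprime 2 N" using assms N_eq by simp
  then have "chi 2 = chi8 n0" using 1 by (simp add: jacobi_2 n0(1,2))
  moreover have "D = - n0" using 1(4) N_eq by linarith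
  moreover have "n0 mod 8 = 1 \<or> n0 mod 8 = 7 \<longleftrightarrow> (- n0) mod 8 = 1"
  proof -
    have "n0 mod 8 = 3 \<or> n0 mod 8 = 7" using 1(3) by presburger
    then show ?thesis by (elim disjE) (simp_all add: zmod_zminus1_eq_if)
  qed
  ultimately show ?thesis by (simp add: chi8_odd n0(1))
qed (use assms N_eq in auto)

end

section \<open>The sums over the parts of the reduced residues\<close>

context imaginary_quadratic
begin

definition reps where "reps = reduced_residues N"

lemma reps_iff: "x \<in> reps \<longleftrightarrow> 0 < x \<and> x < N \<and> coprime x N"
  using N_gt unfolding reps_def reduced_residues_def coprime_iff_gcd_eq_1
  by (cases "x = N") auto

lemma finite_reps [simp]: "finite reps"
  unfolding reps_def reduced_residues_def by (rule finite_subset[of _ "{1..N}"]) auto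

lemma reps_bij_minus: "bij_betw (\<lambda>x. N - x) reps reps"
  by (rule bij_betw_byWitness[where f' = "\<lambda>x. N - x"])
     (auto simp: reps_iff coprime_iff_gcd_eq_1 gcd_diff1 gcd_diff2)

lemma chi_N_minus: "chi (N - x) = - chi x"
  using chi_cong[of "N - x" "- x"] chi_minus[of x] by (simp add: Cong.cong_def)

lemma reps_bij_mult:
  assumes "coprime B N"
  shows "bij_betw (\<lambda>x. (B * x) mod N) reps reps"
proof -
  have inj: "inj_on (\<lambda>x. (B * x) mod N) reps"
  proof (rule inj_onI)
    fix x y assume xy: "x \<in> reps" "y \<in> reps" and "(B * x) mod N = (B * y) mod N"
    then have "[B * x = B * y] (mod N)" by (simp add: Cong.cong_def)
    then have "[x = y] (mod N)" using assms by (simp add: cong_mult_lcancel)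
    then show "x = y" using xy unfolding reps_iff by (simp add: Cong.cong_def)
  qed
  have sub: "(\<lambda>x. (B * x) mod N) ` reps \<subseteq> reps"
  proof
    fix y assume "y \<in> (\<lambda>x. (B * x) mod N) ` reps"
    then obtain x where x: "x \<in> reps" "y = (B * x) mod N" by blast
    have "coprime (B * x) N" using x assms by (simp add: reps_iff)
    then have "coprime y N" unfolding x(2) using N_pos by (simp add: coprime_mod_left_iff del: coprime_mult_left_iff)
    moreover have "0 \<le> y" "y < N" unfolding x(2) using N_pos by simp_all
    moreover have "y \<noteq> 0" using \<open>coprime y N\<close> N_gt by auto
    ultimately show "y \<in> reps" by (simp add: reps_iff)
  qed
  show ?thesis unfolding bij_betw_def using inj endo_inj_surj[OF finite_reps sub inj] by simp
qed

lemma not_dvd_reps: "coprime B N \<Longrightarrow> x \<in> reps \<Longrightarrow> \<not> N dvd B * x"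
proof
  assume "coprime B N" "x \<in> reps" "N dvd B * x"
  then have "coprime (B * x) N" by (simp add: reps_iff)
  then have "is_unit N" using \<open>N dvd B * x\<close> by (meson coprime_common_divisor dvd_refl)
  then show False using N_gt by simp
qed

text \<open>The boundaries k N / B are never attained: B x is coprime to N, so it is not a multiple of N. Therefore the open intervals are the fibres of the integer quotient of B x by N.\<close>

lemma E_sum_eq:
  assumes "0 < B" "coprime B N"
  shows "E_sum m B k = (\<Sum>x | x \<in> reps \<and> (B * x) div N = k. chi x)"
proof -
  have "residues_part N B k = {x. x \<in> reps \<and> (B * x) div N = k}"
    unfolding residues_part_def reps_def[symmetric]
  proof (intro Collect_cong conj_cong refl)
    fix x assume x: "x \<in> reps"
    have "real_of_int (k * N) / real_of_int B < real_of_int x \<longleftrightarrow> k * N < B * x"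
      using assms(1) by (simp add: divide_less_eq mult.commute flip: of_int_mult)
    moreover have "real_of_int x < real_of_int ((k + 1) * N) / real_of_int B \<longleftrightarrow> B * x < (k + 1) * N"
      using assms(1) by (simp add: less_divide_eq mult.commute flip: of_int_mult)
    moreover have "k * N < B * x \<and> B * x < (k + 1) * N \<longleftrightarrow> (B * x) div N = k"
    proof
      assume "k * N < B * x \<and> B * x < (k + 1) * N"
      then show "(B * x) div N = k"
        by (intro int_div_pos_eq[of _ _ _ "B * x - N * k"]) (simp_all add: algebra_simps)
    next
      assume e: "(B * x) div N = k"
      have "B * x = k * N + (B * x) mod N" unfolding e[symmetric] by simp
      moreover have "0 < (B * x) mod N" using not_dvd_reps[OF assms(2) x] N_pos
        by (simp add: dvd_eq_mod_eq_0 order_less_le)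
      moreover have "(B * x) mod N < N" using N_pos by simp
      ultimately show "k * N < B * x \<and> B * x < (k + 1) * N" by (simp add: algebra_simps)
    qed
    ultimately show "real_of_int (k * N) / real_of_int B < real_of_int x \<and> real_of_int x < real_of_int ((k + 1) * N) / real_of_int B
      \<longleftrightarrow> (B * x) div N = k" by simp
  qed
  then show ?thesis unfolding E_sum_def D_def[symmetric] N_def[symmetric] by simp
qed

lemma div_range:
  assumes "0 < B" "x \<in> reps"
  shows "(B * x) div N \<in> {0..<B}"
proof -
  have "(B * x) div N * N + (B * x) mod N = B * x" by simp
  moreover have "0 \<le> (B * x) mod N" using N_pos by simp
  moreover have "B * x < B * N" using assms by (simp add: reps_iff)
  ultimately have "(B * x) div N * N < B * N" by linarith
  then have "(B * x) div N < B" using N_pos by simp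
  then show ?thesis using assms N_pos by (simp add: reps_iff pos_imp_zdiv_nonneg_iff)
qed

lemma sum_E_sum:
  assumes "0 < B" "coprime B N"
  shows "(\<Sum>k\<in>{0..<B}. w k * E_sum m B k) = (\<Sum>x\<in>reps. w ((B * x) div N) * chi x)"
proof -
  have "(\<Sum>x\<in>reps. w ((B * x) div N) * chi x) = (\<Sum>k\<in>{0..<B}. \<Sum>x\<in>{x\<in>reps. (B * x) div N = k}. w ((B * x) div N) * chi x)"
    by (rule sum.group[symmetric]) (use div_range[OF assms(1)] in auto)
  also have "\<dots> = (\<Sum>k\<in>{0..<B}. w k * E_sum m B k)"
    unfolding E_sum_eq[OF assms] sum_distrib_left by (intro sum.cong refl) auto
  finally show ?thesis ..
qed

text \<open>The reflection of x to N - x exchanges the k-th interval with the one at B - 1 - k, and the character is odd.\<close>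

lemma E_sum_reflect:
  assumes "0 < B" "coprime B N"
  shows "E_sum m B (B - 1 - k) = - E_sum m B k"
proof -
  have r: "(B * (N - x)) div N = B - 1 - (B * x) div N" if "x \<in> reps" for x
  proof -
    have "(B * (N - x)) div N = (B * N + - (B * x)) div N" by (simp add: algebra_simps)
    also have "\<dots> = B + (- (B * x)) div N" using N_pos by (intro div_mult_self3) simp
    also have "(- (B * x)) div N = - ((B * x) div N) - 1"
      using not_dvd_reps[OF assms(2) that] N_pos by (simp add: zdiv_zminus1_eq_if dvd_eq_mod_eq_0)
    finally show ?thesis by simp
  qed
  have XN: "N - x \<in> reps" if "x \<in> reps" for x
    using reps_bij_minus that by (meson bij_betwE)
  have "bij_betw (\<lambda>x. N - x) {x. x \<in> reps \<and> (B * x) div N = k} {x. x \<in> reps \<and> (B * x) div N = B - 1 - k}"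
    by (rule bij_betw_byWitness[where f' = "\<lambda>x. N - x"]) (use XN r in auto)
  from sum.reindex_bij_betw[OF this, of chi]
  show ?thesis unfolding E_sum_eq[OF assms] by (simp add: chi_N_minus sum_negf)
qed

text \<open>Multiplication by B permutes the reduced residues, and the value of the character at x equals chi(B) times its value at B x, because chi(B) is its own inverse.\<close>

lemma sum_mult_mod:
  assumes "coprime B N"
  shows "(\<Sum>x\<in>reps. ((B * x) mod N) * chi x) = chi B * (\<Sum>x\<in>reps. x * chi x)"
proof -
  have "chi B * chi B = 1" using chi_coprime[OF assms] by auto
  then have "chi x = chi B * chi ((B * x) mod N)" for x
    using chi_cong[of "(B * x) mod N" "B * x"] chi_mult[of B x] by (simp add: mult.assoc[symmetric])
  then have "(\<Sum>x\<in>reps. ((B * x) mod N) * chi x) = (\<Sum>x\<in>reps. ((B * x) mod N) * (chi B * chi ((B * x) mod N)))"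
    by (intro sum.cong refl) metis
  also have "\<dots> = (\<Sum>y\<in>reps. y * (chi B * chi y))"
    by (rule sum.reindex_bij_betw[OF reps_bij_mult[OF assms]])
  finally show ?thesis by (simp add: sum_distrib_left algebra_simps)
qed

lemma sum_chi_reps: "(\<Sum>x\<in>reps. chi x) = 0"
proof -
  have "(\<Sum>x\<in>reps. chi (N - x)) = (\<Sum>x\<in>reps. chi x)"
    by (rule sum.reindex_bij_betw[OF reps_bij_minus])
  then show ?thesis by (simp add: chi_N_minus sum_negf)
qed

lemma weighted_E_sums:
  assumes B: "1 < B" "coprime B N" and h: "N * h = - (\<Sum>x\<in>reps. x * chi x)"
  shows "(\<Sum>k = 0..\<lfloor>real_of_int B / 2\<rfloor> - 1. (B - 1 - 2 * k) * E_sum m B k) = (B - chi B) * h"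
proof -
  have B0: "0 < B" using B by simp
  let ?f = "\<lambda>k. (B - 1 - 2 * k) * E_sum m B k"
  have fl: "\<lfloor>real_of_int B / 2\<rfloor> = B div 2"
    using floor_divide_of_int_eq[of B 2] by simp
  have set1: "{0..\<lfloor>real_of_int B / 2\<rfloor> - 1} = {0..<B div 2}" unfolding fl by auto
  have f_refl: "?f (B - 1 - k) = ?f k" for k
    unfolding E_sum_reflect[OF B0 B(2)] by (simp add: algebra_simps)
  have upper: "(\<Sum>k\<in>{B - B div 2..<B}. ?f k) = (\<Sum>k\<in>{0..<B div 2}. ?f k)"
  proof -
    have "bij_betw (\<lambda>k. B - 1 - k) {0..<B div 2} {B - B div 2..<B}"
      by (rule bij_betw_byWitness[where f' = "\<lambda>k. B - 1 - k"]) auto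
    from sum.reindex_bij_betw[OF this, of ?f] show ?thesis using f_refl by (metis (no_types, lifting) sum.cong)
  qed
  \<comment> \<open>This range is empty for even B; for odd B it consists of the middle index, whose weight vanishes.\<close>
  have mid: "(\<Sum>k\<in>{B div 2..<B - B div 2}. ?f k) = 0"
  proof (rule sum.neutral, rule ballI)
    fix k assume "k \<in> {B div 2..<B - B div 2}"
    then have "B - 1 - 2 * k = 0" by (simp, presburger)
    then show "?f k = 0" by (simp only: mult_zero_left)
  qed
  have "{0..<B} = {0..<B div 2} \<union> ({B div 2..<B - B div 2} \<union> {B - B div 2..<B})"
    using B by auto
  then have "(\<Sum>k\<in>{0..<B}. ?f k) = (\<Sum>k\<in>{0..<B div 2}. ?f k) + ((\<Sum>k\<in>{B div 2..<B - B div 2}. ?f k) + (\<Sum>k\<in>{B - B div 2..<B}. ?f k))"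
    by (simp only:) (subst sum.union_disjoint; (subst sum.union_disjoint)?; auto)
  then have two: "2 * (\<Sum>k\<in>{0..<B div 2}. ?f k) = (\<Sum>k\<in>{0..<B}. ?f k)" using upper mid by simp
  have "N * (\<Sum>k\<in>{0..<B}. ?f k) = (\<Sum>x\<in>reps. (N * (B - 1) - 2 * (N * ((B * x) div N))) * chi x)"
    unfolding sum_E_sum[OF B0 B(2), of "\<lambda>k. B - 1 - 2 * k"] sum_distrib_left
    by (intro sum.cong refl) (simp add: algebra_simps)
  also have "\<dots> = (\<Sum>x\<in>reps. N * (B - 1) * chi x - 2 * B * (x * chi x) + 2 * (((B * x) mod N) * chi x))"
    by (intro sum.cong refl) (simp add: algebra_simps flip: minus_mult_div_eq_mod)
  also have "\<dots> = N * (B - 1) * (\<Sum>x\<in>reps. chi x) - 2 * B * (\<Sum>x\<in>reps. x * chi x) + 2 * (\<Sum>x\<in>reps. ((B * x) mod N) * chi x)"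
    by (simp add: sum.distrib sum_subtractf sum_distrib_left)
  also have "\<dots> = 2 * (chi B - B) * (\<Sum>x\<in>reps. x * chi x)"
    unfolding sum_chi_reps sum_mult_mod[OF B(2)] by (simp add: algebra_simps)
  also have "(\<Sum>x\<in>reps. x * chi x) = - (N * h)" using h by simp
  also have "2 * (chi B - B) * - (N * h) = N * (2 * ((B - chi B) * h))"
    by (simp add: algebra_simps)
  finally have "(\<Sum>k\<in>{0..<B}. ?f k) = 2 * ((B - chi B) * h)" using N_pos by simp
  then show ?thesis unfolding set1 using two by simp
qed

text \<open>Dividing B1 B2 x first by N and then by B2 is the same as dividing B1 x by N. So the interval number k for B1 is the union of the B2 intervals with numbers k B2 + j for B1 B2.\<close>

lemma E_sum_merge:
  assumes "0 < B1" "0 < B2" "coprime (B1 * B2) N"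
  shows "(\<Sum>j = 0..B2 - 1. E_sum m (B1 * B2) (k * B2 + j)) = E_sum m B1 k"
proof -
  have c: "coprime B1 N" using assms(3) by simp
  have d: "(B1 * x) div N = (B1 * B2 * x) div N div B2" for x
  proof -
    have "(B1 * x * B2) div N div B2 = (B1 * x * B2) div (N * B2)"
      using assms by (simp only: zdiv_zmult2_eq[of B2] less_imp_le)
    also have "\<dots> = (B1 * x) div N" using assms by simp
    also have "B1 * x * B2 = B1 * B2 * x" by simp
    finally show ?thesis ..
  qed
  let ?A = "{x. x \<in> reps \<and> (B1 * x) div N = k}"
  have "E_sum m B1 k = (\<Sum>x\<in>?A. chi x)" by (rule E_sum_eq[OF assms(1) c])
  also have "\<dots> = (\<Sum>j = 0..B2 - 1. \<Sum>x\<in>{x\<in>?A. (B1 * B2 * x) div N mod B2 = j}. chi x)"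
    by (rule sum.group[symmetric]) (use assms in auto)
  also have "\<dots> = (\<Sum>j = 0..B2 - 1. E_sum m (B1 * B2) (k * B2 + j))"
  proof (intro sum.cong refl)
    fix j assume j: "j \<in> {0..B2 - 1}"
    have "q div B2 = k \<and> q mod B2 = j \<longleftrightarrow> q = k * B2 + j" for q
    proof
      assume "q = k * B2 + j"
      then show "q div B2 = k \<and> q mod B2 = j" using j by simp
    qed (metis div_mult_mod_eq)
    then have "{x\<in>?A. (B1 * B2 * x) div N mod B2 = j} = {x. x \<in> reps \<and> (B1 * B2 * x) div N = k * B2 + j}"
      unfolding d by auto
    then show "(\<Sum>x\<in>{x\<in>?A. (B1 * B2 * x) div N mod B2 = j}. chi x) = E_sum m (B1 * B2) (k * B2 + j)"
      using E_sum_eq[OF _ assms(3)] assms by simp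
  qed
  finally show ?thesis ..
qed

end

section \<open>Gaussian sums over shifted integers\<close>

lemma has_sum_int_imp_tendsto:
  fixes f :: "int \<Rightarrow> real"
  assumes "(f has_sum S) UNIV"
  shows "(\<lambda>K. \<Sum>n\<in>{- int K..<int K}. f n) \<longlonglongrightarrow> S"
proof -
  have "filterlim (\<lambda>K. {- int K..<int K}) (finite_subsets_at_top UNIV) sequentially"
    unfolding filterlim_finite_subsets_at_top
  proof safe
    fix A :: "int set" assume "finite A"
    then obtain b where b: "\<And>x. x \<in> A \<Longrightarrow> \<bar>x\<bar> \<le> b"
      by (metis (no_types, lifting) bdd_above_def bdd_above.unfold finite_imageI bdd_above_finite image_eqI)
    show "\<forall>\<^sub>F K in sequentially. finite {- int K..<int K} \<and> A \<subseteq> {- int K..<int K} \<and> {- int K..<int K} \<subseteq> UNIV"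
    proof (rule eventually_sequentiallyI[of "nat (b + 1)"], safe)
      fix K x assume "nat (b + 1) \<le> K" "x \<in> A"
      then show "x \<in> {- int K..<int K}" using b[of x] by auto
    qed auto
  qed
  then show ?thesis using assms unfolding has_sum_def by (rule filterlim_compose[rotated])
qed

lemma sum_symmetric_Suc:
  fixes f :: "int \<Rightarrow> 'a :: comm_monoid_add"
  shows "(\<Sum>n\<in>{- int (Suc K)..<int (Suc K)}. f n) = (\<Sum>n\<in>{- int K..<int K}. f n) + (f (int K) + f (- int K - 1))"
proof -
  have "{- int (Suc K)..<int (Suc K)} = insert (int K) (insert (- int K - 1) {- int K..<int K})" by auto
  then show ?thesis by (simp add: algebra_simps)
qed

lemma sum_symmetric_telescope:
  fixes F :: "real \<Rightarrow> real"
  shows "(\<Sum>n\<in>{- int K..<int K}. F (of_int n + 1) - F (of_int n)) = F (real K) - F (- real K)"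
proof (induction K)
  case (Suc K)
  have e: "of_int (int K) + 1 = real (Suc K)" "of_int (int K) = real K"
    "of_int (- int K - 1) + 1 = - real K" "of_int (- int K - 1) = - real (Suc K)" by simp_all
  show ?case unfolding sum_symmetric_Suc Suc.IH e by (simp add: add.commute)
qed simp

text \<open>The terms with nonnegative and with negative index are each dominated by a geometric series with ratio exp(- s).\<close>

lemma sum_exp_abs_le:
  fixes s \<beta> :: real
  assumes "0 < s" "0 \<le> \<beta>" "\<beta> \<le> 1"
  shows "(\<Sum>n\<in>{- int K..<int K}. exp (- \<bar>s * (of_int n + \<beta>)\<bar>)) \<le> 2 / (1 - exp (- s))"
proof -
  define q where "q = exp (- s)"
  have q: "0 < q" "q < 1" using assms by (simp_all add: q_def)
  have "(\<Sum>n\<in>{- int K..<int K}. exp (- \<bar>s * (of_int n + \<beta>)\<bar>)) \<le> 2 * (\<Sum>k<K. q ^ k)"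
  proof (induction K)
    case (Suc K)
    have qK: "q ^ K = exp (- (s * real K))" by (simp add: q_def flip: exp_of_nat_mult)
    have "exp (- \<bar>s * (of_int (int K) + \<beta>)\<bar>) \<le> q ^ K"
      unfolding qK using assms by (simp add: abs_mult)
    moreover have "exp (- \<bar>s * (of_int (- int K - 1) + \<beta>)\<bar>) \<le> q ^ K"
    proof -
      have "real K \<le> \<bar>of_int (- int K - 1) + \<beta>\<bar>" using assms by (simp add: abs_if)
      then have "s * real K \<le> s * \<bar>of_int (- int K - 1) + \<beta>\<bar>" using assms by (intro mult_left_mono) simp_all
      then show ?thesis unfolding qK using assms by (simp add: abs_mult)
    qed
    ultimately show ?case unfolding sum_symmetric_Suc using Suc.IH by (simp add: algebra_simps)
  qed simp
  also have "(\<Sum>k<K. q ^ k) \<le> 1 / (1 - q)"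
    using q by (simp add: sum_gp_strict divide_right_mono)
  finally show ?thesis unfolding q_def by simp
qed

lemma one_minus_exp_ge:
  fixes s :: real
  assumes "0 < s" "s \<le> 1"
  shows "s / 2 \<le> 1 - exp (- s)"
proof -
  have "1 + s \<le> exp s" by (rule exp_ge_add_one_self)
  then have "exp (- s) \<le> 1 / (1 + s)" using assms by (simp add: exp_minus field_simps)
  also have "\<dots> \<le> 1 - s / 2"
  proof -
    have "1 \<le> (1 - s / 2) * (1 + s)" using assms mult_left_mono[of s 1 s] by (simp add: algebra_simps)
    then show ?thesis using assms by (simp add: divide_le_eq)
  qed
  finally show ?thesis by simp
qed

lemma exp_minus_square_le: "exp (- (u\<^sup>2)) \<le> 2 * exp (- \<bar>u\<bar>)" for u :: real
proof -
  have "0 \<le> (\<bar>u\<bar> - 1 / 2)\<^sup>2" by simp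
  then have "- (u\<^sup>2) \<le> 1 / 4 + - \<bar>u\<bar>" by (simp add: power2_eq_square algebra_simps)
  then have "exp (- (u\<^sup>2)) \<le> exp (1 / 4) * exp (- \<bar>u\<bar>)" by (simp flip: exp_add)
  also have "exp (1 / 4) \<le> (2 :: real)" using exp_bound[of "1/4"] by (simp add: power2_eq_square)
  finally show ?thesis by simp
qed

text \<open>A Gaussian and its first three derivatives. The bound for the third one shows that a Gaussian sum depends on the shift only to order s^2. In the two-dimensional sums below this is multiplied by a factor of order 1/s, so order s, which two derivatives would give, does not suffice.\<close>

definition gauss :: "real \<Rightarrow> real \<Rightarrow> real" where "gauss s x = exp (- ((s * x)\<^sup>2))"
definition gauss1 :: "real \<Rightarrow> real \<Rightarrow> real" where "gauss1 s x = - 2 * s\<^sup>2 * x * gauss s x"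
definition gauss2 :: "real \<Rightarrow> real \<Rightarrow> real" where "gauss2 s x = (4 * s ^ 4 * x\<^sup>2 - 2 * s\<^sup>2) * gauss s x"
definition gauss3 :: "real \<Rightarrow> real \<Rightarrow> real" where "gauss3 s x = (12 * s ^ 4 * x - 8 * s ^ 6 * x ^ 3) * gauss s x"

lemma gauss_deriv: "(gauss s has_real_derivative gauss1 s x) (at x)"
  unfolding gauss_def[abs_def] gauss1_def
  by (auto intro!: derivative_eq_intros simp: power2_eq_square algebra_simps)

lemma gauss1_deriv: "(gauss1 s has_real_derivative gauss2 s x) (at x)"
  unfolding gauss1_def[abs_def] gauss2_def
  by (rule derivative_eq_intros gauss_deriv refl)+ (simp add: gauss1_def power2_eq_square power4_eq_xxxx algebra_simps)

lemma gauss2_deriv: "(gauss2 s has_real_derivative gauss3 s x) (at x)"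
  unfolding gauss2_def[abs_def] gauss3_def
  by (rule derivative_eq_intros gauss_deriv refl)+ (simp add: gauss1_def eval_nat_numeral algebra_simps)

lemma gauss3_bound:
  assumes "0 < s"
  shows "\<bar>gauss3 s x\<bar> \<le> 20 * exp 4 * s ^ 3 * exp (- \<bar>s * x\<bar>)"
proof -
  define v where "v = \<bar>s * x\<bar>"
  have v: "0 \<le> v" by (simp add: v_def)
  have "gauss3 s x = s ^ 3 * ((12 * (s * x) - 8 * (s * x) ^ 3) * exp (- (v\<^sup>2)))"
    unfolding gauss3_def gauss_def v_def by (simp add: eval_nat_numeral algebra_simps)
  \<comment> \<open>With v the absolute value of s x, the polynomial factor is at most 20 exp(3 v), and 4 v - v^2 is at most 4.\<close>
  then have "\<bar>gauss3 s x\<bar> = s ^ 3 * (\<bar>12 * (s * x) - 8 * (s * x) ^ 3\<bar> * exp (- (v\<^sup>2)))"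
    using assms by (simp add: abs_mult)
  also have "\<bar>12 * (s * x) - 8 * (s * x) ^ 3\<bar> \<le> 12 * v + 8 * v ^ 3"
    unfolding v_def using abs_triangle_ineq4[of "12 * (s * x)" "8 * (s * x) ^ 3"] by (simp add: abs_mult power_abs)
  also have "12 * v + 8 * v ^ 3 \<le> 20 * exp (3 * v)"
  proof -
    have le: "v \<le> exp v" using exp_ge_add_one_self[of v] by linarith
    have "v ^ 3 \<le> exp v ^ 3" using le v by (rule power_mono)
    then have "v ^ 3 \<le> exp (3 * v)" by (simp flip: exp_of_nat_mult)
    moreover have "v \<le> exp (3 * v)" using le v by (meson exp_le_cancel_iff order_trans mult_le_cancel_right1 one_le_numeral not_less)
    ultimately show ?thesis by linarith
  qed
  also have "exp (3 * v) * exp (- (v\<^sup>2)) \<le> exp 4 * exp (- v)"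
  proof -
    have "0 \<le> (v - 2)\<^sup>2" by simp
    then have "3 * v + - (v\<^sup>2) \<le> 4 + - v" by (simp add: power2_eq_square algebra_simps)
    then show ?thesis by (simp flip: exp_add)
  qed
  then have "20 * exp (3 * v) * exp (- (v\<^sup>2)) \<le> 20 * exp 4 * exp (- v)" by simp
  finally show ?thesis using assms by (simp add: v_def mult_ac mult_left_mono)
qed

text \<open>Together with the next lemma this replaces Poisson summation. A derivative of a nearly periodic function has a mean value close to 0, so a bound for one derivative is inherited by the previous one.\<close>

lemma oscillation_le_deriv_bound:
  fixes H H' :: "real \<Rightarrow> real"
  assumes d: "\<And>x. (H has_real_derivative H' x) (at x)"
    and b: "\<And>x. 0 \<le> x \<Longrightarrow> x \<le> 1 \<Longrightarrow> \<bar>H' x\<bar> \<le> M"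
    and "0 \<le> x" "x \<le> 1" "0 \<le> y" "y \<le> 1"
  shows "\<bar>H x - H y\<bar> \<le> M"
proof -
  have M: "0 \<le> M" using b[of 0] by simp
  have "norm (H x - H y) \<le> M * norm (x - y)"
    by (rule field_differentiable_bound[of "{0..1}" H H'])
       (use assms in \<open>auto intro: has_field_derivative_at_within\<close>)
  also have "\<dots> \<le> M * 1" using assms M by (intro mult_left_mono) auto
  finally show ?thesis by simp
qed

lemma exists_mean_value:
  fixes H H' :: "real \<Rightarrow> real"
  assumes d: "\<And>x. (H has_real_derivative H' x) (at x)"
  shows "\<exists>z. 0 \<le> z \<and> z \<le> 1 \<and> H' z = H 1 - H 0"
  using MVT2[of 0 1 H H'] assms by (auto intro: less_imp_le)

text \<open>The functions H1 and H2 take their mean values over the unit interval somewhere. These means are the increments of H0 and H1, so the bound for H3 descends to H2, to H1 and finally to the oscillation of H0.\<close>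

lemma three_derivative_bound:
  fixes H0 H1 H2 H3 :: "real \<Rightarrow> real"
  assumes d0: "\<And>x. (H0 has_real_derivative H1 x) (at x)"
    and d1: "\<And>x. (H1 has_real_derivative H2 x) (at x)"
    and d2: "\<And>x. (H2 has_real_derivative H3 x) (at x)"
    and b: "\<And>x. 0 \<le> x \<Longrightarrow> x \<le> 1 \<Longrightarrow> \<bar>H3 x\<bar> \<le> M"
    and per: "H0 1 = H0 0"
    and x: "0 \<le> x" "x \<le> 1"
  shows "\<bar>H0 x - H0 0\<bar> \<le> M + \<bar>H1 1 - H1 0\<bar>"
proof -
  obtain z where z: "0 \<le> z" "z \<le> 1" "H2 z = H1 1 - H1 0" using exists_mean_value[OF d1] by blast
  have b2: "\<bar>H2 x\<bar> \<le> M + \<bar>H1 1 - H1 0\<bar>" if "0 \<le> x" "x \<le> 1" for x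
    using oscillation_le_deriv_bound[OF d2 b that z(1,2)] z(3) by linarith
  obtain y where y: "0 \<le> y" "y \<le> 1" "H1 y = 0" using exists_mean_value[OF d0] per by auto
  have b1: "\<bar>H1 x\<bar> \<le> M + \<bar>H1 1 - H1 0\<bar>" if "0 \<le> x" "x \<le> 1" for x
    using oscillation_le_deriv_bound[OF d1 b2 that y(1,2)] y(3) by simp
  show ?thesis by (rule oscillation_le_deriv_bound[OF d0 b1 x]) simp_all
qed

lemma gauss1_tendsto_0:
  assumes "0 < s"
  shows "(\<lambda>K. gauss1 s (real K)) \<longlonglongrightarrow> 0"
proof -
  show ?thesis
  proof (rule Lim_null_comparison)
    show "(\<lambda>K. 2 / real K) \<longlonglongrightarrow> 0" by (rule lim_const_over_n)
    show "\<forall>\<^sub>F K in sequentially. norm (gauss1 s (real K)) \<le> 2 / real K"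
    proof (rule eventually_sequentiallyI[of 1])
      fix K :: nat assume K: "1 \<le> K"
      define u where "u = (s * real K)\<^sup>2"
      have u: "0 < u" using assms K by (simp add: u_def)
      have "1 + u \<le> exp u" by (rule exp_ge_add_one_self)
      then have "u \<le> exp u" by linarith
      then have "exp (- u) \<le> 1 / u" using u by (simp add: exp_minus divide_simps)
      have "norm (gauss1 s (real K)) = 2 * s\<^sup>2 * real K * exp (- u)"
        using assms by (simp add: gauss1_def gauss_def u_def abs_mult)
      also have "\<dots> \<le> 2 * s\<^sup>2 * real K * (1 / u)"
        using \<open>exp (- u) \<le> 1 / u\<close> by (intro mult_left_mono) simp_all
      also have "\<dots> = 2 / real K" using assms K by (simp add: u_def power2_eq_square)
      finally show "norm (gauss1 s (real K)) \<le> 2 / real K" .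
    qed
  qed
qed

definition theta1 :: "real \<Rightarrow> real \<Rightarrow> real" where
  "theta1 s \<beta> = (\<Sum>\<^sub>\<infinity>n::int. gauss s (of_int n + \<beta>))"

lemma gauss_sum_le:
  assumes "0 < s" "0 \<le> \<beta>" "\<beta> \<le> 1"
  shows "(\<Sum>n\<in>{- int K..<int K}. gauss s (of_int n + \<beta>)) \<le> 4 / (1 - exp (- s))"
proof -
  have "(\<Sum>n\<in>{- int K..<int K}. gauss s (of_int n + \<beta>)) \<le> (\<Sum>n\<in>{- int K..<int K}. 2 * exp (- \<bar>s * (of_int n + \<beta>)\<bar>))"
    unfolding gauss_def by (intro sum_mono exp_minus_square_le)
  also have "\<dots> \<le> 2 * (2 / (1 - exp (- s)))"
    unfolding sum_distrib_left[symmetric] by (intro mult_left_mono sum_exp_abs_le assms) simp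
  finally show ?thesis by simp
qed

lemma gauss_summable_01:
  assumes "0 < s" "0 \<le> \<beta>" "\<beta> \<le> 1"
  shows "(\<lambda>n::int. gauss s (of_int n + \<beta>)) summable_on UNIV"
proof (rule nonneg_bounded_partial_sums_imp_summable_on)
  show "\<forall>\<^sub>F F in finite_subsets_at_top UNIV. (\<Sum>n\<in>F. gauss s (of_int n + \<beta>)) \<le> 4 / (1 - exp (- s))"
  proof (rule eventually_finite_subsets_at_top_weakI)
    fix F :: "int set" assume "finite F"
    then obtain b where b: "\<And>x. x \<in> F \<Longrightarrow> \<bar>x\<bar> \<le> b"
      by (metis (no_types, lifting) bdd_above_def bdd_above.unfold finite_imageI bdd_above_finite image_eqI)
    have "(\<Sum>n\<in>F. gauss s (of_int n + \<beta>)) \<le> (\<Sum>n\<in>{- int (nat (b + 1))..<int (nat (b + 1))}. gauss s (of_int n + \<beta>))"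
    proof (rule sum_mono2)
      show "F \<subseteq> {- int (nat (b + 1))..<int (nat (b + 1))}" using b by force
    qed (auto simp: gauss_def)
    also note gauss_sum_le[OF assms]
    finally show "(\<Sum>n\<in>F. gauss s (of_int n + \<beta>)) \<le> 4 / (1 - exp (- s))" .
  qed
qed (simp add: gauss_def)

lemma bij_int_shift: "bij_betw (\<lambda>n. n + k) UNIV (UNIV :: int set)"
  by (rule bij_betw_byWitness[where f' = "\<lambda>n. n - k"]) auto

lemma gauss_frac:
  "(\<lambda>n::int. gauss s (of_int n + \<beta>)) = (\<lambda>n. gauss s (of_int (n + \<lfloor>\<beta>\<rfloor>) + frac \<beta>))"
  by (simp add: frac_def)

lemma gauss_summable:
  assumes "0 < s"
  shows "(\<lambda>n::int. gauss s (of_int n + \<beta>)) summable_on UNIV"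
proof -
  have "(\<lambda>n::int. gauss s (of_int n + frac \<beta>)) summable_on UNIV"
    by (rule gauss_summable_01[OF assms]) (simp_all add: less_imp_le[OF frac_lt_1])
  then show ?thesis unfolding gauss_frac[of s \<beta>]
    using summable_on_reindex_bij_betw[OF bij_int_shift[of "\<lfloor>\<beta>\<rfloor>"], of "\<lambda>n. gauss s (of_int n + frac \<beta>)"] by simp
qed

lemma theta1_frac: "theta1 s \<beta> = theta1 s (frac \<beta>)"
  unfolding theta1_def gauss_frac[of s \<beta>]
  using infsum_reindex_bij_betw[OF bij_int_shift[of "\<lfloor>\<beta>\<rfloor>"], of "\<lambda>n. gauss s (of_int n + frac \<beta>)"] by simp

lemma theta1_tendsto:
  assumes "0 < s"
  shows "(\<lambda>K. \<Sum>n\<in>{- int K..<int K}. gauss s (of_int n + \<beta>)) \<longlonglongrightarrow> theta1 s \<beta>"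
  unfolding theta1_def using gauss_summable[OF assms] by (intro has_sum_int_imp_tendsto has_sum_infsum)

lemma theta1_nonneg: "0 \<le> theta1 s \<beta>"
  unfolding theta1_def by (rule infsum_nonneg) (simp add: gauss_def)

lemma theta1_le:
  assumes "0 < s" "s \<le> 1"
  shows "theta1 s \<beta> \<le> 8 / s"
proof -
  have "theta1 s (frac \<beta>) \<le> 4 / (1 - exp (- s))"
    by (rule LIMSEQ_le_const2[OF theta1_tendsto[OF assms(1)]])
       (use gauss_sum_le[OF assms(1)] in \<open>auto simp: less_imp_le[OF frac_lt_1]\<close>)
  also have "\<dots> \<le> 4 / (s / 2)"
    using one_minus_exp_ge[OF assms] assms by (intro divide_left_mono) auto
  finally show ?thesis unfolding theta1_frac[of s \<beta>] by simp
qed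

text \<open>Poisson summation would give that the sum depends on the shift only by an exponentially small amount. For what follows the order s^2 suffices. The three-derivative argument is applied to finite symmetric partial sums: their increments over a unit shift telescope to boundary terms, which vanish in the limit.\<close>

lemma theta1_shift_01:
  assumes s: "0 < s" "s \<le> 1" and \<beta>: "0 \<le> \<beta>" "\<beta> \<le> 1"
  shows "\<bar>theta1 s \<beta> - theta1 s 0\<bar> \<le> 80 * exp 4 * s\<^sup>2"
proof -
  let ?H = "\<lambda>g K x. \<Sum>n\<in>{- int K..<int K}. g s (of_int n + x) :: real"
  let ?M = "80 * exp 4 * s\<^sup>2"
  have d: "(?H g K has_real_derivative ?H g' K x) (at x)"
    if "\<And>x. (g s has_real_derivative g' s x) (at x)" for g g' :: "real \<Rightarrow> real \<Rightarrow> real" and K x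
  proof (rule DERIV_sum)
    fix n :: int
    show "((\<lambda>x. g s (of_int n + x)) has_real_derivative g' s (of_int n + x)) (at x)"
      using that[of "of_int n + x"] by (simp add: DERIV_shift add.commute)
  qed
  have le: "\<bar>?H gauss K \<beta> - ?H gauss K 0\<bar> \<le> ?M + 2 * \<bar>gauss1 s (real K)\<bar>" for K
  proof -
    have "\<bar>?H gauss K \<beta> - ?H gauss K 0\<bar> \<le> ?M + \<bar>?H gauss1 K 1 - ?H gauss1 K 0\<bar>"
    proof (rule three_derivative_bound[OF d[OF gauss_deriv] d[OF gauss1_deriv] d[OF gauss2_deriv] _ _ \<beta>])
      fix x :: real assume x: "0 \<le> x" "x \<le> 1"
      have "\<bar>?H gauss3 K x\<bar> \<le> (\<Sum>n\<in>{- int K..<int K}. \<bar>gauss3 s (of_int n + x)\<bar>)" by (rule sum_abs)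
      also have "\<dots> \<le> (\<Sum>n\<in>{- int K..<int K}. 20 * exp 4 * s ^ 3 * exp (- \<bar>s * (of_int n + x)\<bar>))"
        by (intro sum_mono gauss3_bound s)
      also have "\<dots> \<le> 20 * exp 4 * s ^ 3 * (2 / (1 - exp (- s)))"
        unfolding sum_distrib_left[symmetric] by (intro mult_left_mono sum_exp_abs_le s x) (use s in simp)
      also have "\<dots> \<le> 20 * exp 4 * s ^ 3 * (2 / (s / 2))"
        using one_minus_exp_ge[OF s] s by (intro mult_left_mono divide_left_mono) auto
      also have "\<dots> = ?M" using s by (simp add: eval_nat_numeral)
      finally show "\<bar>?H gauss3 K x\<bar> \<le> ?M" .
    next
      have "?H gauss K 1 - ?H gauss K 0 = gauss s (real K) - gauss s (- real K)"
        using sum_symmetric_telescope[of "gauss s" K] by (simp add: sum_subtractf)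
      then show "?H gauss K 1 = ?H gauss K 0" by (simp add: gauss_def)
    qed
    also have "?H gauss1 K 1 - ?H gauss1 K 0 = gauss1 s (real K) - gauss1 s (- real K)"
      using sum_symmetric_telescope[of "gauss1 s" K] by (simp add: sum_subtractf)
    also have "\<dots> = 2 * gauss1 s (real K)" by (simp add: gauss1_def gauss_def)
    finally show ?thesis by (simp add: abs_mult)
  qed
  have "(\<lambda>K. \<bar>?H gauss K \<beta> - ?H gauss K 0\<bar>) \<longlonglongrightarrow> \<bar>theta1 s \<beta> - theta1 s 0\<bar>"
    by (intro tendsto_intros theta1_tendsto s)
  moreover have "(\<lambda>K. ?M + 2 * \<bar>gauss1 s (real K)\<bar>) \<longlonglongrightarrow> ?M + 2 * \<bar>0\<bar>"
    by (intro tendsto_intros gauss1_tendsto_0 s)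
  ultimately have "\<bar>theta1 s \<beta> - theta1 s 0\<bar> \<le> ?M + 2 * \<bar>0\<bar>"
    by (rule LIMSEQ_le) (use le in blast)
  then show ?thesis by simp
qed

lemma theta1_shift:
  assumes s: "0 < s" "s \<le> 1"
  shows "\<bar>theta1 s \<beta> - theta1 s 0\<bar> \<le> 80 * exp 4 * s\<^sup>2"
  unfolding theta1_frac[of s \<beta>] by (rule theta1_shift_01[OF s]) (simp_all add: less_imp_le[OF frac_lt_1])

lemma theta1_le_geometric:
  assumes "0 < s"
  shows "theta1 s \<beta> \<le> 4 / (1 - exp (- s))"
  unfolding theta1_frac[of s \<beta>]
  by (rule LIMSEQ_le_const2[OF theta1_tendsto[OF assms(1)]])
     (use gauss_sum_le[OF assms(1)] in \<open>auto simp: less_imp_le[OF frac_lt_1]\<close>)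

section \<open>Two-dimensional theta series\<close>

text \<open>The theta series of the binary form p (x + \<rho> y)^2 + \<kappa> y^2, that is, of an arbitrary positive definite form with completed square, over the integer lattice shifted by (c, d). The index pair is (j, i), with the coordinate of the pure square first, so that the inner sum is a one-dimensional Gaussian sum with a shift depending on j.\<close>

definition theta2 :: "real \<Rightarrow> real \<Rightarrow> real \<Rightarrow> real \<Rightarrow> real \<Rightarrow> real \<Rightarrow> real" where
  "theta2 p \<kappa> \<rho> t c d =
     (\<Sum>\<^sub>\<infinity>(j::int, i::int). exp (- (t * (p * ((of_int i + c) + \<rho> * (of_int j + d))\<^sup>2 + \<kappa> * (of_int j + d)\<^sup>2))))"

lemma theta2_has_sum:
  fixes p \<kappa> \<rho> t c d :: real
  assumes "0 < p" "0 < \<kappa>" "0 < t"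
  defines "F \<equiv> (\<lambda>(j::int, i::int). exp (- (t * (p * ((of_int i + c) + \<rho> * (of_int j + d))\<^sup>2 + \<kappa> * (of_int j + d)\<^sup>2))))"
  defines "G \<equiv> (\<lambda>j::int. gauss (sqrt (t * \<kappa>)) (of_int j + d) * theta1 (sqrt (t * p)) (c + \<rho> * (of_int j + d)))"
  shows "F summable_on UNIV" "(G has_sum theta2 p \<kappa> \<rho> t c d) UNIV"
proof -
  define a b where "a = sqrt (t * p)" and "b = sqrt (t * \<kappa>)"
  have ab: "0 < a" "0 < b" "a\<^sup>2 = t * p" "b\<^sup>2 = t * \<kappa>" using assms by (simp_all add: a_def b_def)
  have F: "F (j, i) = gauss b (of_int j + d) * gauss a (of_int i + (c + \<rho> * (of_int j + d)))" for i j
    unfolding F_def gauss_def exp_add[symmetric] power_mult_distrib ab by (simp add: algebra_simps)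
  have inner: "((\<lambda>i. F (j, i)) has_sum G j) UNIV" for j
    unfolding F G_def a_def[symmetric] b_def[symmetric] theta1_def
    by (intro has_sum_cmult_right has_sum_infsum gauss_summable ab)
  have "G summable_on UNIV"
  proof (rule summable_on_comparison_test)
    show "(\<lambda>j. gauss b (of_int j + d) * (4 / (1 - exp (- a)))) summable_on UNIV"
      by (intro summable_on_cmult_left gauss_summable ab)
    show "G j \<le> gauss b (of_int j + d) * (4 / (1 - exp (- a)))" for j
      unfolding G_def a_def[symmetric] b_def[symmetric]
      by (intro mult_left_mono theta1_le_geometric ab) (simp add: gauss_def)
    show "0 \<le> G j" for j unfolding G_def by (simp add: theta1_nonneg gauss_def)
  qed
  then have "F summable_on Sigma UNIV (\<lambda>_. UNIV)"
    by (rule summable_on_SigmaI[OF inner]) (simp add: F_def)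
  then show sum: "F summable_on UNIV" by simp
  have "(F has_sum theta2 p \<kappa> \<rho> t c d) (Sigma UNIV (\<lambda>_. UNIV))"
    using has_sum_infsum[OF sum] unfolding theta2_def F_def by simp
  then show "(G has_sum theta2 p \<kappa> \<rho> t c d) UNIV" by (rule has_sum_SigmaD) (rule inner)
qed

text \<open>Each one-dimensional factor is of order 1 / sqrt t, and moving its shift changes it only by order t. Hence the shifts (c, d), and likewise the skewness \<rho>, change the double sum only by order sqrt t.\<close>

lemma theta2_approx:
  fixes p \<kappa> \<rho> t c d :: real
  assumes "0 < p" "0 < \<kappa>" "0 < t" "t * p \<le> 1" "t * \<kappa> \<le> 1"
  shows "\<bar>theta2 p \<kappa> \<rho> t c d - theta1 (sqrt (t * p)) 0 * theta1 (sqrt (t * \<kappa>)) 0\<bar>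
    \<le> sqrt t * (640 * exp 4 * (p / sqrt \<kappa> + \<kappa> / sqrt p))"
proof -
  define a b where "a = sqrt (t * p)" and "b = sqrt (t * \<kappa>)"
  have ab: "0 < a" "0 < b" "a\<^sup>2 = t * p" "b\<^sup>2 = t * \<kappa>" "a \<le> 1" "b \<le> 1"
    using assms by (simp_all add: a_def b_def)
  define C :: real where "C = 80 * exp 4"
  let ?g = "\<lambda>j::int. gauss b (of_int j + d)"
  let ?T = "\<lambda>j::int. theta1 a (c + \<rho> * (of_int j + d))"
  have hs: "((\<lambda>j. ?g j * ?T j) has_sum theta2 p \<kappa> \<rho> t c d) UNIV"
    using theta2_has_sum(2)[OF assms(1-3)] unfolding a_def b_def .
  have g: "(?g has_sum theta1 b d) UNIV"
    unfolding theta1_def by (intro has_sum_infsum gauss_summable ab)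
  have "((\<lambda>j. ?g j * ?T j + ?g j * (- theta1 a 0)) has_sum (theta2 p \<kappa> \<rho> t c d + theta1 b d * (- theta1 a 0))) UNIV"
    by (intro has_sum_add hs has_sum_cmult_left g)
  then have hs1: "((\<lambda>j. ?g j * (?T j - theta1 a 0)) has_sum (theta2 p \<kappa> \<rho> t c d - theta1 b d * theta1 a 0)) UNIV"
    by (simp add: algebra_simps)
  have le: "\<bar>?g j * (?T j - theta1 a 0)\<bar> \<le> ?g j * (C * a\<^sup>2)" for j
  proof -
    have "\<bar>?g j * (?T j - theta1 a 0)\<bar> = ?g j * \<bar>?T j - theta1 a 0\<bar>" by (simp add: abs_mult gauss_def)
    also have "\<dots> \<le> ?g j * (C * a\<^sup>2)"
      unfolding C_def by (intro mult_left_mono theta1_shift ab) (simp add: gauss_def)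
    finally show ?thesis .
  qed
  have up: "((\<lambda>j. ?g j * (C * a\<^sup>2)) has_sum theta1 b d * (C * a\<^sup>2)) UNIV"
    by (intro has_sum_cmult_left g)
  have lo: "((\<lambda>j. ?g j * (- (C * a\<^sup>2))) has_sum theta1 b d * (- (C * a\<^sup>2))) UNIV"
    by (intro has_sum_cmult_left g)
  have "theta2 p \<kappa> \<rho> t c d - theta1 b d * theta1 a 0 \<le> theta1 b d * (C * a\<^sup>2)"
    by (rule has_sum_mono[OF hs1 up]) (use le in \<open>metis abs_le_D1\<close>)
  moreover have "theta1 b d * (- (C * a\<^sup>2)) \<le> theta2 p \<kappa> \<rho> t c d - theta1 b d * theta1 a 0"
  proof (rule has_sum_mono[OF lo hs1])
    fix j :: int
    show "?g j * (- (C * a\<^sup>2)) \<le> ?g j * (?T j - theta1 a 0)" using le[of j] by simp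
  qed
  ultimately have 1: "\<bar>theta2 p \<kappa> \<rho> t c d - theta1 b d * theta1 a 0\<bar> \<le> theta1 b d * (C * a\<^sup>2)" by simp
  also have "\<dots> \<le> (8 / b) * (C * a\<^sup>2)"
    by (intro mult_right_mono theta1_le ab) (simp add: C_def)
  finally have 1: "\<bar>theta2 p \<kappa> \<rho> t c d - theta1 b d * theta1 a 0\<bar> \<le> (8 / b) * (C * a\<^sup>2)" .
  have "\<bar>theta1 b d * theta1 a 0 - theta1 a 0 * theta1 b 0\<bar> = theta1 a 0 * \<bar>theta1 b d - theta1 b 0\<bar>"
    using theta1_nonneg[of a 0] by (metis abs_mult abs_of_nonneg mult.commute right_diff_distrib)
  also have "\<dots> \<le> (8 / a) * (C * b\<^sup>2)"
    unfolding C_def using ab by (intro mult_mono theta1_le theta1_shift) simp_all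
  finally have 2: "\<bar>theta1 b d * theta1 a 0 - theta1 a 0 * theta1 b 0\<bar> \<le> (8 / a) * (C * b\<^sup>2)" .
  have "\<bar>theta2 p \<kappa> \<rho> t c d - theta1 a 0 * theta1 b 0\<bar> \<le> (8 / b) * (C * a\<^sup>2) + (8 / a) * (C * b\<^sup>2)"
    using 1 2 by linarith
  also have "\<dots> = sqrt t * (640 * exp 4 * (p / sqrt \<kappa> + \<kappa> / sqrt p))"
  proof -
    have "t / sqrt t = sqrt t" using assms by (simp add: real_div_sqrt)
    then have "a\<^sup>2 / b = sqrt t * (p / sqrt \<kappa>)" "b\<^sup>2 / a = sqrt t * (\<kappa> / sqrt p)"
      unfolding ab(3,4) unfolding a_def b_def real_sqrt_mult by (metis (no_types) times_divide_times_eq)+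
    then have "640 * exp 4 * (a\<^sup>2 / b + b\<^sup>2 / a) = 640 * exp 4 * (sqrt t * (p / sqrt \<kappa>) + sqrt t * (\<kappa> / sqrt p))" by simp
    then show ?thesis by (simp add: C_def algebra_simps)
  qed
  finally show ?thesis unfolding a_def b_def .
qed

text \<open>Writing the coordinates as 2 j + f and 2 i + e splits the lattice into the four cosets of its double, and doubling the coordinates multiplies the form by 4.\<close>

lemma theta2_parity:
  fixes p \<kappa> \<rho> t :: real
  assumes "0 < p" "0 < \<kappa>" "0 < t"
  shows "theta2 p \<kappa> \<rho> t 0 0 = (\<Sum>(f, e)\<in>{0, 1} \<times> {0, 1::int}. theta2 p \<kappa> \<rho> (4 * t) (of_int e / 2) (of_int f / 2))"
proof -
  define F where "F = (\<lambda>(j::int, i::int). exp (- (t * (p * ((of_int i + 0) + \<rho> * (of_int j + 0))\<^sup>2 + \<kappa> * (of_int j + 0)\<^sup>2))))"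
  define par :: "(int \<times> int) \<times> (int \<times> int) \<Rightarrow> int \<times> int"
    where "par = (\<lambda>((f, e), (j, i)). (2 * j + f, 2 * i + e))"
  have bij: "bij_betw par (({0, 1} \<times> {0, 1}) \<times> UNIV) UNIV"
  proof (rule bij_betw_byWitness[where f' = "\<lambda>(y, x). ((y mod 2, x mod 2), (y div 2, x div 2))"])
    show "(\<lambda>(y, x). ((y mod 2, x mod 2), (y div 2, x div 2))) ` UNIV \<subseteq> ({0, 1} \<times> {0, 1}) \<times> (UNIV :: (int \<times> int) set)"
      by auto
  qed (auto simp: par_def)
  have "(F has_sum theta2 p \<kappa> \<rho> t 0 0) UNIV"
    using has_sum_infsum[OF theta2_has_sum(1)[OF assms, of 0 \<rho> 0]] unfolding F_def theta2_def .
  then have "((\<lambda>z. F (par z)) has_sum theta2 p \<kappa> \<rho> t 0 0) (({0, 1} \<times> {0, 1}) \<times> UNIV)"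
    by (subst has_sum_reindex_bij_betw[OF bij])
  then have "((\<lambda>(f, e). theta2 p \<kappa> \<rho> (4 * t) (of_int e / 2) (of_int f / 2)) has_sum theta2 p \<kappa> \<rho> t 0 0) ({0, 1} \<times> {0, 1})"
  proof (rule has_sum_SigmaD)
    fix x :: "int \<times> int"
    obtain f e where x: "x = (f, e)" by force
    have "F (par ((f, e), y)) = (case y of (j, i) \<Rightarrow> exp (- (4 * t * (p * ((of_int i + of_int e / 2) + \<rho> * (of_int j + of_int f / 2))\<^sup>2 + \<kappa> * (of_int j + of_int f / 2)\<^sup>2))))" for y
      by (cases y) (simp add: F_def par_def power2_eq_square field_simps)
    then show "((\<lambda>y. F (par (x, y))) has_sum (case x of (f, e) \<Rightarrow> theta2 p \<kappa> \<rho> (4 * t) (of_int e / 2) (of_int f / 2))) UNIV"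
      using has_sum_infsum[OF theta2_has_sum(1)[OF assms(1,2), of "4 * t" "of_int e / 2" \<rho> "of_int f / 2"]] assms(3)
      unfolding theta2_def x by simp
  qed
  then show ?thesis by (simp add: has_sum_finite_iff)
qed

text \<open>The main term, a constant divided by t, cancels in this combination, so its value is never computed.\<close>

lemma theta2_limit:
  fixes p \<kappa> \<rho> :: real
  assumes "0 < p" "0 < \<kappa>"
  shows "((\<lambda>t. theta2 p \<kappa> \<rho> t 0 0 - 4 * theta2 p \<kappa> \<rho> (4 * t) 0 0) \<longlongrightarrow> 0) (at_right 0)"
proof (rule Lim_null_comparison)
  define C where "C = 640 * exp 4 * (p / sqrt \<kappa> + \<kappa> / sqrt p)"
  have "((\<lambda>t. 8 * (sqrt (4 * t) * C)) \<longlongrightarrow> 8 * (sqrt (4 * 0) * C)) (at_right 0)"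
    by (intro tendsto_intros)
  then show "((\<lambda>t. 8 * (sqrt (4 * t) * C)) \<longlongrightarrow> 0) (at_right 0)" by simp
  \<comment> \<open>For t below this bound both one-dimensional factors at 4 t are in the range where their estimates apply.\<close>
  define \<epsilon> where "\<epsilon> = min (1 / (4 * p)) (1 / (4 * \<kappa>))"
  have "\<epsilon> > 0" using assms by (simp add: \<epsilon>_def)
  have "norm (theta2 p \<kappa> \<rho> t 0 0 - 4 * theta2 p \<kappa> \<rho> (4 * t) 0 0) \<le> 8 * (sqrt (4 * t) * C)"
    if t: "0 < t" "t < \<epsilon>" for t
  proof -
    have tp: "4 * t * p \<le> 1" "4 * t * \<kappa> \<le> 1" using t assms by (simp_all add: \<epsilon>_def field_simps)
    define M where "M = theta1 (sqrt (4 * t * p)) 0 * theta1 (sqrt (4 * t * \<kappa>)) 0"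
    have b: "\<bar>theta2 p \<kappa> \<rho> (4 * t) c d - M\<bar> \<le> sqrt (4 * t) * C" for c d
      unfolding M_def C_def by (rule theta2_approx[OF assms _ tp]) (use t in simp)
    show ?thesis unfolding theta2_parity[OF assms t(1)]
      using b[of 0 0] b[of "1/2" 0] b[of 0 "1/2"] b[of "1/2" "1/2"]
      by (simp add: sum.cartesian_product[symmetric] abs_le_iff)
  qed
  then show "\<forall>\<^sub>F t in at_right 0. norm (theta2 p \<kappa> \<rho> t 0 0 - 4 * theta2 p \<kappa> \<rho> (4 * t) 0 0) \<le> 8 * (sqrt (4 * t) * C)"
    using \<open>\<epsilon> > 0\<close> unfolding eventually_at_right_field by blast
qed

section \<open>Lambert series of periodic functions\<close>

definition fermi :: "real \<Rightarrow> real" where "fermi u = 1 / (exp u + 1)"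
definition fermi1 :: "real \<Rightarrow> real" where "fermi1 u = - exp u / (exp u + 1)\<^sup>2"
definition fermi2 :: "real \<Rightarrow> real" where "fermi2 u = exp u * (exp u - 1) / (exp u + 1) ^ 3"

lemma fermi_deriv: "(fermi has_real_derivative fermi1 u) (at u)"
proof -
  have "exp u + 1 \<noteq> 0" using exp_gt_zero[of u] by linarith
  then show ?thesis unfolding fermi_def[abs_def] fermi1_def
    by (auto intro!: derivative_eq_intros simp: power2_eq_square)
qed

lemma fermi1_deriv: "(fermi1 has_real_derivative fermi2 u) (at u)"
proof -
  define E where "E = exp u"
  have E: "E + 1 \<noteq> 0" "E > 0" using exp_gt_zero[of u] unfolding E_def by linarith+
  have num: "((\<lambda>u. - exp u) has_real_derivative - exp u) (at u)"
    by (auto intro!: derivative_eq_intros)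
  have den: "((\<lambda>u. (exp u + 1)\<^sup>2) has_real_derivative 2 * (exp u + 1) * exp u) (at u)"
    by (auto intro!: derivative_eq_intros)
  have nz: "(exp u + 1)\<^sup>2 \<noteq> 0" using E(1) unfolding E_def by simp
  have "(fermi1 has_real_derivative (- exp u * (exp u + 1)\<^sup>2 - (- exp u) * (2 * (exp u + 1) * exp u)) / ((exp u + 1)\<^sup>2 * (exp u + 1)\<^sup>2)) (at u)"
    unfolding fermi1_def[abs_def] by (rule DERIV_divide[OF num den nz])
  also have "(- exp u * (exp u + 1)\<^sup>2 - (- exp u) * (2 * (exp u + 1) * exp u)) / ((exp u + 1)\<^sup>2 * (exp u + 1)\<^sup>2) = fermi2 u"
    unfolding fermi2_def E_def[symmetric] using E by (simp add: divide_simps eval_nat_numeral) (simp add: algebra_simps)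
  finally show ?thesis .
qed

lemma fermi2_bound:
  assumes "0 \<le> u"
  shows "\<bar>fermi2 u\<bar> \<le> exp (- u)"
proof -
  define E where "E = exp u"
  have E: "1 \<le> E" unfolding E_def using assms by simp
  have "E * (E - 1) * E \<le> (E + 1) * (E + 1) * (E + 1)" using E by (intro mult_mono) auto
  then have "E * (E - 1) / (E + 1) ^ 3 \<le> 1 / E" using E by (simp add: divide_simps eval_nat_numeral)
  moreover have "0 \<le> E * (E - 1) / (E + 1) ^ 3" using E by simp
  ultimately show ?thesis unfolding fermi2_def E_def[symmetric] exp_minus by (simp add: E_def inverse_eq_divide)
qed

lemma fermi_le: "0 \<le> fermi u" "fermi u \<le> exp (- u)"
proof -
  define E where "E = exp u"
  have E: "0 < E" unfolding E_def by simp
  then show "0 \<le> fermi u" unfolding fermi_def E_def[symmetric] by simp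
  have "1 / (E + 1) \<le> 1 / E" using E by (intro divide_left_mono) simp_all
  then show "fermi u \<le> exp (- u)" unfolding fermi_def exp_minus E_def inverse_eq_divide .
qed

text \<open>Linear interpolation of a function with an exponentially decaying second derivative.\<close>

lemma fermi_interpolation:
  assumes "0 \<le> a" "0 < h" "0 \<le> \<theta>" "\<theta> \<le> 1"
  shows "\<bar>fermi (a + \<theta> * h) - fermi a - \<theta> * (fermi (a + h) - fermi a)\<bar> \<le> h\<^sup>2 * exp (- a)"
proof -
  have mv: "\<exists>z. a \<le> z \<and> z \<le> a + h \<and> fermi (a + \<eta> * h) - fermi a = \<eta> * h * fermi1 z" if "0 \<le> \<eta>" "\<eta> \<le> 1" for \<eta>
  proof (cases "\<eta> = 0")
    case True
    then show ?thesis using assms by (intro exI[of _ a]) simp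
  next
    case False
    then have lt: "a < a + \<eta> * h" using assms that by simp
    have "\<eta> * h \<le> h" using assms that by simp
    obtain z where "a < z" "z < a + \<eta> * h" "fermi (a + \<eta> * h) - fermi a = (a + \<eta> * h - a) * fermi1 z"
      using MVT2[OF lt fermi_deriv] by blast
    then show ?thesis using \<open>\<eta> * h \<le> h\<close> by (intro exI[of _ z]) simp
  qed
  obtain z where z: "a \<le> z" "z \<le> a + h" "fermi (a + \<theta> * h) - fermi a = \<theta> * h * fermi1 z"
    using mv[OF assms(3,4)] by blast
  obtain w where w: "a \<le> w" "w \<le> a + h" "fermi (a + h) - fermi a = h * fermi1 w"
    using mv[of 1] by auto
  have "norm (fermi1 z - fermi1 w) \<le> exp (- a) * norm (z - w)"
  proof (rule field_differentiable_bound[of "{a..a + h}" fermi1 fermi2])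
    fix x assume "x \<in> {a..a + h}"
    then have "\<bar>fermi2 x\<bar> \<le> exp (- x)" "exp (- x) \<le> exp (- a)" using assms fermi2_bound[of x] by simp_all
    then show "norm (fermi2 x) \<le> exp (- a)" unfolding real_norm_def by (rule order_trans)
  qed (use z w in \<open>auto intro: has_field_derivative_at_within fermi1_deriv\<close>)
  also have "\<dots> \<le> exp (- a) * h" using z w by (intro mult_left_mono) auto
  finally have d: "\<bar>fermi1 z - fermi1 w\<bar> \<le> exp (- a) * h" by simp
  have "\<bar>fermi (a + \<theta> * h) - fermi a - \<theta> * (fermi (a + h) - fermi a)\<bar> = \<theta> * h * \<bar>fermi1 z - fermi1 w\<bar>"
    unfolding z(3) w(3) using assms by (simp add: abs_mult flip: right_diff_distrib mult.assoc)
  also have "\<dots> \<le> 1 * h * (exp (- a) * h)"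
    using assms d by (intro mult_mono) simp_all
  finally show ?thesis by (simp add: power2_eq_square mult_ac)
qed

text \<open>Subtracting twice the value at 2 u removes the pole of 1 / (exp u - 1) at 0 and leaves a smooth function.\<close>

lemma fermi_identity:
  assumes "0 < u"
  shows "1 / (exp u - 1) - 2 * (1 / (exp (2 * u) - 1)) = fermi u"
proof -
  define E where "E = exp u"
  have E: "1 < E" unfolding E_def using assms by simp
  have "exp (2 * u) = E * E" unfolding E_def by (simp flip: exp_add)
  moreover have "E * E - 1 = (E - 1) * (E + 1)" by (simp add: algebra_simps)
  ultimately show ?thesis unfolding fermi_def E_def[symmetric] using E by (simp add: divide_simps)
qed

lemma bij_Suc_positive: "bij_betw Suc UNIV {1..}"
  by (rule bij_betw_byWitness[where f' = "\<lambda>n. n - 1"]) auto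

lemma geometric_has_sum:
  fixes u :: real
  assumes "0 < u"
  shows "((\<lambda>k::nat. exp (- (u * real k))) has_sum 1 / (exp u - 1)) {1..}"
proof -
  define q where "q = exp (- u)"
  have q: "0 < q" "q < 1" using assms by (simp_all add: q_def)
  have "((\<lambda>k. q ^ k) has_sum 1 / (1 - q)) UNIV"
    using geometric_sums[of q] q by (intro norm_summable_imp_has_sum) (simp_all add: summable_geometric)
  then have "((\<lambda>k. q * q ^ k) has_sum q * (1 / (1 - q))) UNIV" by (rule has_sum_cmult_right)
  moreover have "q * q ^ k = exp (- (u * real (Suc k)))" for k
    unfolding q_def by (simp add: algebra_simps flip: exp_of_nat_mult exp_add)
  moreover have "q * (1 / (1 - q)) = 1 / (exp u - 1)"
    unfolding q_def using assms by (simp add: exp_minus field_simps)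
  ultimately show ?thesis
    using has_sum_reindex_bij_betw[OF bij_Suc_positive, of "\<lambda>k. exp (- (u * real k))" "1 / (exp u - 1)"] by simp
qed

definition lambert :: "(nat \<Rightarrow> real) \<Rightarrow> real \<Rightarrow> real" where
  "lambert c t = (\<Sum>\<^sub>\<infinity>(d, k)\<in>{1..} \<times> {1..}. c d * exp (- (t * real (d * k))))"

locale periodic_mean_zero =
  fixes c :: "nat \<Rightarrow> real" and N :: nat
  assumes N_pos: "0 < N" and per: "\<And>d. c (d + N) = c d" and mean: "(\<Sum>x = 1..N. c x) = 0"
    and bd: "\<And>d. \<bar>c d\<bar> \<le> 1"
begin

lemma lambert_summable:
  assumes "0 < t"
  shows "(\<lambda>(d, k). exp (- (t * real (d * k)))) summable_on {1..} \<times> {1..}" (is ?A)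
    and "(\<lambda>(d, k). c d * exp (- (t * real (d * k)))) summable_on {1..} \<times> {1..}" (is ?B)
proof -
  define E where "E = 1 / (exp (t / 2) - 1)"
  have g: "((\<lambda>k::nat. exp (- (t / 2 * real k))) has_sum E) {1..}"
    unfolding E_def using assms by (intro geometric_has_sum) simp
  have "(\<lambda>(d, k). exp (- (t / 2 * real d)) * exp (- (t / 2 * real k))) summable_on {1..} \<times> {1..}"
  proof (rule summable_on_SigmaI)
    show "((\<lambda>y. case (x, y) of (d, k) \<Rightarrow> exp (- (t / 2 * real d)) * exp (- (t / 2 * real k))) has_sum exp (- (t / 2 * real x)) * E) {1..}" for x
      using has_sum_cmult_right[OF g] by simp
    show "(\<lambda>x. exp (- (t / 2 * real x)) * E) summable_on {1..}"
      using has_sum_cmult_left[OF g] by (rule has_sum_imp_summable)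
  qed simp
  then show A: ?A
  proof (rule summable_on_comparison_test)
    fix z :: "nat \<times> nat" assume "z \<in> {1..} \<times> {1..}"
    then obtain d k where z: "z = (d, k)" "1 \<le> d" "1 \<le> k" by auto
    have "d \<le> d * k" "k \<le> d * k" using z by simp_all
    then have "d + k \<le> 2 * (d * k)" by linarith
    then have "real d + real k \<le> 2 * real (d * k)" by (metis of_nat_add of_nat_le_iff of_nat_mult of_nat_numeral)
    then have "t / 2 * (real d + real k) \<le> t * real (d * k)" using assms by simp
    then show "(case z of (d, k) \<Rightarrow> exp (- (t * real (d * k)))) \<le> (case z of (d, k) \<Rightarrow> exp (- (t / 2 * real d)) * exp (- (t / 2 * real k)))"
      unfolding z by (simp add: algebra_simps flip: exp_add)
  qed auto
  show ?B
  proof (rule abs_summable_summable, rule summable_on_comparison_test[OF A])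
    fix z :: "nat \<times> nat"
    show "norm (case z of (d, k) \<Rightarrow> c d * exp (- (t * real (d * k)))) \<le> (case z of (d, k) \<Rightarrow> exp (- (t * real (d * k))))"
      using bd by (cases z) (simp add: abs_mult)
  qed auto
qed

lemma lambert_has_sum:
  assumes "0 < t"
  shows "((\<lambda>d. c d * (1 / (exp (t * real d) - 1))) has_sum lambert c t) {1..}"
proof (rule has_sum_SigmaD)
  show "((\<lambda>(d, k). c d * exp (- (t * real (d * k)))) has_sum lambert c t) ({1..} \<times> {1..})"
    unfolding lambert_def by (intro has_sum_infsum lambert_summable assms)
  fix d :: nat assume "d \<in> {1..}"
  then have "((\<lambda>k. exp (- (t * real d * real k))) has_sum 1 / (exp (t * real d) - 1)) {1..}"
    using assms by (intro geometric_has_sum) simp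
  from has_sum_cmult_right[OF this, of "c d"]
  show "((\<lambda>y. case (d, y) of (d, k) \<Rightarrow> c d * exp (- (t * real (d * k)))) has_sum c d * (1 / (exp (t * real d) - 1))) {1..}"
    by (simp add: mult.assoc)
qed

lemma fermi_has_sum:
  assumes "0 < t"
  shows "((\<lambda>d. c d * fermi (t * real d)) has_sum (lambert c t - 2 * lambert c (2 * t))) {1..}"
proof -
  let ?f = "\<lambda>d. c d * (1 / (exp (t * real d) - 1)) + (- 2) * (c d * (1 / (exp (2 * t * real d) - 1)))"
  have hs: "(?f has_sum (lambert c t + (- 2) * lambert c (2 * t))) {1..}"
    by (intro has_sum_add has_sum_cmult_right lambert_has_sum) (use assms in simp_all)
  have eq: "?f d = c d * fermi (t * real d)" if "d \<in> {1..}" for d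
  proof -
    have "0 < t * real d" using assms that by simp
    from fermi_identity[OF this] show ?thesis by (simp add: algebra_simps flip: right_diff_distrib)
  qed
  have "(?f has_sum S) {1..} = ((\<lambda>d. c d * fermi (t * real d)) has_sum S) {1..}" for S
    by (rule has_sum_cong) (rule eq)
  then show ?thesis using hs by simp
qed

lemma per_mult: "c (j * N + x) = c x"
proof (induction j)
  case (Suc j)
  then show ?case using per[of "j * N + x"] by (simp add: add_ac)
qed simp

lemma bij_blocks: "bij_betw (\<lambda>(j, x). j * N + x) (UNIV \<times> {1..N}) {1..}"
proof (rule bij_betw_byWitness[where f' = "\<lambda>d. ((d - 1) div N, (d - 1) mod N + 1)"])
  show "\<forall>a\<in>UNIV \<times> {1..N}. (\<lambda>d. ((d - 1) div N, (d - 1) mod N + 1)) ((\<lambda>(j, x). j * N + x) a) = a"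
  proof
    fix a assume "a \<in> (UNIV :: nat set) \<times> {1..N}"
    then obtain j x where a: "a = (j, x)" "1 \<le> x" "x \<le> N" by auto
    then obtain y where x: "x = Suc y" "y < N" by (cases x) auto
    then have "j * N + x - 1 = j * N + y" by simp
    then show "(\<lambda>d. ((d - 1) div N, (d - 1) mod N + 1)) ((\<lambda>(j, x). j * N + x) a) = a"
      unfolding a using x by simp
  qed
  show "\<forall>a'\<in>{1..}. (\<lambda>(j, x). j * N + x) ((\<lambda>d. ((d - 1) div N, (d - 1) mod N + 1)) a') = a'"
    by (auto simp: add.assoc[symmetric])
  show "(\<lambda>d. ((d - 1) div N, (d - 1) mod N + 1)) ` {1..} \<subseteq> UNIV \<times> {1..N}"
    using N_pos by (auto simp: Suc_le_eq)
qed auto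

lemma fermi_sums:
  assumes "0 < t"
  shows "(\<lambda>j. \<Sum>x = 1..N. c x * fermi (t * real (j * N + x))) sums (lambert c t - 2 * lambert c (2 * t))"
proof -
  have "((\<lambda>(j, x). c (j * N + x) * fermi (t * real (j * N + x))) has_sum (lambert c t - 2 * lambert c (2 * t))) (UNIV \<times> {1..N})"
    using fermi_has_sum[OF assms]
      has_sum_reindex_bij_betw[OF bij_blocks, of "\<lambda>d. c d * fermi (t * real d)" "lambert c t - 2 * lambert c (2 * t)"]
    by (simp add: case_prod_unfold)
  then have "((\<lambda>j. \<Sum>x = 1..N. c x * fermi (t * real (j * N + x))) has_sum (lambert c t - 2 * lambert c (2 * t))) UNIV"
    by (rule has_sum_SigmaD) (simp add: per_mult)
  then show ?thesis by (rule has_sum_imp_sums)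
qed

lemma fermi_tendsto_0: "(\<lambda>j. fermi (real j * h)) \<longlonglongrightarrow> 0" if "0 < h"
proof (rule Lim_null_comparison)
  have "(\<lambda>j. exp (- h) ^ j) \<longlonglongrightarrow> 0" using that by (intro LIMSEQ_power_zero) simp
  then show "(\<lambda>j. exp (- (real j * h))) \<longlonglongrightarrow> 0" by (simp flip: exp_of_nat_mult)
  show "\<forall>\<^sub>F j in sequentially. norm (fermi (real j * h)) \<le> exp (- (real j * h))"
    using fermi_le by simp
qed

text \<open>The function is summed over blocks of N consecutive integers. On each block the smooth function is replaced by its linear interpolation; the constant part is annihilated by the vanishing mean of c, and the linear parts telescope over the blocks to the value 1/2 at 0. The error is a sum of about 1/t terms of order t^2.\<close>

lemma lambert_estimate:
  assumes "0 < t" "t * real N \<le> 1"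
  shows "\<bar>lambert c t - 2 * lambert c (2 * t) - (- (\<Sum>x = 1..N. real x * c x) / (2 * real N))\<bar> \<le> 2 * real N * (t * real N)"
proof -
  define h where "h = t * real N"
  have h: "0 < h" "h \<le> 1" using assms N_pos by (simp_all add: h_def)
  define S where "S = (\<Sum>x = 1..N. real x * c x)"
  define b where "b = (\<lambda>j. \<Sum>x = 1..N. c x * fermi (t * real (j * N + x)))"
  define m where "m = (\<lambda>j. S / real N * (fermi (real (Suc j) * h) - fermi (real j * h)))"
  have b: "b sums (lambert c t - 2 * lambert c (2 * t))" unfolding b_def by (rule fermi_sums[OF assms(1)])
  have "m sums (S / real N * (0 - fermi (real 0 * h)))"
    unfolding m_def by (intro sums_mult telescope_sums fermi_tendsto_0 h)
  then have m: "m sums (- S / (2 * real N))" by (simp add: fermi_def mult.commute)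
  have le: "\<bar>b j - m j\<bar> \<le> real N * h\<^sup>2 * exp (- h) ^ j" for j
  proof -
    let ?a = "real j * h"
    have e: "t * real (j * N + x) = ?a + real x / real N * h" for x
      using N_pos by (simp add: h_def algebra_simps)
    have "m j = (\<Sum>x = 1..N. c x * (real x / real N * (fermi (?a + h) - fermi ?a)))"
    proof -
      define Y where "Y = fermi (?a + h) - fermi ?a"
      have "m j = S / real N * Y" unfolding m_def Y_def by (simp add: algebra_simps)
      also have "\<dots> = (\<Sum>x = 1..N. real x * c x / real N * Y)"
        unfolding S_def sum_divide_distrib sum_distrib_right ..
      also have "\<dots> = (\<Sum>x = 1..N. c x * (real x / real N * Y))" by (simp add: mult_ac)
      finally show ?thesis unfolding Y_def .
    qed
    moreover have "(\<Sum>x = 1..N. c x * fermi ?a) = 0" using mean by (simp flip: sum_distrib_right)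
    ultimately have "b j - m j = (\<Sum>x = 1..N. c x * fermi (?a + real x / real N * h)) - (\<Sum>x = 1..N. c x * fermi ?a)
        - (\<Sum>x = 1..N. c x * (real x / real N * (fermi (?a + h) - fermi ?a)))"
      unfolding b_def e by simp
    also have "\<dots> = (\<Sum>x = 1..N. c x * (fermi (?a + real x / real N * h) - fermi ?a - real x / real N * (fermi (?a + h) - fermi ?a)))"
      unfolding sum_subtractf[symmetric] by (simp only: right_diff_distrib)
    finally have "\<bar>b j - m j\<bar> = \<bar>\<Sum>x = 1..N. c x * (fermi (?a + real x / real N * h) - fermi ?a - real x / real N * (fermi (?a + h) - fermi ?a))\<bar>"
      by (rule arg_cong)
    also have "\<dots> \<le> (\<Sum>x = 1..N. \<bar>c x * (fermi (?a + real x / real N * h) - fermi ?a - real x / real N * (fermi (?a + h) - fermi ?a))\<bar>)"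
      by (rule sum_abs)
    also have "\<dots> \<le> (\<Sum>x = 1..N. 1 * (h\<^sup>2 * exp (- ?a)))"
    proof (rule sum_mono)
      fix x assume x: "x \<in> {1..N}"
      have "0 \<le> ?a" "0 \<le> real x / real N" "real x / real N \<le> 1" using h x N_pos by simp_all
      from fermi_interpolation[OF this(1) h(1) this(2,3)]
      show "\<bar>c x * (fermi (?a + real x / real N * h) - fermi ?a - real x / real N * (fermi (?a + h) - fermi ?a))\<bar> \<le> 1 * (h\<^sup>2 * exp (- ?a))"
        unfolding abs_mult by (rule mult_mono[OF bd]) simp_all
    qed
    also have "\<dots> = real N * h\<^sup>2 * exp (- h) ^ j" by (simp flip: exp_of_nat_mult)
    finally show ?thesis .
  qed
  have g: "(\<lambda>j. real N * h\<^sup>2 * exp (- h) ^ j) sums (real N * h\<^sup>2 * (1 / (1 - exp (- h))))"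
    using h by (intro sums_mult geometric_sums) simp
  have d: "(\<lambda>j. b j - m j) sums (lambert c t - 2 * lambert c (2 * t) - (- S / (2 * real N)))"
    by (rule sums_diff[OF b m])
  have "lambert c t - 2 * lambert c (2 * t) - (- S / (2 * real N)) \<le> real N * h\<^sup>2 * (1 / (1 - exp (- h)))"
    by (rule sums_le[OF _ d g]) (use le in \<open>metis abs_le_D1\<close>)
  moreover have "- (lambert c t - 2 * lambert c (2 * t) - (- S / (2 * real N))) \<le> real N * h\<^sup>2 * (1 / (1 - exp (- h)))"
    by (rule sums_le[OF _ sums_minus[OF d] g]) (use le in \<open>metis abs_le_D2\<close>)
  ultimately have "\<bar>lambert c t - 2 * lambert c (2 * t) - (- S / (2 * real N))\<bar> \<le> real N * h\<^sup>2 * (1 / (1 - exp (- h)))"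
    by linarith
  also have "\<dots> \<le> real N * h\<^sup>2 * (1 / (h / 2))"
    using h one_minus_exp_ge[OF h] by (intro mult_left_mono divide_left_mono) auto
  also have "\<dots> = 2 * real N * h" using h by (simp add: power2_eq_square)
  finally show ?thesis unfolding S_def h_def .
qed

lemma fermi_limit:
  "((\<lambda>t. lambert c t - 2 * lambert c (2 * t)) \<longlongrightarrow> - (\<Sum>x = 1..N. real x * c x) / (2 * real N)) (at_right 0)"
proof (rule LIM_zero_cancel, rule Lim_null_comparison)
  have "((\<lambda>t. 2 * real N * (t * real N)) \<longlongrightarrow> 2 * real N * (0 * real N)) (at_right 0)" by (intro tendsto_intros)
  then show "((\<lambda>t. 2 * real N * (t * real N)) \<longlongrightarrow> 0) (at_right 0)" by simp
  have "norm (lambert c t - 2 * lambert c (2 * t) - (- (\<Sum>x = 1..N. real x * c x) / (2 * real N))) \<le> 2 * real N * (t * real N)"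
    if "0 < t" "t < 1 / real N" for t
    using lambert_estimate[OF that(1)] that N_pos by (simp add: field_simps)
  then show "\<forall>\<^sub>F t in at_right 0. norm (lambert c t - 2 * lambert c (2 * t) - (- (\<Sum>x = 1..N. real x * c x) / (2 * real N))) \<le> 2 * real N * (t * real N)"
    unfolding eventually_at_right_field using N_pos by (intro exI[of _ "1 / real N"]) auto
qed

lemma filterlim_mult_at_right_0: "filterlim (\<lambda>t::real. k * t) (at_right 0) (at_right 0)" if "0 < k" for k :: real
proof -
  have "((\<lambda>t. k * t) \<longlongrightarrow> k * 0) (at_right 0)" by (intro tendsto_intros)
  then show ?thesis using that unfolding filterlim_at
    by (auto simp: eventually_at_right_field intro!: exI[of _ 1])
qed

text \<open>The combination with 4 is the one with 2 plus twice its value at 2 t, so the limit is three times as large.\<close>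

lemma lambert_limit:
  "((\<lambda>t. lambert c t - 4 * lambert c (4 * t)) \<longlongrightarrow> - 3 * (\<Sum>x = 1..N. real x * c x) / (2 * real N)) (at_right 0)"
proof -
  let ?L = "- (\<Sum>x = 1..N. real x * c x) / (2 * real N)"
  let ?A = "\<lambda>t. lambert c t - 2 * lambert c (2 * t)"
  have "((\<lambda>t. ?A (2 * t)) \<longlongrightarrow> ?L) (at_right 0)"
    by (rule filterlim_compose[OF fermi_limit filterlim_mult_at_right_0]) simp
  then have "((\<lambda>t. ?A t + 2 * ?A (2 * t)) \<longlongrightarrow> ?L + 2 * ?L) (at_right 0)"
    by (intro tendsto_intros fermi_limit)
  moreover have "?A t + 2 * ?A (2 * t) = lambert c t - 4 * lambert c (4 * t)" for t by simp
  ultimately show ?thesis by simp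
qed

end

section \<open>The ring of integers\<close>

lemma quadratic_algebraic_int:
  fixes z :: complex
  assumes "z\<^sup>2 - of_int T * z + of_int n = 0"
  shows "algebraic_int z"
proof (rule algebraic_int.intros[of "[:of_int n, - of_int T, 1:]"])
  show "poly [:of_int n, - of_int T, 1:] z = 0" using assms by (simp add: power2_eq_square algebra_simps)
  show "\<forall>i. Polynomial.coeff [:of_int n, - of_int T, 1 :: complex:] i \<in> \<int>"
    by (simp add: coeff_pCons split: nat.splits)
qed simp

lemma eval_int_poly:
  fixes z :: complex
  shows "poly (map_poly of_int (p + q)) z = poly (map_poly of_int p) z + poly (map_poly of_int q) z"
    and "poly (map_poly of_int (p * q)) z = poly (map_poly of_int p) z * poly (map_poly of_int q) z"
proof -
  have add: "poly (map_poly of_int (p + q)) z = poly (map_poly of_int p) z + poly (map_poly of_int q) z" for p q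
    by (induction p q rule: poly_induct2) (simp_all add: map_poly_pCons algebra_simps)
  then show "poly (map_poly of_int (p + q)) z = poly (map_poly of_int p) z + poly (map_poly of_int q) z" .
  show "poly (map_poly of_int (p * q)) z = poly (map_poly of_int p) z * poly (map_poly of_int q) z"
    by (induction p) (simp_all add: map_poly_pCons add map_poly_smult algebra_simps)
qed

text \<open>Gauss's lemma: by comparison of contents, a primitive integer polynomial that divides a constant multiple of a monic one divides the monic one itself.\<close>

lemma monic_multiple_of_primitive:
  fixes f g :: "int poly"
  assumes "f \<noteq> 0" "content f = 1" "Polynomial.lead_coeff g = 1" "f dvd Polynomial.smult c g" "c \<noteq> 0"
  shows "is_unit (Polynomial.lead_coeff f)"
proof -
  obtain q where q: "Polynomial.smult c g = f * q" using assms(4) by (elim dvdE)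
  have cg: "content g = 1" 
    using content_dvd_coeff[of g "Polynomial.degree g"] assms(3) by (metis is_unit_content_iff)
  have "normalize c * content g = content f * content q"
    using arg_cong[OF q, of content] by (simp add: content_mult)
  then have "content q = normalize c" using cg assms(2) by simp
  then have "c dvd content q" by simp
  then obtain k where k: "content q = c * k" by (elim dvdE)
  define q' where "q' = Polynomial.smult k (primitive_part q)"
  have "q = Polynomial.smult c q'"
    using content_times_primitive_part[of q] unfolding k q'_def by simp
  then have "Polynomial.smult c g = Polynomial.smult c (f * q')" using q by (simp add: mult.commute)
  then have "Polynomial.smult c (g - f * q') = 0" by (simp add: smult_diff_right)
  then have "g = f * q'" using assms(5) by simp
  then have "Polynomial.lead_coeff f * Polynomial.lead_coeff q' = 1" using assms(3) by (metis lead_coeff_mult)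
  then show ?thesis by (metis dvd_triv_left)
qed

text \<open>A non-real algebraic integer that is a root of a rational quadratic has integral trace and norm. Pseudo-division of a monic integer polynomial with root z by the primitive part of the quadratic leaves a remainder of degree at most 1 vanishing at the non-real z, hence zero.\<close>

lemma quadratic_algebraic_int_imp_integral:
  fixes z :: complex and T n e :: int
  assumes z: "Im z \<noteq> 0" "algebraic_int z" and e: "e \<noteq> 0"
    and root: "of_int e * z\<^sup>2 - of_int T * z + of_int n = 0"
  shows "e dvd T" "e dvd n"
proof -
  define f0 :: "int poly" where "f0 = [:n, - T, e:]"
  define f where "f = primitive_part f0"
  have f0: "f0 \<noteq> 0" using e by (simp add: f0_def)
  have f0f: "f0 = Polynomial.smult (content f0) f" unfolding f_def by (rule content_times_primitive_part[symmetric])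
  have c0: "content f0 \<noteq> 0" using f0 by simp
  have fc: "content f = 1" using f0 by (simp add: f_def)
  have fn: "f \<noteq> 0" using f0 by (simp add: f_def)
  have deg: "Polynomial.degree f = 2" using e unfolding f_def by (simp add: f0_def)
  define ev where "ev = (\<lambda>p :: int poly. poly (map_poly of_int p) z :: complex)"
  have "ev f0 = 0" using root by (simp add: ev_def f0_def map_poly_pCons power2_eq_square algebra_simps)
  then have evf: "ev f = 0"
    using c0 by (subst (asm) f0f) (simp add: ev_def map_poly_smult)
  obtain g where g: "ev g = 0" "Polynomial.lead_coeff g = 1"
    using z(2) unfolding algebraic_int_altdef_ipoly ev_def by blast
  obtain q r where qr: "pseudo_divmod g f = (q, r)" by force
  define c where "c = Polynomial.coeff f (Polynomial.degree f) ^ (Suc (Polynomial.degree g) - Polynomial.degree f)"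
  have eq: "Polynomial.smult c g = f * q + r" and r: "r = 0 \<or> Polynomial.degree r < Polynomial.degree f"
    using pseudo_divmod[OF fn qr] unfolding c_def by blast+
  have "ev (Polynomial.smult c g) = of_int c * ev g" by (simp add: ev_def map_poly_smult)
  moreover have "ev (f * q + r) = ev f * ev q + ev r"
    by (simp add: ev_def eval_int_poly)
  ultimately have evr: "ev r = 0" using eq evf g(1) by simp
  have "r = 0"
  proof (rule ccontr)
    assume "r \<noteq> 0"
    then have "Polynomial.degree r < 2" using r deg by simp
    then have "Polynomial.degree r \<le> 1" by simp
    then have "r = [:Polynomial.coeff r 0, Polynomial.coeff r 1:]"
      by (intro poly_eqI) (auto simp: coeff_pCons coeff_eq_0 split: nat.splits)
    then obtain r0 r1 where rr: "r = [:r0, r1:]" by blast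
    have "of_int r0 + of_int r1 * z = 0" using evr unfolding ev_def rr by (simp add: map_poly_pCons mult.commute)
    then have "of_int r1 * Im z = 0" "of_int r0 + of_int r1 * Re z = 0" by (simp_all add: complex_eq_iff)
    then have "r1 = 0" "r0 = 0" using z(1) by auto
    then show False using \<open>r \<noteq> 0\<close> rr by simp
  qed
  then have "f dvd Polynomial.smult c g" using eq by simp
  moreover have "c \<noteq> 0" unfolding c_def using fn by simp
  ultimately have u: "is_unit (Polynomial.lead_coeff f)" using monic_multiple_of_primitive[OF fn fc g(2)] by blast
  have co: "Polynomial.coeff f0 i = content f0 * Polynomial.coeff f i" for i by (subst f0f) simp
  have "e = content f0 * Polynomial.lead_coeff f" using co[of 2] deg by (simp add: f0_def numeral_2_eq_2)
  then have "e dvd content f0" using u by (simp add: dvd_mult_unit_iff)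
  moreover have "n = content f0 * Polynomial.coeff f 0" "- T = content f0 * Polynomial.coeff f 1" using co[of 0] co[of 1] by (simp_all add: f0_def)
  ultimately show "e dvd T" "e dvd n" by (metis dvd_minus_iff dvd_mult2)+
qed

lemma of_rat_complex: "(of_rat a :: complex) = of_real (of_rat a)"
  by (cases a) (simp add: of_rat_rat)

lemma Re_of_rat [simp]: "Re (of_rat a) = of_rat a" and Im_of_rat [simp]: "Im (of_rat a) = 0"
  unfolding of_rat_complex by simp_all

context imaginary_quadratic
begin

text \<open>The element \<omega> = (s + sqrt D) / 2, with s the parity of D, generates the ring of integers over the integers in all cases at once; c0 is its norm. The sets of complex numbers OK and KK are the ring of integers and the field.\<close>

definition s where "s = D mod 2"
definition c0 where "c0 = (s - D) div 4"
definition \<omega> :: complex where "\<omega> = Complex (of_int s / 2) (sqrt (of_int N) / 2)"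
definition OK :: "complex set" where "OK = {of_int x + of_int y * \<omega> | x y. True}"
definition KK :: "complex set" where "KK = carrier (quad_field m)"
definition r :: complex where "r = csqrt (of_int m)"

lemma D_cases: "(m mod 4 = 1 \<and> D = m \<and> s = 1) \<or> ((m mod 4 = 2 \<or> m mod 4 = 3) \<and> D = 4 * m \<and> s = 0)"
proof -
  have "odd m" if "m mod 4 = 1" using that by presburger
  then show ?thesis using m_mod_4 unfolding s_def D_def quad_disc_def by (auto simp: odd_iff_mod_2_eq_one)
qed

lemma s_01: "s = 0 \<or> s = 1" using D_cases by blast

lemma c0: "4 * c0 = s - D"
proof -
  have "(s - D) mod 4 = 0" using D_cases by (elim disjE conjE) (simp_all, presburger)
  then show ?thesis unfolding c0_def by presburger
qed

lemma c0_real: "4 * real_of_int c0 = real_of_int s + real_of_int N"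
  using c0 N_eq by (metis diff_minus_eq_add minus_minus of_int_add of_int_mult of_int_numeral)

lemma Re_\<omega>: "Re \<omega> = of_int s / 2" and Im_\<omega>: "Im \<omega> = sqrt (of_int N) / 2"
  by (simp_all add: \<omega>_def)

lemma Im_\<omega>_pos: "0 < Im \<omega>" using N_pos by (simp add: Im_\<omega>)

lemma Im_\<omega>_squared: "(Im \<omega>)\<^sup>2 = of_int N / 4" using N_pos by (simp add: Im_\<omega> power_divide)

lemma \<omega>_squared: "\<omega> * \<omega> = of_int s * \<omega> - of_int c0"
proof (rule complex_eqI)
  have "Re (\<omega> * \<omega>) = (of_int s / 2)\<^sup>2 - of_int N / 4"
    using Im_\<omega>_squared by (simp add: Re_\<omega> power2_eq_square)
  also have "\<dots> = of_int s * (of_int s / 2) - of_int c0"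
    using c0_real s_01 by (auto simp: power2_eq_square)
  finally show "Re (\<omega> * \<omega>) = Re (of_int s * \<omega> - of_int c0)" by (simp add: Re_\<omega>)
qed (simp add: Re_\<omega>)

lemma \<omega>_pm: "of_int x + of_int y * \<omega> = of_int x' + of_int y' * \<omega> \<longleftrightarrow> x = x' \<and> y = y'"
proof
  assume e: "of_int x + of_int y * \<omega> = of_int x' + of_int y' * \<omega>"
  have "of_int y * Im \<omega> = of_int y' * Im \<omega>" using arg_cong[OF e, of Im] by simp
  then have "y = y'" using Im_\<omega>_pos by simp
  then show "x = x' \<and> y = y'" using e by simp
qed simp

lemma OK_I: "of_int x + of_int y * \<omega> \<in> OK" unfolding OK_def by blast
lemma OK_E: assumes "z \<in> OK" obtains x y where "z = of_int x + of_int y * \<omega>" using assms unfolding OK_def by blast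

lemma OK_of_int: "of_int x \<in> OK" using OK_I[of x 0] by simp
lemma OK_0: "0 \<in> OK" and OK_1: "1 \<in> OK" using OK_of_int[of 0] OK_of_int[of 1] by simp_all
lemma OK_\<omega>: "\<omega> \<in> OK" using OK_I[of 0 1] by simp

lemma OK_add: "z \<in> OK \<Longrightarrow> w \<in> OK \<Longrightarrow> z + w \<in> OK"
proof (elim OK_E)
  fix x y x' y' assume "z = of_int x + of_int y * \<omega>" "w = of_int x' + of_int y' * \<omega>"
  then have "z + w = of_int (x + x') + of_int (y + y') * \<omega>" by (simp add: algebra_simps)
  then show "z + w \<in> OK" using OK_I by metis
qed

lemma OK_mult: "z \<in> OK \<Longrightarrow> w \<in> OK \<Longrightarrow> z * w \<in> OK"
proof (elim OK_E)
  fix x y x' y' assume zw: "z = of_int x + of_int y * \<omega>" "w = of_int x' + of_int y' * \<omega>"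
  have "z * w = of_int x * of_int x' + (of_int x * of_int y' + of_int x' * of_int y) * \<omega> + of_int y * of_int y' * (\<omega> * \<omega>)"
    unfolding zw by (simp add: algebra_simps)
  also have "\<dots> = of_int (x * x' - y * y' * c0) + of_int (x * y' + x' * y + y * y' * s) * \<omega>"
    unfolding \<omega>_squared by (simp add: algebra_simps)
  finally show "z * w \<in> OK" using OK_I by metis
qed

lemma OK_minus: "z \<in> OK \<Longrightarrow> - z \<in> OK"
  using OK_mult[OF OK_of_int[of "-1"], of z] by simp

lemma r_eq: "r = Complex 0 (sqrt (of_int (- m)))"
  unfolding r_def using m_neg csqrt_of_real_nonpos[of "of_int m"] by (simp add: complex_eq_iff)

lemma r_sq: "r * r = of_int m"
  unfolding r_def using power2_csqrt[of "of_int m"] by (simp add: power2_eq_square)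

lemma Im_r: "0 < Im r" and Re_r: "Re r = 0" using m_neg by (simp_all add: r_eq)

lemma \<omega>_r: "2 * \<omega> = of_int s + of_int (2 - s) * r"
proof (cases "s = 1")
  case True
  then have "D = m" using D_cases by auto
  then show ?thesis using True N_eq by (simp add: complex_eq_iff Re_\<omega> Im_\<omega> r_eq)
next
  case False
  then have "s = 0" "D = 4 * m" using D_cases by auto
  moreover have "sqrt (- (4 * real_of_int m)) = 2 * sqrt (- real_of_int m)"
    using real_sqrt_mult[of 4 "- real_of_int m"] by simp
  ultimately show ?thesis using N_eq by (simp add: complex_eq_iff Re_\<omega> Im_\<omega> r_eq)
qed

lemma KK_eq: "KK = {of_rat a + of_rat b * r | a b. True}"
  unfolding KK_def quad_field_def r_def by simp

lemma KK_I: "of_rat a + of_rat b * r \<in> KK" unfolding KK_eq by blast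
lemma KK_E: assumes "z \<in> KK" obtains a b where "z = of_rat a + of_rat b * r" using assms unfolding KK_eq by blast

lemma KK_mult: "z \<in> KK \<Longrightarrow> w \<in> KK \<Longrightarrow> z * w \<in> KK"
proof (elim KK_E)
  fix a b a' b' assume zw: "z = of_rat a + of_rat b * r" "w = of_rat a' + of_rat b' * r"
  have "z * w = of_rat a * of_rat a' + (of_rat a * of_rat b' + of_rat a' * of_rat b) * r + of_rat b * of_rat b' * (r * r)"
    unfolding zw by (simp add: algebra_simps)
  also have "\<dots> = of_rat (a * a' + b * b' * of_int m) + of_rat (a * b' + a' * b) * r"
    unfolding r_sq by (simp add: of_rat_add of_rat_mult)
  finally show "z * w \<in> KK" using KK_I by metis
qed

lemma KK_inverse:
  assumes "z \<in> KK" shows "inverse z \<in> KK"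
proof (cases "z = 0")
  case False
  obtain a b where z: "z = of_rat a + of_rat b * r" using assms by (elim KK_E)
  define w where "w = of_rat a + of_rat (- b) * r"
  define n where "n = a * a - b * b * of_int m"
  have "z * w = of_rat a * of_rat a - of_rat b * of_rat b * (r * r)"
    unfolding z w_def by (simp add: algebra_simps of_rat_minus)
  also have "\<dots> = of_rat n" unfolding r_sq n_def by (simp add: of_rat_diff of_rat_mult)
  finally have zw: "z * w = of_rat n" .
  have "n \<noteq> 0"
  proof
    assume "n = 0"
    then have "w = 0" using zw False by simp
    moreover have "Im w = - (of_rat b * Im r)" "Re w = of_rat a"
      by (simp_all add: w_def of_rat_minus Re_r)
    ultimately have "of_rat b = (0 :: real)" "of_rat a = (0 :: real)" using Im_r by simp_all
    then show False using False unfolding z by simp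
  qed
  have "z * (of_rat (inverse n) * w) = of_rat (inverse n) * of_rat n"
    unfolding zw[symmetric] by (simp only: mult_ac)
  also have "\<dots> = 1" using \<open>n \<noteq> 0\<close> by (simp flip: of_rat_mult)
  finally have "inverse z = of_rat (inverse n) * w" by (rule inverse_unique)
  then show ?thesis using KK_mult KK_I[of "inverse n" 0] KK_I[of a "- b"] unfolding w_def by simp
qed (use KK_I[of 0 0] in simp)

lemma KK_divide: "z \<in> KK \<Longrightarrow> w \<in> KK \<Longrightarrow> z / w \<in> KK"
  unfolding divide_inverse by (intro KK_mult KK_inverse)

lemma OK_subset_KK: "z \<in> OK \<Longrightarrow> z \<in> KK"
proof (elim OK_E)
  fix x y assume z: "z = of_int x + of_int y * \<omega>"
  have "z = of_int x + of_int y * (of_int s + of_int (2 - s) * r) / 2"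
    unfolding z \<omega>_r[symmetric] by simp
  also have "\<dots> = of_rat (of_int x + of_int y * of_int s / 2) + of_rat (of_int y * of_int (2 - s) / 2) * r"
    using s_01 by (elim disjE) (simp_all add: of_rat_add of_rat_divide algebra_simps add_divide_distrib)
  finally show "z \<in> KK" using KK_I by metis
qed

lemma OK_algebraic_int: "z \<in> OK \<Longrightarrow> algebraic_int z"
proof (elim OK_E)
  fix x y assume z: "z = of_int x + of_int y * \<omega>"
  have "z\<^sup>2 - of_int (2 * x + y * s) * z + of_int (x * x + s * x * y + c0 * y * y) = of_int y * of_int y * (\<omega> * \<omega> - of_int s * \<omega> + of_int c0)"
    unfolding z by (simp add: power2_eq_square algebra_simps)
  also have "\<dots> = 0" unfolding \<omega>_squared by simp
  finally show ?thesis by (rule quadratic_algebraic_int)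
qed

lemma squarefree_square_denominator:
  fixes b e :: int
  assumes "coprime b e" "e\<^sup>2 dvd m * b\<^sup>2"
  shows "is_unit e"
proof -
  have "coprime (e\<^sup>2) (b\<^sup>2)" using assms(1) by (simp add: coprime_commute)
  then have "e\<^sup>2 dvd m" using assms(2) coprime_dvd_mult_left_iff by blast
  then show ?thesis using sqf unfolding squarefree_def by blast
qed

text \<open>Write z = a + b r with r^2 = m. Then A = 2 a and the norm of z are integers, so m (2 b)^2 is an integer, and p = 2 b is one because m is squarefree. The congruence between A^2 and m p^2 modulo 4 finally decides which halves are allowed.\<close>

lemma algebraic_int_in_OK:
  assumes "z \<in> KK" "algebraic_int z"
  shows "z \<in> OK"
proof -
  obtain a b where z: "z = of_rat a + of_rat b * r" using assms(1) by (elim KK_E)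
  show ?thesis
  proof (cases "b = 0")
    case True
    then have "z \<in> \<rat>" unfolding z by simp
    then have "z \<in> \<int>" using assms(2) rational_algebraic_int_is_int by blast
    then show ?thesis using OK_of_int by (elim Ints_cases) simp
  next
    case False
    obtain a1 a2 where a: "a = of_int a1 / of_int a2" "a2 > 0" by (metis quotient_of_denom_pos quotient_of_div surj_pair)
    obtain b1 b2 where b: "b = of_int b1 / of_int b2" "b2 > 0" by (metis quotient_of_denom_pos quotient_of_div surj_pair)
    have Imz: "Im z \<noteq> 0" unfolding z using False Im_r by simp
    have rt: "z\<^sup>2 - of_rat (2 * a) * z + of_rat (a\<^sup>2 - of_int m * b\<^sup>2) = 0"
    proof -
      have "z\<^sup>2 - of_rat (2 * a) * z + of_rat (a\<^sup>2 - of_int m * b\<^sup>2) = of_rat b * of_rat b * (r * r - of_int m)"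
        unfolding z by (simp add: of_rat_diff of_rat_mult power2_eq_square algebra_simps)
      then show ?thesis unfolding r_sq by simp
    qed
    \<comment> \<open>A common denominator of trace and norm.\<close>
    define e where "e = (a2 * b2)\<^sup>2"
    have e: "e \<noteq> 0" using a b by (simp add: e_def)
    have "2 * a * of_int e = of_int (2 * a1 * a2 * b2\<^sup>2)"
      using a b unfolding e_def by (simp add: power2_eq_square)
    moreover have "(a\<^sup>2 - of_int m * b\<^sup>2) * of_int e = of_int ((a1 * b2)\<^sup>2 - m * (b1 * a2)\<^sup>2)"
    proof -
      have ab: "a * of_int a2 = of_int a1" "b * of_int b2 = of_int b1" using a b by simp_all
      have "(a\<^sup>2 - of_int m * b\<^sup>2) * of_int e = ((a * of_int a2) * of_int b2)\<^sup>2 - of_int m * ((b * of_int b2) * of_int a2)\<^sup>2"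
        unfolding e_def by (simp add: power2_eq_square algebra_simps)
      then show ?thesis unfolding ab by simp
    qed
    ultimately obtain T n where Tn: "2 * a * of_int e = of_int T" "(a\<^sup>2 - of_int m * b\<^sup>2) * of_int e = of_int n" by blast
    have "of_int e * z\<^sup>2 - of_int T * z + of_int n = of_int e * (z\<^sup>2 - of_rat (2 * a) * z + of_rat (a\<^sup>2 - of_int m * b\<^sup>2))"
    proof -
      have T: "of_int T = (of_rat (2 * a) * of_int e :: complex)"
        by (metis Tn(1) of_rat_mult of_rat_of_int_eq)
      have n: "of_int n = (of_rat (a\<^sup>2 - of_int m * b\<^sup>2) * of_int e :: complex)"
        by (metis Tn(2) of_rat_mult of_rat_of_int_eq)
      show ?thesis unfolding T n by (simp only: algebra_simps)
    qed
    then have "of_int e * z\<^sup>2 - of_int T * z + of_int n = 0" unfolding rt by simp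
    from quadratic_algebraic_int_imp_integral[OF Imz assms(2) e this]
    obtain A n' where A: "T = e * A" "n = e * n'" by (auto elim!: dvdE)
    have "(2 * a - of_int A) * of_int e = 0" "(a\<^sup>2 - of_int m * b\<^sup>2 - of_int n') * of_int e = 0"
      unfolding left_diff_distrib[of _ _ "of_int e"] Tn A
      using Tn(2)[unfolded left_diff_distrib[of _ _ "of_int e"] A] by (simp_all add: mult.commute)
    then have A2: "2 * a = of_int A" and n': "a\<^sup>2 - of_int m * b\<^sup>2 = of_int n'"
      using e by (simp_all only: mult_eq_0_iff of_int_eq_0_iff right_minus_eq simp_thms)
    obtain p q where pq: "2 * b = of_int p / of_int q" "q > 0" "coprime p q"
      by (metis quotient_of_coprime quotient_of_denom_pos quotient_of_div surj_pair)
    have "of_int m * (2 * b)\<^sup>2 = (of_int (A\<^sup>2 - 4 * n') :: rat)"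
    proof -
      have "of_int m * (2 * b)\<^sup>2 = (2 * a)\<^sup>2 - 4 * (a\<^sup>2 - of_int m * b\<^sup>2)" by (simp add: power2_eq_square algebra_simps)
      also have "\<dots> = of_int (A\<^sup>2 - 4 * n')" unfolding A2 n' by simp
      finally show ?thesis .
    qed
    then have "of_int (m * p\<^sup>2) = (of_int ((A\<^sup>2 - 4 * n') * q\<^sup>2) :: rat)"
      unfolding pq(1) using pq(2) by (simp add: power_divide field_simps)
    then have mp: "m * p\<^sup>2 = (A\<^sup>2 - 4 * n') * q\<^sup>2" by (simp only: of_int_eq_iff)
    then have "q\<^sup>2 dvd m * p\<^sup>2" by simp
    then have "q = 1" using squarefree_square_denominator[OF pq(3)] pq(2) by simp
    then have b2: "2 * b = of_int p" and mp: "m * p\<^sup>2 = A\<^sup>2 - 4 * n'" using pq(1) mp by simp_all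
    have z2: "2 * z = of_int A + of_int p * r"
    proof -
      have "2 * z = of_rat (2 * a) + of_rat (2 * b) * r" unfolding z by (simp add: of_rat_mult algebra_simps)
      then show ?thesis unfolding A2 b2 by simp
    qed
    have par: "4 dvd A\<^sup>2 - m * p\<^sup>2" using mp by simp
    show ?thesis
    proof (cases "s = 1")
      case True
      then have m1: "m mod 4 = 1" using D_cases by auto
      then have "even (A - p)"
      proof -
        have "odd m" using m1 by presburger
        moreover have "even (A\<^sup>2 - m * p\<^sup>2)" using par by presburger
        ultimately show ?thesis by simp
      qed
      then obtain x where "A - p = 2 * x" by (elim evenE)
      then have A': "A = p + 2 * x" by simp
      have "2 * \<omega> = 1 + r" using \<omega>_r True by simp
      then have r': "r = 2 * \<omega> - 1" by simp
      have "2 * z = 2 * (of_int x + of_int p * \<omega>)" unfolding z2 A' r' by (simp add: algebra_simps)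
      then have "z = of_int x + of_int p * \<omega>" by (metis mult_left_cancel zero_neq_numeral)
      then show ?thesis using OK_I by simp
    next
      case False
      then have s0: "s = 0" and m23: "m mod 4 = 2 \<or> m mod 4 = 3" using D_cases by auto
      have "even A \<and> even p"
      proof -
        have square_ind: "x\<^sup>2 mod 4 = (if even x then 0 else 1)" for x :: int
        proof (cases "even x")
          case True
          then obtain y where "x = 2 * y" by (elim evenE)
          then show ?thesis by (simp add: power2_eq_square)
        next
          case False
          then obtain y where "x = 2 * y + 1" by (elim oddE)
          then have "x\<^sup>2 = 4 * (y * y + y) + 1" by (simp add: power2_eq_square algebra_simps)
          then obtain k where "x\<^sup>2 = 4 * k + 1" by blast
          then show ?thesis using False by simp
        qed
        have "A\<^sup>2 mod 4 = (m * p\<^sup>2) mod 4" using par by (simp add: mod_eq_dvd_iff)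
        also have "\<dots> = ((m mod 4) * (p\<^sup>2 mod 4)) mod 4" by (simp add: mod_mult_eq)
        finally show ?thesis unfolding square_ind using m23 by (auto split: if_splits)
      qed
      then obtain x y where "A = 2 * x" "p = 2 * y" by (elim conjE evenE)
      moreover have "r = \<omega>" using \<omega>_r s0 by simp
      ultimately have "2 * z = 2 * (of_int x + of_int y * \<omega>)" unfolding z2 by (simp add: algebra_simps)
      then have "z = of_int x + of_int y * \<omega>" by (metis mult_left_cancel zero_neq_numeral)
      then show ?thesis using OK_I by simp
    qed
  qed
qed

lemma carrier_quad_integers: "carrier (quad_integers m) = OK"
proof -
  have "carrier (quad_integers m) = {z \<in> KK. algebraic_int z}"
    unfolding quad_integers_def KK_def by simp
  also have "\<dots> = OK" using OK_subset_KK OK_algebraic_int algebraic_int_in_OK by blast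
  finally show ?thesis .
qed

end

section \<open>Ideal classes as classes of ideals up to scaling\<close>

context imaginary_quadratic
begin

text \<open>Nonzero ideals, described inside the complex numbers without the ring record.\<close>

definition nz_ideal :: "complex set \<Rightarrow> bool" where
  "nz_ideal I \<longleftrightarrow> I \<subseteq> OK \<and> 0 \<in> I \<and> (\<forall>x\<in>I. \<forall>y\<in>I. x + y \<in> I) \<and> (\<forall>a\<in>OK. \<forall>x\<in>I. a * x \<in> I) \<and> I \<noteq> {0}"

lemma R_simps: "carrier (quad_integers m) = OK" "monoid.mult (quad_integers m) = (*)" "monoid.one (quad_integers m) = 1"
  "ring.zero (quad_integers m) = 0" "ring.add (quad_integers m) = (+)"
  using carrier_quad_integers by (simp_all add: quad_integers_def quad_field_def)

lemma ring_R: "ring (quad_integers m)"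
proof -
  have "cring (quad_integers m)"
  proof (rule cringI)
    show "abelian_group (quad_integers m)"
      by (rule abelian_groupI) (auto simp: R_simps OK_0 OK_add add_ac intro!: bexI[of _ "- _"] dest: OK_minus)
    show "comm_monoid (quad_integers m)"
      by (rule comm_monoidI) (auto simp: R_simps OK_1 OK_mult)
  qed (simp add: R_simps algebra_simps)
  then show ?thesis by (rule cring.axioms(1))
qed

lemma nz_ideal_minus: "nz_ideal I \<Longrightarrow> x \<in> I \<Longrightarrow> - x \<in> I"
  using OK_of_int[of "-1"] unfolding nz_ideal_def by fastforce

lemma ideal_iff_nz_ideal: "ideal I (quad_integers m) \<and> I \<noteq> {0} \<longleftrightarrow> nz_ideal I"
proof
  assume I: "ideal I (quad_integers m) \<and> I \<noteq> {0}"
  then have A: "additive_subgroup I (quad_integers m)" by (auto intro: ideal.axioms(1))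
  have "x + y \<in> I" if "x \<in> I" "y \<in> I" for x y
    using additive_subgroup.a_closed[OF A that] by (simp add: R_simps)
  moreover have "a * x \<in> I" if "a \<in> OK" "x \<in> I" for a x
    using ideal.I_l_closed[OF conjunct1[OF I] that(2), of a] that by (simp add: R_simps)
  moreover have "I \<subseteq> OK" using additive_subgroup.a_subset[OF A] by (simp add: R_simps)
  moreover have "0 \<in> I" using additive_subgroup.zero_closed[OF A] by (simp add: R_simps)
  ultimately show "nz_ideal I" using I unfolding nz_ideal_def by blast
next
  assume I: "nz_ideal I"
  interpret ring "quad_integers m" by (rule ring_R)
  have "ideal I (quad_integers m)"
  proof (rule idealI[OF ring_R])
    show "subgroup I (add_monoid (quad_integers m))"
    proof (rule group.subgroupI)
      show "group (add_monoid (quad_integers m))" by (rule a_group)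
      show "I \<subseteq> carrier (add_monoid (quad_integers m))" using I by (simp add: nz_ideal_def R_simps)
      show "I \<noteq> {}" using I by (auto simp: nz_ideal_def)
      fix x assume x: "x \<in> I"
      have "inv\<^bsub>add_monoid (quad_integers m)\<^esub> x = - x"
        by (rule group.inv_equality[OF a_group]) (use x I OK_minus in \<open>auto simp: R_simps nz_ideal_def\<close>)
      then show "inv\<^bsub>add_monoid (quad_integers m)\<^esub> x \<in> I" using nz_ideal_minus[OF I x] by simp
    next
      fix x y assume "x \<in> I" "y \<in> I"
      then show "x \<otimes>\<^bsub>add_monoid (quad_integers m)\<^esub> y \<in> I" using I by (simp add: R_simps nz_ideal_def)
    qed
  next
    fix a x assume "a \<in> I" "x \<in> carrier (quad_integers m)"
    then have "x * a \<in> I" using I unfolding nz_ideal_def R_simps by blast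
    then show "x \<otimes>\<^bsub>quad_integers m\<^esub> a \<in> I" "a \<otimes>\<^bsub>quad_integers m\<^esub> x \<in> I"
      unfolding R_simps by (simp_all add: mult.commute)
  qed
  then show "ideal I (quad_integers m) \<and> I \<noteq> {0}" using I by (simp add: nz_ideal_def)
qed

text \<open>The coset of J in the class group, as a set of fractional ideals: the product of J with a principal ideal is a multiple of J.\<close>

definition scaling_class :: "complex set \<Rightarrow> complex set set" where
  "scaling_class J = {(\<lambda>x. a * x) ` J | a. a \<in> KK \<and> a \<noteq> 0}"

definition ideal_classes :: "complex set set set" where "ideal_classes = scaling_class ` {I. nz_ideal I}"

lemma image_mult_image: "(\<lambda>x. a * x) ` ((\<lambda>x. b * x) ` J) = (\<lambda>x. (a * b) * x) ` J" for a b :: complex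
  by (simp add: image_image mult.assoc)

lemma scaling_class_scale:
  assumes "a \<in> KK" "a \<noteq> 0"
  shows "scaling_class ((\<lambda>x. a * x) ` J) = scaling_class J"
proof
  show "scaling_class ((\<lambda>x. a * x) ` J) \<subseteq> scaling_class J"
  proof
    fix Y assume "Y \<in> scaling_class ((\<lambda>x. a * x) ` J)"
    then obtain b where b: "b \<in> KK" "b \<noteq> 0" "Y = (\<lambda>x. (b * a) * x) ` J"
      unfolding scaling_class_def image_mult_image by blast
    have "b * a \<in> KK" "b * a \<noteq> 0" using KK_mult b assms by simp_all
    then show "Y \<in> scaling_class J" unfolding scaling_class_def b(3) by blast
  qed
  show "scaling_class J \<subseteq> scaling_class ((\<lambda>x. a * x) ` J)"
  proof
    fix Y assume "Y \<in> scaling_class J"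
    then obtain b where b: "b \<in> KK" "b \<noteq> 0" "Y = (\<lambda>x. b * x) ` J" unfolding scaling_class_def by blast
    have "Y = (\<lambda>x. (b / a) * x) ` ((\<lambda>x. a * x) ` J)" unfolding image_mult_image b(3) using assms by simp
    moreover have "b / a \<in> KK" "b / a \<noteq> 0" using KK_divide b assms by simp_all
    ultimately show "Y \<in> scaling_class ((\<lambda>x. a * x) ` J)" unfolding scaling_class_def by blast
  qed
qed

lemma KK_1: "1 \<in> KK" using OK_subset_KK OK_1 by simp

lemma scaling_class_refl: "J \<in> scaling_class J"
  unfolding scaling_class_def using KK_1 by (auto intro!: exI[of _ 1])

lemma scaling_class_eq_iff: "scaling_class I = scaling_class J \<longleftrightarrow> (\<exists>a. a \<in> KK \<and> a \<noteq> 0 \<and> I = (\<lambda>x. a * x) ` J)"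
proof
  assume "scaling_class I = scaling_class J"
  then have "I \<in> scaling_class J" using scaling_class_refl[of I] by simp
  then show "\<exists>a. a \<in> KK \<and> a \<noteq> 0 \<and> I = (\<lambda>x. a * x) ` J" unfolding scaling_class_def by blast
next
  assume "\<exists>a. a \<in> KK \<and> a \<noteq> 0 \<and> I = (\<lambda>x. a * x) ` J"
  then show "scaling_class I = scaling_class J" using scaling_class_scale by blast
qed

lemma fractional_ideal_iff:
  "fractional_ideal m J \<longleftrightarrow> (\<exists>d I. d \<in> OK \<and> d \<noteq> 0 \<and> nz_ideal I \<and> J = (\<lambda>x. inverse d * x) ` I)"
proof
  assume "fractional_ideal m J"
  then obtain d where d: "d \<in> OK" "d \<noteq> 0" "ideal ((\<lambda>x. d * x) ` J) (quad_integers m)" "J \<noteq> {0}"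
    unfolding fractional_ideal_def R_simps by blast
  have J: "J = (\<lambda>x. inverse d * x) ` ((\<lambda>x. d * x) ` J)" unfolding image_mult_image using d(2) by simp
  have "(\<lambda>x. d * x) ` J \<noteq> {0}"
  proof
    assume e: "(\<lambda>x. d * x) ` J = {0}"
    then have "J = {0}" using J by simp
    then show False using d(4) by simp
  qed
  then have "nz_ideal ((\<lambda>x. d * x) ` J)" using ideal_iff_nz_ideal d(3) by blast
  then show "\<exists>d I. d \<in> OK \<and> d \<noteq> 0 \<and> nz_ideal I \<and> J = (\<lambda>x. inverse d * x) ` I" using d J by blast
next
  assume "\<exists>d I. d \<in> OK \<and> d \<noteq> 0 \<and> nz_ideal I \<and> J = (\<lambda>x. inverse d * x) ` I"
  then obtain d I where d: "d \<in> OK" "d \<noteq> 0" "nz_ideal I" "J = (\<lambda>x. inverse d * x) ` I" by blast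
  have I: "(\<lambda>x. d * x) ` J = I" unfolding d(4) image_mult_image using d(2) by simp
  have "ideal I (quad_integers m)" using d(3) ideal_iff_nz_ideal by blast
  then have "ideal ((\<lambda>x. d * x) ` J) (quad_integers m)" unfolding I .
  moreover have "J \<subseteq> carrier (quad_field m)"
  proof
    fix z assume "z \<in> J"
    then obtain x where x: "x \<in> I" "z = inverse d * x" unfolding d(4) by blast
    have "x \<in> OK" using x(1) d(3) unfolding nz_ideal_def by blast
    then show "z \<in> carrier (quad_field m)"
      unfolding x(2) KK_def[symmetric] by (intro KK_mult KK_inverse OK_subset_KK d(1))
  qed
  moreover have "J \<noteq> {0}" using I d(3) unfolding nz_ideal_def by auto
  ultimately show "fractional_ideal m J" unfolding fractional_ideal_def R_simps using d(1,2) by blast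
qed

text \<open>Since J is already closed under addition and under multiplication by integers of the field, the additive closure in the product of ideals adds nothing.\<close>

lemma ideal_prod_principal:
  assumes J: "J \<noteq> {}" "\<And>x y. x \<in> J \<Longrightarrow> y \<in> J \<Longrightarrow> x + y \<in> J" "\<And>a x. a \<in> OK \<Longrightarrow> x \<in> J \<Longrightarrow> a * x \<in> J"
  shows "ideal_prod (quad_field m) ((\<lambda>x. a * x) ` OK) J = (\<lambda>x. a * x) ` J"
proof
  have F: "monoid.mult (quad_field m) = (*)" "ring.add (quad_field m) = (+)" by (simp_all add: quad_field_def)
  show "ideal_prod (quad_field m) ((\<lambda>x. a * x) ` OK) J \<subseteq> (\<lambda>x. a * x) ` J"
  proof
    fix z assume "z \<in> ideal_prod (quad_field m) ((\<lambda>x. a * x) ` OK) J"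
    then show "z \<in> (\<lambda>x. a * x) ` J"
    proof (induction z rule: ideal_prod.induct)
      case (prod i j)
      then obtain b where b: "b \<in> OK" "i = a * b" by blast
      then have "i \<otimes>\<^bsub>quad_field m\<^esub> j = a * (b * j)" by (simp add: F mult.assoc)
      then show ?case using J(3) b prod by blast
    next
      case (sum s1 s2)
      then obtain x y where "x \<in> J" "y \<in> J" "s1 = a * x" "s2 = a * y" by blast
      then have "s1 \<oplus>\<^bsub>quad_field m\<^esub> s2 = a * (x + y)" by (simp add: F algebra_simps)
      then show ?case using J(2) \<open>x \<in> J\<close> \<open>y \<in> J\<close> by blast
    qed
  qed
  show "(\<lambda>x. a * x) ` J \<subseteq> ideal_prod (quad_field m) ((\<lambda>x. a * x) ` OK) J"
  proof
    fix z assume "z \<in> (\<lambda>x. a * x) ` J"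
    then obtain x where x: "x \<in> J" "z = a * x" by blast
    have "a \<in> (\<lambda>x. a * x) ` OK" using OK_1 by force
    from ideal_prod.prod[OF this x(1), of "quad_field m"]
    show "z \<in> ideal_prod (quad_field m) ((\<lambda>x. a * x) ` OK) J" using x(2) by (simp add: F)
  qed
qed

text \<open>Every fractional ideal is a multiple of an ordinary ideal, so counting cosets means counting ideals up to scaling.\<close>

lemma class_number_eq: "class_number m = card ideal_classes"
proof -
  have coset: "principal_fractional_ideals m #>\<^bsub>fractional_ideal_group m\<^esub> J = scaling_class J" if fr: "fractional_ideal m J" for J
  proof -
    obtain d I where d: "d \<in> OK" "d \<noteq> 0" "nz_ideal I" "J = (\<lambda>x. inverse d * x) ` I"
      using fr unfolding fractional_ideal_iff by blast
    have J1: "J \<noteq> {}" using d(3,4) unfolding nz_ideal_def by auto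
    have J2: "x + y \<in> J" if xy: "x \<in> J" "y \<in> J" for x y
    proof -
      obtain x' y' where "x' \<in> I" "y' \<in> I" "x = inverse d * x'" "y = inverse d * y'" using xy d(4) by blast
      then have "x + y = inverse d * (x' + y')" "x' + y' \<in> I" using d(3) unfolding nz_ideal_def by (simp_all add: distrib_left)
      then show ?thesis unfolding d(4) by blast
    qed
    have J3: "a * x \<in> J" if ax: "a \<in> OK" "x \<in> J" for a x
    proof -
      obtain x' where "x' \<in> I" "x = inverse d * x'" using ax d(4) by blast
      then have "a * x = inverse d * (a * x')" "a * x' \<in> I" using d(3) ax unfolding nz_ideal_def by simp_all
      then show ?thesis unfolding d(4) by blast
    qed
    have "principal_fractional_ideals m #>\<^bsub>fractional_ideal_group m\<^esub> J
        = {ideal_prod (quad_field m) P J | P. P \<in> principal_fractional_ideals m}"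
      unfolding r_coset_def fractional_ideal_group_def by auto
    also have "\<dots> = {ideal_prod (quad_field m) ((\<lambda>x. a * x) ` OK) J | a. a \<in> KK \<and> a \<noteq> 0}"
      unfolding principal_fractional_ideals_def R_simps KK_def[symmetric] by blast
    also have "\<dots> = scaling_class J"
    proof -
      have "ideal_prod (quad_field m) ((\<lambda>x. a * x) ` OK) J = (\<lambda>x. a * x) ` J" for a
        by (rule ideal_prod_principal[OF J1]) (use J2 J3 in blast)+
      then show ?thesis unfolding scaling_class_def by simp
    qed
    finally show ?thesis .
  qed
  have "carrier (ideal_class_group m) = (\<lambda>J. principal_fractional_ideals m #>\<^bsub>fractional_ideal_group m\<^esub> J) ` {J. fractional_ideal m J}"
    unfolding ideal_class_group_def FactGroup_def RCOSETS_def by (auto simp: fractional_ideal_group_def)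
  also have "\<dots> = scaling_class ` {J. fractional_ideal m J}" using coset by (intro image_cong) auto
  also have "\<dots> = ideal_classes"
  proof
    show "scaling_class ` {J. fractional_ideal m J} \<subseteq> ideal_classes"
    proof
      fix c assume "c \<in> scaling_class ` {J. fractional_ideal m J}"
      then obtain d I where d: "d \<in> OK" "d \<noteq> 0" "nz_ideal I" "c = scaling_class ((\<lambda>x. inverse d * x) ` I)"
        unfolding fractional_ideal_iff by blast
      then have "c = scaling_class I" using scaling_class_scale[of "inverse d"] KK_inverse OK_subset_KK by simp
      then show "c \<in> ideal_classes" unfolding ideal_classes_def using d(3) by blast
    qed
    show "ideal_classes \<subseteq> scaling_class ` {J. fractional_ideal m J}"
    proof
      fix c assume "c \<in> ideal_classes"
      then obtain I where I: "nz_ideal I" "c = scaling_class I" unfolding ideal_classes_def by blast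
      have "fractional_ideal m I" unfolding fractional_ideal_iff using I(1) OK_1 by (intro exI[of _ 1] exI[of _ I]) simp
      then show "c \<in> scaling_class ` {J. fractional_ideal m J}" using I by blast
    qed
  qed
  finally show ?thesis unfolding class_number_def Coset.order_def by simp
qed

text \<open>The covolume of a lattice is used to define norms of ideals in a way that visibly scales with the square of the absolute value of a multiplier.\<close>

definition lat :: "complex \<Rightarrow> complex \<Rightarrow> complex set" where
  "lat u v = {of_int x * u + of_int y * v | x y. True}"

lemma lat_I: "of_int x * u + of_int y * v \<in> lat u v" unfolding lat_def by blast
lemma lat_E: assumes "z \<in> lat u v" obtains x y where "z = of_int x * u + of_int y * v" using assms unfolding lat_def by blast

lemma lat_scale: "(\<lambda>x. a * x) ` lat u v = lat (a * u) (a * v)"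
proof -
  have "a * (of_int x * u + of_int y * v) = of_int x * (a * u) + of_int y * (a * v)" for x y by (simp add: algebra_simps)
  then show ?thesis unfolding lat_def by (auto simp: image_iff) metis+
qed

definition area :: "complex \<Rightarrow> complex \<Rightarrow> real" where "area u v = Im (cnj u * v)"

lemma area_scale: "area (a * u) (a * v) = (cmod a)\<^sup>2 * area u v"
proof -
  have "cnj (a * u) * (a * v) = of_real ((cmod a)\<^sup>2) * (cnj u * v)"
    using complex_norm_square[of a] by (simp add: mult_ac)
  then show ?thesis unfolding area_def by (metis Im_complex_of_real Re_complex_of_real mult_zero_left add.right_neutral times_complex.sel(2))
qed

lemma area_le:
  assumes "u' \<in> lat u v" "v' \<in> lat u v" "area u' v' \<noteq> 0"
  shows "\<bar>area u v\<bar> \<le> \<bar>area u' v'\<bar>"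
proof -
  obtain p q where u': "u' = of_int p * u + of_int q * v" using assms(1) by (elim lat_E)
  obtain p' q' where v': "v' = of_int p' * u + of_int q' * v" using assms(2) by (elim lat_E)
  have a: "area u' v' = of_int (p * q' - q * p') * area u v"
    unfolding u' v' area_def by (simp add: algebra_simps)
  have "p * q' - q * p' \<noteq> 0"
  proof
    assume e: "p * q' - q * p' = 0"
    show False using a assms(3) unfolding e by simp
  qed
  then have "1 \<le> \<bar>of_int (p * q' - q * p') :: real\<bar>" by linarith
  then show ?thesis unfolding a abs_mult using mult_right_mono[of 1 _ "\<bar>area u v\<bar>"] by simp
qed

lemma lat_gen: "u \<in> lat u v" "v \<in> lat u v"
  using lat_I[of 1 u 0 v] lat_I[of 0 u 1 v] by simp_all

text \<open>Each basis is expressed by the other one with an integer matrix, and a nonzero integer determinant has absolute value at least 1.\<close>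

lemma area_unique:
  assumes "lat u v = lat u' v'" "area u v \<noteq> 0" "area u' v' \<noteq> 0"
  shows "\<bar>area u v\<bar> = \<bar>area u' v'\<bar>"
  using area_le[of u u' v' v] area_le[of u' u v v'] lat_gen assms by (metis order_antisym)

end

section \<open>The shape of the ideals and their norms\<close>

lemma int_subgroup_generator:
  fixes S :: "int set"
  assumes mult: "\<And>c x. x \<in> S \<Longrightarrow> c * x \<in> S" and add: "\<And>x y. x \<in> S \<Longrightarrow> y \<in> S \<Longrightarrow> x + y \<in> S"
    and nz: "z \<in> S" "z \<noteq> 0"
  obtains k where "0 < k" "\<And>x. x \<in> S \<longleftrightarrow> k dvd x"
proof -
  define P where "P = (\<lambda>n. 0 < n \<and> int n \<in> S)"
  have "\<bar>z\<bar> \<in> S" using mult[OF nz(1), of "sgn z"] by (simp add: abs_sgn mult.commute)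
  then have "P (nat \<bar>z\<bar>)" using nz(2) by (simp add: P_def)
  then have L: "P (LEAST n. P n)" by (rule LeastI)
  define k where "k = int (LEAST n. P n)"
  have k: "0 < k" "k \<in> S" using L by (simp_all add: k_def P_def)
  have "k dvd x" if x: "x \<in> S" for x
  proof (rule ccontr)
    assume "\<not> k dvd x"
    then have "0 < x mod k" using k(1) by (simp add: dvd_eq_mod_eq_0 order_less_le)
    have "x + (- (x div k)) * k \<in> S" by (rule add[OF x mult[OF k(2)]])
    moreover have "x + (- (x div k)) * k = x mod k" by (simp add: minus_div_mult_eq_mod)
    ultimately have "P (nat (x mod k))" using \<open>0 < x mod k\<close> by (simp add: P_def)
    then have "(LEAST n. P n) \<le> nat (x mod k)" by (rule Least_le)
    moreover have "x mod k < k" using k(1) by simp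
    ultimately show False using \<open>0 < x mod k\<close> unfolding k_def by linarith
  qed
  moreover have "x \<in> S" if "k dvd x" for x using that mult[OF k(2)] by (metis dvdE mult.commute)
  ultimately show ?thesis using k(1) that by blast
qed

context imaginary_quadratic
begin

text \<open>The value f b is the norm of b + \<omega>; as a polynomial in b it has discriminant D.\<close>

definition f :: "int \<Rightarrow> int" where "f b = b * b + s * b + c0"

text \<open>The triple (k, a, b) encodes the ideal k (a Z + (b + \<omega>) Z). The divisibility condition makes this lattice an ideal, and the range of b makes the triple unique.\<close>

definition triples :: "(int \<times> int \<times> int) set" where
  "triples = {(k, a, b). 0 < k \<and> 0 < a \<and> 0 \<le> b \<and> b < a \<and> a dvd f b}"

definition ideal_of :: "int \<Rightarrow> int \<Rightarrow> int \<Rightarrow> complex set" where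
  "ideal_of k a b = lat (of_int (k * a)) (of_int k * (of_int b + \<omega>))"

lemma cnj_\<omega>: "cnj \<omega> = of_int s - \<omega>"
  by (simp add: complex_eq_iff Re_\<omega>)

lemma f_factor: "(of_int b + \<omega>) * (of_int b + cnj \<omega>) = of_int (f b)"
proof -
  have "(of_int b + \<omega>) * (of_int b + cnj \<omega>) = of_int b * of_int b + of_int b * of_int s + of_int s * \<omega> - \<omega> * \<omega>"
    unfolding cnj_\<omega> by (simp add: algebra_simps)
  then show ?thesis unfolding \<omega>_squared f_def by (simp add: algebra_simps)
qed

lemma four_f: "4 * f b = (2 * b + s)\<^sup>2 + N"
proof -
  have "4 * f b = 4 * (b * b) + 4 * (s * b) + 4 * c0" by (simp add: f_def)
  also have "\<dots> = 4 * (b * b) + 4 * (s * b) + (s - D)" unfolding c0 ..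
  also have "\<dots> = (2 * b + s)\<^sup>2 + N" using s_01 N_eq by (auto simp: power2_eq_square algebra_simps)
  finally show ?thesis .
qed

lemma f_pos: "0 < f b"
proof -
  have "0 \<le> (2 * b + s)\<^sup>2" by simp
  then show ?thesis using four_f[of b] N_pos by linarith
qed

lemma f_reflect: "f (- b - s) = f b" by (simp add: f_def algebra_simps)

lemma f_cong: "a dvd f (b + a * t) \<longleftrightarrow> a dvd f b"
proof -
  have "f (b + a * t) = f b + a * (2 * b * t + a * t * t + s * t)" by (simp add: f_def algebra_simps)
  then show ?thesis by (simp only: dvd_add_left_iff[OF dvd_triv_left])
qed

lemma ideal_of_mem:
  "of_int p + of_int q * \<omega> \<in> ideal_of k a b \<longleftrightarrow> (\<exists>x y. p = k * (x * a + y * b) \<and> q = k * y)"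
proof -
  have E: "of_int x * of_int (k * a) + of_int y * (of_int k * (of_int b + \<omega>)) = of_int (k * (x * a + y * b)) + of_int (k * y) * \<omega>" for x y
    by (simp add: algebra_simps)
  show ?thesis unfolding ideal_of_def lat_def mem_Collect_eq E \<omega>_pm by blast
qed

lemma ideal_of_subset: "ideal_of k a b \<subseteq> OK"
proof
  fix z assume "z \<in> ideal_of k a b"
  then obtain x y where "z = of_int x * of_int (k * a) + of_int y * (of_int k * (of_int b + \<omega>))" unfolding ideal_of_def by (elim lat_E)
  then have "z = of_int (k * (x * a + y * b)) + of_int (k * y) * \<omega>" by (simp add: algebra_simps)
  then show "z \<in> OK" by (simp only: OK_I)
qed

lemma ideal_of_shift: "ideal_of k a (b + a * t) = ideal_of k a b"
proof -
  have "of_int x * of_int (k * a) + of_int y * (of_int k * (of_int (b + a * t) + \<omega>)) = of_int (x + y * t) * of_int (k * a) + of_int y * (of_int k * (of_int b + \<omega>))" for x y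
    by (simp add: algebra_simps)
  moreover have "of_int x * of_int (k * a) + of_int y * (of_int k * (of_int b + \<omega>)) = of_int (x - y * t) * of_int (k * a) + of_int y * (of_int k * (of_int (b + a * t) + \<omega>))" for x y
    by (simp add: algebra_simps)
  ultimately show ?thesis unfolding ideal_of_def lat_def by blast
qed

lemma ideal_of_mod: "ideal_of k a (b mod a) = ideal_of k a b"
  using ideal_of_shift[of k a b "- (b div a)"] by (simp add: minus_mult_div_eq_mod)

lemma ideal_of_nz_ideal:
  assumes "0 < k" "0 < a" "a dvd f b"
  shows "nz_ideal (ideal_of k a b)"
  unfolding nz_ideal_def
proof (intro conjI ballI)
  obtain g where g: "f b = a * g" using assms(3) by (elim dvdE)
  let ?u = "of_int (k * a) :: complex" and ?v = "of_int k * (of_int b + \<omega>)"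
  show "ideal_of k a b \<subseteq> OK" by (rule ideal_of_subset)
  show "0 \<in> ideal_of k a b" unfolding ideal_of_def using lat_I[of 0 _ 0] by simp
  have "?u \<in> ideal_of k a b" unfolding ideal_of_def by (rule lat_gen)
  moreover have "?u \<noteq> 0" using assms by simp
  ultimately show "ideal_of k a b \<noteq> {0}" by blast
  fix z assume "z \<in> ideal_of k a b"
  then obtain x y where z: "z = of_int x * ?u + of_int y * ?v" unfolding ideal_of_def by (elim lat_E)
  {
    fix w assume "w \<in> ideal_of k a b"
    then obtain x' y' where w: "w = of_int x' * ?u + of_int y' * ?v" unfolding ideal_of_def by (elim lat_E)
    have "z + w = of_int (x + x') * ?u + of_int (y + y') * ?v" unfolding z w by (simp add: algebra_simps)
    then show "z + w \<in> ideal_of k a b" unfolding ideal_of_def using lat_I by metis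
  }
  fix \<alpha> assume "\<alpha> \<in> OK"
  then obtain c d where \<alpha>: "\<alpha> = of_int c + of_int d * \<omega>" by (elim OK_E)
  have 1: "\<omega> * ?u = of_int a * ?v - of_int b * ?u" by (simp add: algebra_simps)
  have "\<omega> * ?v = of_int k * (of_int b * \<omega> + \<omega> * \<omega>)" by (simp add: algebra_simps)
  also have "\<dots> = of_int (b + s) * ?v - of_int k * of_int (f b)"
    unfolding \<omega>_squared f_def by (simp add: algebra_simps)
  finally have 2: "\<omega> * ?v = of_int (b + s) * ?v - of_int g * ?u" unfolding g by (simp add: algebra_simps)
  have "\<alpha> * z = of_int c * z + of_int d * (of_int x * (\<omega> * ?u) + of_int y * (\<omega> * ?v))"
    unfolding \<alpha> z by (simp add: algebra_simps)
  also have "\<dots> = of_int (c * x - d * x * b - d * y * g) * ?u + of_int (c * y + d * x * a + d * y * (b + s)) * ?v"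
    unfolding 1 2 z by (simp add: algebra_simps)
  finally show "\<alpha> * z \<in> ideal_of k a b" unfolding ideal_of_def using lat_I by metis
qed

lemma cnj_OK: "z \<in> OK \<Longrightarrow> cnj z \<in> OK"
proof (elim OK_E)
  fix x y assume "z = of_int x + of_int y * \<omega>"
  then have "cnj z = of_int (x + y * s) + of_int (- y) * \<omega>" by (simp add: cnj_\<omega> algebra_simps)
  then show "cnj z \<in> OK" using OK_I by metis
qed

lemma OK_norm:
  assumes "z \<in> OK" "z \<noteq> 0"
  obtains n where "0 < n" "cnj z * z = of_int n"
proof -
  obtain x y where z: "z = of_int x + of_int y * \<omega>" using assms(1) by (elim OK_E)
  define n where "n = x * x + s * x * y + c0 * y * y"
  have "cnj z * z = of_int x * of_int x + of_int x * of_int y * of_int s + of_int y * of_int y * (of_int s * \<omega> - \<omega> * \<omega>)"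
    unfolding z by (simp add: cnj_\<omega> algebra_simps)
  also have "\<dots> = of_int n" unfolding \<omega>_squared n_def by (simp add: algebra_simps)
  finally have e: "cnj z * z = of_int n" .
  have "(of_int n :: complex) = of_real ((cmod z)\<^sup>2)" unfolding e[symmetric] complex_norm_square by (simp add: mult.commute)
  then have "of_int n = (cmod z)\<^sup>2" by (metis of_real_eq_iff of_real_of_int_eq)
  then have "0 < n" using assms(2) by (metis of_int_0_less_iff zero_less_norm_iff zero_less_power)
  then show ?thesis using e that by blast
qed

text \<open>The generator k belongs to the group of all \<omega>-coordinates of elements of I, and c = k a generates the integers in I. Multiplication by \<omega> shows that k divides both c and the rational part e of an element e + k \<omega> of I; multiplication of that element by a conjugate shows that a divides f of the quotient.\<close>

lemma nz_ideal_ideal_of: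
  assumes "nz_ideal I"
  obtains k a b where "(k, a, b) \<in> triples" "I = ideal_of k a b"
proof -
  have I: "I \<subseteq> OK" "0 \<in> I" "\<And>x y. x \<in> I \<Longrightarrow> y \<in> I \<Longrightarrow> x + y \<in> I" "\<And>a x. a \<in> OK \<Longrightarrow> x \<in> I \<Longrightarrow> a * x \<in> I" "I \<noteq> {0}"
    using assms unfolding nz_ideal_def by blast+
  obtain z where z: "z \<in> I" "z \<noteq> 0" using I(2,5) by blast
  then obtain n where n: "0 < n" "cnj z * z = of_int n" using I(1) OK_norm[of z] by blast
  have "z \<in> OK" using z(1) I(1) by blast
  then have nI: "of_int n \<in> I" using I(4)[OF cnj_OK[OF \<open>z \<in> OK\<close>] z(1)] unfolding n(2) by blast
  define S where "S = {x. (of_int x :: complex) \<in> I}"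
  define Y where "Y = {y. \<exists>x. of_int x + of_int y * \<omega> \<in> I}"
  have Smult: "c * x \<in> S" if "x \<in> S" for c x using I(4)[OF OK_of_int[of c], of "of_int x"] that by (simp add: S_def)
  have Sadd: "x + y \<in> S" if "x \<in> S" "y \<in> S" for x y using I(3)[of "of_int x" "of_int y"] that by (simp add: S_def)
  have Ymult: "c * y \<in> Y" if "y \<in> Y" for c y
  proof -
    obtain x where x: "of_int x + of_int y * \<omega> \<in> I" using \<open>y \<in> Y\<close> unfolding Y_def by blast
    have "of_int c * (of_int x + of_int y * \<omega>) = of_int (c * x) + of_int (c * y) * \<omega>" by (simp add: algebra_simps)
    then have "of_int (c * x) + of_int (c * y) * \<omega> \<in> I" using I(4)[OF OK_of_int x, of c] by simp
    then show ?thesis unfolding Y_def by blast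
  qed
  have Yadd: "y + y' \<in> Y" if yy: "y \<in> Y" "y' \<in> Y" for y y'
  proof -
    obtain x x' where x: "of_int x + of_int y * \<omega> \<in> I" "of_int x' + of_int y' * \<omega> \<in> I" using yy unfolding Y_def by blast
    have e: "(of_int x + of_int y * \<omega>) + (of_int x' + of_int y' * \<omega>) = of_int (x + x') + of_int (y + y') * \<omega>" by (simp add: algebra_simps)
    have "of_int (x + x') + of_int (y + y') * \<omega> \<in> I" using I(3)[OF x] unfolding e .
    then show ?thesis unfolding Y_def by blast
  qed
  have "n \<in> S" "n \<noteq> 0" using nI n(1) by (simp_all add: S_def)
  then obtain c where c: "0 < c" "\<And>x. x \<in> S \<longleftrightarrow> c dvd x" using int_subgroup_generator[of S n, OF Smult Sadd] by metis
  have cI: "of_int c \<in> I" using c(2)[of c] by (simp add: S_def)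
  have "c \<in> Y"
  proof -
    have "of_int 0 + of_int c * \<omega> \<in> I" using I(4)[OF OK_\<omega> cI] by (simp add: mult.commute)
    then show ?thesis unfolding Y_def by blast
  qed
  then obtain k where k: "0 < k" "\<And>y. y \<in> Y \<longleftrightarrow> k dvd y" using int_subgroup_generator[of Y c, OF Ymult Yadd] c(1) by (metis less_irrefl)
  obtain e where e: "of_int e + of_int k * \<omega> \<in> I" using k(2)[of k] unfolding Y_def by auto
  have "k dvd c" using \<open>c \<in> Y\<close> k(2) by simp
  then obtain a where a: "c = k * a" by (elim dvdE)
  have "0 < a" using c(1) k(1) unfolding a by (simp add: zero_less_mult_iff)
  have "\<omega> * (of_int e + of_int k * \<omega>) = of_int e * \<omega> + of_int k * (\<omega> * \<omega>)" by (simp add: algebra_simps)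
  also have "\<dots> = of_int (- k * c0) + of_int (e + k * s) * \<omega>" unfolding \<omega>_squared by (simp add: algebra_simps)
  finally have "of_int (- k * c0) + of_int (e + k * s) * \<omega> \<in> I" using I(4)[OF OK_\<omega> e] by simp
  then have "e + k * s \<in> Y" unfolding Y_def by blast
  then have "k dvd e" unfolding k(2) by (simp add: dvd_add_left_iff)
  then obtain \<beta> where \<beta>: "e = k * \<beta>" by (elim dvdE)
  define v where "v = of_int k * (of_int \<beta> + \<omega>)"
  have vI: "v \<in> I" using e unfolding \<beta> v_def by (simp add: algebra_simps)
  have "of_int \<beta> + cnj \<omega> \<in> OK" using OK_add OK_of_int cnj_OK[OF OK_\<omega>] by blast
  then have "(of_int \<beta> + cnj \<omega>) * v \<in> I" using I(4) vI by blast
  moreover have "(of_int \<beta> + cnj \<omega>) * v = of_int (k * f \<beta>)"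
    using f_factor[of \<beta>] unfolding v_def by (simp add: mult_ac)
  ultimately have "k * f \<beta> \<in> S" by (simp add: S_def)
  then have "k * a dvd k * f \<beta>" unfolding c(2) a .
  then have af: "a dvd f \<beta>" using k(1) by simp
  have "I = ideal_of k a \<beta>"
  proof
    show "ideal_of k a \<beta> \<subseteq> I"
    proof
      fix w assume "w \<in> ideal_of k a \<beta>"
      then obtain x y where "w = of_int x * of_int c + of_int y * v" unfolding ideal_of_def v_def a by (elim lat_E)
      then show "w \<in> I" using I(3)[OF I(4)[OF OK_of_int cI] I(4)[OF OK_of_int vI]] by simp
    qed
    show "I \<subseteq> ideal_of k a \<beta>"
    proof
      fix w assume w: "w \<in> I"
      then obtain p q where pq: "w = of_int p + of_int q * \<omega>" using I(1) by (elim OK_E[OF subsetD])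
      then have "q \<in> Y" using w unfolding Y_def by blast
      then obtain y where y: "q = k * y" using k(2) by (auto elim: dvdE)
      have "w + of_int (- y) * v \<in> I" by (rule I(3)[OF w I(4)[OF OK_of_int vI]])
      moreover have "w + of_int (- y) * v = of_int (p - y * k * \<beta>)" unfolding pq y v_def by (simp add: algebra_simps)
      ultimately have "p - y * k * \<beta> \<in> S" by (simp add: S_def)
      then obtain x where "p - y * k * \<beta> = k * a * x" unfolding c(2) a by (elim dvdE)
      then have "p = k * (x * a + y * \<beta>)" by (simp add: algebra_simps)
      then show "w \<in> ideal_of k a \<beta>" unfolding pq ideal_of_mem using y by blast
    qed
  qed
  then have "I = ideal_of k a (\<beta> mod a)" unfolding ideal_of_mod .
  moreover have "a dvd f (\<beta> mod a)" using f_cong[of a \<beta> "- (\<beta> div a)"] af by (simp add: minus_mult_div_eq_mod)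
  ultimately show ?thesis using that[of k a "\<beta> mod a"] k(1) \<open>0 < a\<close> unfolding triples_def by simp
qed

lemma ideal_of_of_int_mem: "0 < k \<Longrightarrow> of_int p \<in> ideal_of k a b \<longleftrightarrow> k * a dvd p"
  using ideal_of_mem[of p 0 k a b] by (auto simp: dvd_def ac_simps)

lemma ideal_of_inj:
  assumes "(k, a, b) \<in> triples" "(k', a', b') \<in> triples" "ideal_of k a b = ideal_of k' a' b'"
  shows "k = k' \<and> a = a' \<and> b = b'"
proof -
  have t: "0 < k" "0 < a" "0 \<le> b" "b < a" "0 < k'" "0 < a'" "0 \<le> b'" "b' < a'" using assms unfolding triples_def by auto
  have v: "of_int (k * b) + of_int k * \<omega> \<in> ideal_of k a b" for k a b unfolding ideal_of_mem by (intro exI[of _ 0] exI[of _ 1]) simp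
  obtain x y where xy: "k * b = k' * (x * a' + y * b')" "k = k' * y" using v[of k b a] unfolding assms(3) ideal_of_mem by blast
  obtain x' y' where xy': "k' = k * y'" using v[of k' b' a'] unfolding assms(3)[symmetric] ideal_of_mem by blast
  have d1: "k' dvd k" unfolding xy(2) by (rule dvd_triv_left)
  have d2: "k dvd k'" unfolding xy' by (rule dvd_triv_left)
  have kk: "k = k'" by (rule zdvd_antisym_nonneg[OF less_imp_le[OF t(1)] less_imp_le[OF t(5)] d2 d1])
  have e: "k * a dvd p \<longleftrightarrow> k * a' dvd p" for p
    using ideal_of_of_int_mem[OF t(1), of p a b] ideal_of_of_int_mem[OF t(1), of p a' b'] assms(3) unfolding kk by blast
  have "k * a dvd k * a'" "k * a' dvd k * a" using e[of "k * a'"] e[of "k * a"] by (simp_all only: dvd_refl)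
  then have "a dvd a'" "a' dvd a" using t(1) by simp_all
  then have aa: "a = a'" by (rule zdvd_antisym_nonneg[OF less_imp_le[OF t(2)] less_imp_le[OF t(6)]])
  have "k' * y = k' * 1" using xy(2) unfolding kk by (simp only: mult_1_right)
  then have y1: "y = 1" using t(5) by simp
  have "k' * b = k' * (x * a + b')" using xy(1) unfolding kk aa y1 by simp
  then have "b = x * a + b'" using t(5) by simp
  then have "b mod a = b' mod a" by simp
  moreover have "b mod a = b" "b' mod a = b'" using t aa by simp_all
  ultimately have "b = b'" by simp
  then show ?thesis using kk aa by simp
qed

text \<open>The norm read off from the unique triple. By the next lemmas it is the covolume of the ideal divided by that of the ring of integers.\<close>

definition inorm :: "complex set \<Rightarrow> int" where
  "inorm I = (THE n. \<exists>k a b. (k, a, b) \<in> triples \<and> I = ideal_of k a b \<and> n = k * k * a)"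

lemma inorm_ideal_of: "(k, a, b) \<in> triples \<Longrightarrow> inorm (ideal_of k a b) = k * k * a"
  unfolding inorm_def by (rule the_equality) (use ideal_of_inj in blast)+

lemma triples_nz_ideal: "(k, a, b) \<in> triples \<Longrightarrow> nz_ideal (ideal_of k a b)"
  unfolding triples_def by (auto intro: ideal_of_nz_ideal)

lemma inorm_pos: "nz_ideal I \<Longrightarrow> 0 < inorm I"
  by (elim nz_ideal_ideal_of) (auto simp: inorm_ideal_of triples_def)

lemma ideal_of_triples: "bij_betw (\<lambda>(k, a, b). ideal_of k a b) triples {I. nz_ideal I}"
  unfolding bij_betw_def
proof
  show "inj_on (\<lambda>(k, a, b). ideal_of k a b) triples" using ideal_of_inj by (auto simp: inj_on_def)
  show "(\<lambda>(k, a, b). ideal_of k a b) ` triples = {I. nz_ideal I}" using triples_nz_ideal by (auto elim!: nz_ideal_ideal_of intro: rev_image_eqI)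
qed

lemma area_ideal_of: "area (of_int (k * a)) (of_int k * (of_int b + \<omega>)) = of_int (k * k * a) * Im \<omega>"
  unfolding area_def by (simp add: algebra_simps)

lemma inorm_scale:
  assumes "nz_ideal I" "nz_ideal ((\<lambda>x. \<alpha> * x) ` I)" "\<alpha> \<noteq> 0"
  shows "of_int (inorm ((\<lambda>x. \<alpha> * x) ` I)) = (cmod \<alpha>)\<^sup>2 * of_int (inorm I)"
proof -
  obtain k a b where I: "(k, a, b) \<in> triples" "I = ideal_of k a b" using assms(1) by (rule nz_ideal_ideal_of)
  obtain k' a' b' where I': "(k', a', b') \<in> triples" "(\<lambda>x. \<alpha> * x) ` I = ideal_of k' a' b'" using assms(2) by (rule nz_ideal_ideal_of)
  have pos: "0 < k * k * a" "0 < k' * k' * a'" using I I' unfolding triples_def by auto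
  let ?u = "of_int (k * a) :: complex" and ?v = "of_int k * (of_int b + \<omega>)"
  have "lat (\<alpha> * ?u) (\<alpha> * ?v) = lat (of_int (k' * a')) (of_int k' * (of_int b' + \<omega>))"
    using I'(2) unfolding I(2) ideal_of_def lat_scale .
  moreover have A: "area (\<alpha> * ?u) (\<alpha> * ?v) = (cmod \<alpha>)\<^sup>2 * of_int (k * k * a) * Im \<omega>"
    unfolding area_scale area_ideal_of by simp
  moreover have A': "area (of_int (k' * a')) (of_int k' * (of_int b' + \<omega>)) = of_int (k' * k' * a') * Im \<omega>" by (rule area_ideal_of)
  ultimately have "\<bar>(cmod \<alpha>)\<^sup>2 * of_int (k * k * a) * Im \<omega>\<bar> = \<bar>of_int (k' * k' * a') * Im \<omega>\<bar>"
    using area_unique[of "\<alpha> * ?u" "\<alpha> * ?v"] pos Im_\<omega>_pos assms(3)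
    by (metis mult_eq_0_iff norm_eq_zero of_int_eq_0_iff order_less_irrefl power_eq_0_iff)
  moreover have "0 \<le> real_of_int (k * k * a)" "0 \<le> real_of_int (k' * k' * a')"
    using pos by (simp_all only: of_int_0_le_iff less_imp_le)
  then have "0 \<le> (cmod \<alpha>)\<^sup>2 * of_int (k * k * a) * Im \<omega>" "0 \<le> of_int (k' * k' * a') * Im \<omega>"
    using Im_\<omega>_pos by (simp_all only: mult_nonneg_nonneg less_imp_le zero_le_power2)
  ultimately have "(cmod \<alpha>)\<^sup>2 * of_int (k * k * a) * Im \<omega> = of_int (k' * k' * a') * Im \<omega>" by linarith
  then show ?thesis using Im_\<omega>_pos unfolding I'(2) unfolding I(2) inorm_ideal_of[OF I(1)] inorm_ideal_of[OF I'(1)] by simp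
qed

section \<open>Finiteness of the class number\<close>

lemma ideal_of_unscale: "(\<lambda>x. inverse (of_int k) * x) ` ideal_of k a b = ideal_of 1 a b" if "k \<noteq> 0"
proof -
  have h1: "inverse (of_int k) * of_int (k * a) = (of_int (1 * a) :: complex)" using that by (simp add: field_simps)
  have h2: "inverse (of_int k) * (of_int k * (of_int b + \<omega>)) = of_int 1 * (of_int b + \<omega>)" using that by (simp add: field_simps)
  show ?thesis unfolding ideal_of_def lat_scale h1 h2 ..
qed

text \<open>This is the reduction step: multiplication by the conjugate of b + \<omega>, divided by a, turns an ideal of norm a into one of norm a' = f b / a.\<close>

lemma ideal_of_conjugate:
  assumes "0 < a" "f b = a * a'"
  shows "(\<lambda>x. ((of_int b + cnj \<omega>) / of_int a) * x) ` ideal_of 1 a b = ideal_of 1 a' (- b - s)"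
proof -
  let ?c = "(of_int b + cnj \<omega>) / of_int a"
  have 1: "?c * of_int (1 * a) = - (of_int (- b - s) + \<omega>)" using assms(1) by (simp add: cnj_\<omega>)
  have 2: "?c * (of_int 1 * (of_int b + \<omega>)) = of_int a'"
    using f_factor[of b] assms by (simp add: field_simps)
  have swap: "lat (- v) u = lat u v" for u v
  proof -
    have "of_int x * (- v) + of_int y * u = of_int y * u + of_int (- x) * v" for x y by simp
    moreover have "of_int x * u + of_int y * v = of_int (- y) * (- v) + of_int x * u" for x y by simp
    ultimately show ?thesis unfolding lat_def by blast
  qed
  show ?thesis unfolding ideal_of_def lat_scale 1 2 swap by simp
qed

lemma balanced_residue:
  fixes a :: int
  assumes "0 < a"
  obtains b' t where "b' = b + a * t" "\<bar>2 * b' + s\<bar> \<le> a"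
proof -
  define c where "c = 2 * b + s + a"
  define q where "q = c div (2 * a)"
  have "c = 2 * a * q + c mod (2 * a)" unfolding q_def by simp
  moreover have "0 \<le> c mod (2 * a)" "c mod (2 * a) < 2 * a" using assms by simp_all
  ultimately have "\<bar>2 * (b + a * (- q)) + s\<bar> \<le> a" unfolding c_def by (simp add: algebra_simps)
  then show ?thesis using that by blast
qed

lemma of_int_KK: "of_int k \<in> KK" using OK_subset_KK OK_of_int by simp

text \<open>Take an ideal of least norm in its class. Then k = 1, and with b chosen in the middle residue system modulo a, minimality against the conjugate step gives a \<le> f b / a. Hence 4 a^2 \<le> 4 f b = (2 b + s)^2 + N \<le> a^2 + N.\<close>

lemma classes_reduced:
  assumes "c \<in> ideal_classes"
  shows "\<exists>a b. 0 < a \<and> a \<le> N \<and> 0 \<le> b \<and> b < a \<and> a dvd f b \<and> c = scaling_class (ideal_of 1 a b)"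
proof -
  define P where "P = (\<lambda>n. \<exists>I. nz_ideal I \<and> c = scaling_class I \<and> n = nat (inorm I))"
  obtain I0 where "nz_ideal I0" "c = scaling_class I0" using assms unfolding ideal_classes_def by blast
  then have "P (nat (inorm I0))" unfolding P_def by blast
  then have "P (LEAST n. P n)" by (rule LeastI)
  then obtain I where I: "nz_ideal I" "c = scaling_class I" "(LEAST n. P n) = nat (inorm I)" unfolding P_def by blast
  have min: "inorm I \<le> inorm J" if "nz_ideal J" "c = scaling_class J" for J
  proof -
    have "nat (inorm I) \<le> nat (inorm J)" unfolding I(3)[symmetric] by (rule Least_le) (use that P_def in blast)
    then show ?thesis using inorm_pos[OF that(1)] by linarith
  qed
  obtain k a b where kab: "(k, a, b) \<in> triples" "I = ideal_of k a b" using I(1) by (rule nz_ideal_ideal_of)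
  have t: "0 < k" "0 < a" "0 \<le> b" "b < a" "a dvd f b" using kab unfolding triples_def by auto
  have t1: "(1, a, b) \<in> triples" using t unfolding triples_def by simp
  have c1: "c = scaling_class (ideal_of 1 a b)"
  proof -
    have "scaling_class (ideal_of 1 a b) = scaling_class I"
      unfolding ideal_of_unscale[of k a b, symmetric, OF less_imp_neq[OF t(1), symmetric]] kab(2)
      by (rule scaling_class_scale) (use t(1) KK_inverse of_int_KK in auto)
    then show ?thesis using I(2) by simp
  qed
  have le_all: "a \<le> inorm J" if "nz_ideal J" "c = scaling_class J" for J
  proof -
    have "k * k * a \<le> inorm J" using min[OF that] unfolding kab(2) inorm_ideal_of[OF kab(1)] .
    moreover have "1 * a \<le> (k * k) * a" using t by (intro mult_right_mono) (simp_all add: zero_less_mult_iff int_one_le_iff_zero_less)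
    ultimately show ?thesis by linarith
  qed
  obtain b' t where b': "b' = b + a * t" "\<bar>2 * b' + s\<bar> \<le> a" using balanced_residue[OF t(2)] by blast
  have "a dvd f b'" unfolding b'(1) f_cong by (rule t(5))
  then obtain a' where a': "f b' = a * a'" by (elim dvdE)
  have "0 < a'" using f_pos[of b'] t(2) unfolding a' by (simp add: zero_less_mult_iff)
  have J: "(\<lambda>x. ((of_int b' + cnj \<omega>) / of_int a) * x) ` ideal_of 1 a b = ideal_of 1 a' (- b' - s)"
    using ideal_of_conjugate[OF t(2) a'] unfolding b'(1) ideal_of_shift by simp
  have ne: "(of_int b' + cnj \<omega>) / of_int a \<noteq> 0"
    using Im_\<omega>_pos t(2) by (auto simp: complex_eq_iff)
  have inK: "(of_int b' + cnj \<omega>) / of_int a \<in> KK"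
    using KK_divide OK_subset_KK OK_add OK_of_int cnj_OK[OF OK_\<omega>] by metis
  have "c = scaling_class (ideal_of 1 a' (- b' - s))" unfolding J[symmetric] using scaling_class_scale[OF inK ne] c1 by simp
  moreover have "a' dvd f (- b' - s)" unfolding f_reflect a' by simp
  then have "nz_ideal (ideal_of 1 a' (- b' - s))" using \<open>0 < a'\<close> by (intro ideal_of_nz_ideal) simp_all
  moreover have "inorm (ideal_of 1 a' (- b' - s)) = a'"
  proof -
    have "(- b' - s) mod a' = (- b' - s) + a' * (- ((- b' - s) div a'))" by (simp add: minus_mult_div_eq_mod)
    then have "a' dvd f ((- b' - s) mod a')" using f_cong[of a' "- b' - s"] \<open>a' dvd f (- b' - s)\<close> by metis
    then have "(1, a', (- b' - s) mod a') \<in> triples" using \<open>0 < a'\<close> unfolding triples_def by simp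
    from inorm_ideal_of[OF this] show ?thesis unfolding ideal_of_mod by simp
  qed
  ultimately have "a \<le> a'" using le_all by metis
  then have "4 * (a * a) \<le> 4 * (a * a')" using t(2) by simp
  also have "\<dots> = (2 * b' + s)\<^sup>2 + N" using four_f[of b'] a' by simp
  also have "(2 * b' + s)\<^sup>2 \<le> a\<^sup>2" using b'(2) t(2) by (metis abs_le_square_iff abs_of_pos)
  finally have "3 * (a * a) \<le> N" by (simp add: power2_eq_square)
  moreover have "a * 1 \<le> a * a" using t(2) by (intro mult_left_mono) simp_all
  ultimately have "a \<le> N" using t(2) by linarith
  then show ?thesis using t c1 by blast
qed

lemma finite_ideal_classes: "finite ideal_classes"
proof (rule finite_subset)
  show "ideal_classes \<subseteq> (\<lambda>(a, b). scaling_class (ideal_of 1 a b)) ` ({0..N} \<times> {0..N})"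
  proof
    fix c assume "c \<in> ideal_classes"
    then obtain a b where "0 < a \<and> a \<le> N \<and> 0 \<le> b \<and> b < a \<and> a dvd f b \<and> c = scaling_class (ideal_of 1 a b)" using classes_reduced by blast
    then show "c \<in> (\<lambda>(a, b). scaling_class (ideal_of 1 a b)) ` ({0..N} \<times> {0..N})" by (intro image_eqI[of _ _ "(a, b)"]) auto
  qed
qed simp

end

section \<open>Counting ideals by norm\<close>

definition multiplicative :: "(nat \<Rightarrow> int) \<Rightarrow> bool" where
  "multiplicative g \<longleftrightarrow> (\<forall>a b. 0 < a \<longrightarrow> 0 < b \<longrightarrow> coprime a b \<longrightarrow> g (a * b) = g a * g b)"

definition dconv :: "(nat \<Rightarrow> int) \<Rightarrow> (nat \<Rightarrow> int) \<Rightarrow> nat \<Rightarrow> int" where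
  "dconv g h n = (\<Sum>d | d dvd n. g d * h (n div d))"

text \<open>A divisor of a product of coprime numbers splits uniquely, which makes Dirichlet convolution preserve multiplicativity.\<close>

lemma bij_divisors_coprime:
  fixes a b :: nat
  assumes "coprime a b" "0 < a" "0 < b"
  shows "bij_betw (\<lambda>(x, y). x * y) ({x. x dvd a} \<times> {y. y dvd b}) {d. d dvd a * b}"
  unfolding bij_betw_def
proof
  show "inj_on (\<lambda>(x, y). x * y) ({x. x dvd a} \<times> {y. y dvd b})"
  proof (rule inj_onI, clarify)
    fix x y x' y' assume d: "x dvd a" "y dvd b" "x' dvd a" "y' dvd b" and e: "x * y = x' * y'"
    have c: "coprime x y'" "coprime x' y" using assms(1) d by (meson coprime_divisors)+
    have "x dvd x' * y'" "x' dvd x * y" using e by (metis dvd_triv_left)+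
    then have "x dvd x'" "x' dvd x" using c by (simp_all add: coprime_dvd_mult_left_iff)
    then have "x = x'" by (rule dvd_antisym)
    moreover have "x \<noteq> 0" using d(1) assms(2) by (metis dvd_0_left less_irrefl)
    ultimately show "x = x' \<and> y = y'" using e by simp
  qed
  show "(\<lambda>(x, y). x * y) ` ({x. x dvd a} \<times> {y. y dvd b}) = {d. d dvd a * b}"
  proof
    show "(\<lambda>(x, y). x * y) ` ({x. x dvd a} \<times> {y. y dvd b}) \<subseteq> {d. d dvd a * b}" by (auto intro: mult_dvd_mono)
    show "{d. d dvd a * b} \<subseteq> (\<lambda>(x, y). x * y) ` ({x. x dvd a} \<times> {y. y dvd b})"
    proof
      fix d assume "d \<in> {d. d dvd a * b}"
      then obtain x y where "d = x * y" "x dvd a" "y dvd b" using division_decomp[of d a b] by blast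
      then show "d \<in> (\<lambda>(x, y). x * y) ` ({x. x dvd a} \<times> {y. y dvd b})" by (intro image_eqI[of _ _ "(x, y)"]) auto
    qed
  qed
qed

lemma dconv_mult:
  assumes g: "multiplicative g" and h: "multiplicative h"
  shows "multiplicative (dconv g h)"
  unfolding multiplicative_def
proof (intro allI impI)
  fix a b :: nat assume ab: "0 < a" "0 < b" "coprime a b"
  have "dconv g h (a * b) = (\<Sum>z\<in>{x. x dvd a} \<times> {y. y dvd b}. g (case z of (x, y) \<Rightarrow> x * y) * h (a * b div (case z of (x, y) \<Rightarrow> x * y)))"
    unfolding dconv_def by (rule sum.reindex_bij_betw[OF bij_divisors_coprime[OF ab(3,1,2)], symmetric])
  also have "\<dots> = (\<Sum>(x, y)\<in>{x. x dvd a} \<times> {y. y dvd b}. (g x * h (a div x)) * (g y * h (b div y)))"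
  proof (intro sum.cong refl, clarify)
    fix x y assume d: "x dvd a" "y dvd b"
    then obtain x' y' where e: "a = x * x'" "b = y * y'" by (auto elim!: dvdE)
    have pos: "0 < x" "0 < y" "0 < x'" "0 < y'" using ab unfolding e by simp_all
    have c: "coprime x y" "coprime x' y'" using ab(3) unfolding e by simp_all
    have "g (x * y) = g x * g y" using g pos c unfolding multiplicative_def by blast
    moreover have "h (x' * y') = h x' * h y'" using h pos c unfolding multiplicative_def by blast
    moreover have "a * b div (x * y) = x' * y'" "a div x = x'" "b div y = y'"
      using pos by (simp_all add: e mult_ac)
    ultimately show "g (x * y) * h (a * b div (x * y)) = (g x * h (a div x)) * (g y * h (b div y))" by simp
  qed
  also have "\<dots> = dconv g h a * dconv g h b"
    unfolding dconv_def sum_product sum.cartesian_product ..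
  finally show "dconv g h (a * b) = dconv g h a * dconv g h b" .
qed

lemma multiplicative_eqI:
  assumes g: "multiplicative g" and h: "multiplicative h"
    and pp: "\<And>p e. prime p \<Longrightarrow> g (p ^ e) = h (p ^ e)"
    and n: "0 < n"
  shows "g n = h n"
  using n
proof (induction n rule: less_induct)
  case (less n)
  show ?case
  proof (cases "n = 1")
    case True
    then show ?thesis using pp[of 2 0] by simp
  next
    case False
    then obtain p where p: "prime p" "p dvd n" using prime_factor_nat by blast
    obtain k where k: "n = p ^ multiplicity p n * k" "\<not> p dvd k"
      using multiplicity_decompose'[of n p] less.prems p(1) not_prime_unit by (metis less_irrefl)
    let ?e = "multiplicity p n"
    have e: "0 < ?e" using p less.prems by (simp add: prime_multiplicity_gt_zero_iff prime_imp_prime_elem)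
    have "0 < k" using k(1) less.prems by (cases k) auto
    moreover have "1 < p ^ ?e" by (rule one_less_power[OF prime_gt_1_nat[OF p(1)] e])
    ultimately have "1 * k < p ^ ?e * k" by (intro mult_strict_right_mono)
    then have "k < n" using k(1) by simp
    have c: "coprime (p ^ ?e) k" using k(2) p(1) by (simp add: prime_imp_coprime)
    have "g n = g (p ^ ?e) * g k" "h n = h (p ^ ?e) * h k"
      using g h c \<open>0 < k\<close> \<open>1 < p ^ ?e\<close> k(1) unfolding multiplicative_def by (metis less_trans zero_less_one)+
    then show ?thesis using pp[OF p(1)] less.IH[OF \<open>k < n\<close> \<open>0 < k\<close>] by simp
  qed
qed

lemma divisors_prime_power:
  fixes p :: nat
  assumes "prime p"
  shows "dconv g h (p ^ e) = (\<Sum>i\<le>e. g (p ^ i) * h (p ^ (e - i)))"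
proof -
  have p: "1 < p" using assms prime_gt_1_nat by blast
  have "{d. d dvd p ^ e} = (\<lambda>i. p ^ i) ` {..e}" using divides_primepow_nat[OF assms] by auto
  moreover have "inj_on (\<lambda>i. p ^ i) {..e}" using p by (auto simp: inj_on_def power_inject_exp)
  ultimately have "dconv g h (p ^ e) = (\<Sum>i\<le>e. g (p ^ i) * h (p ^ e div p ^ i))"
    unfolding dconv_def by (simp add: sum.reindex)
  also have "\<dots> = (\<Sum>i\<le>e. g (p ^ i) * h (p ^ (e - i)))"
    using p by (intro sum.cong refl) (simp add: power_diff)
  finally show ?thesis .
qed

text \<open>In an ideal given by (k, a, b) the factor k contributes k^2 to the norm. So ideals are counted by the convolution of the indicator of squares with the number of roots of f.\<close>

definition square_ind :: "nat \<Rightarrow> int" where "square_ind d = (if is_nth_power 2 d then 1 else 0)"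

lemma square_ind_mult: "multiplicative square_ind"
  unfolding multiplicative_def square_ind_def using is_nth_power_mult_coprime_nat_iff[of _ _ 2] by simp

lemma square_ind_prime_power:
  fixes p :: nat
  assumes "prime p"
  shows "square_ind (p ^ i) = (if even i then 1 else 0)"
  unfolding square_ind_def by (simp add: is_nth_power_prime_power_nat_iff[OF assms])

text \<open>The local factors at one prime: R i is the number of roots of f modulo the i-th power of the prime, and \<epsilon> is the value of the character there. Passing from e to e + 2 adds the same amount on both sides.\<close>

lemma prime_power_identity:
  fixes R :: "nat \<Rightarrow> int" and \<epsilon> :: int
  assumes R0: "R 0 = 1" and R1: "R 1 = 1 + \<epsilon>" and R2: "\<And>e. R (e + 2) = \<epsilon> ^ (e + 1) + \<epsilon> ^ (e + 2)"
  shows "(\<Sum>i\<le>e. (if even i then 1 else 0) * R (e - i)) = (\<Sum>i\<le>e. \<epsilon> ^ i)"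
proof (induction e rule: induct_nat_012)
  case 0
  then show ?case using R0 by simp
next
  case 1
  then show ?case using R1 by simp
next
  case (ge2 n)
  have "(\<Sum>i\<le>Suc (Suc n). (if even i then 1 else 0) * R (Suc (Suc n) - i)) = R (n + 2) + (\<Sum>i\<le>n. (if even i then 1 else 0) * R (n - i))"
    by (simp add: sum.atMost_Suc_shift del: sum.atMost_Suc)
  also have "\<dots> = (\<Sum>i\<le>n. \<epsilon> ^ i) + \<epsilon> ^ (n + 1) + \<epsilon> ^ (n + 2)" unfolding ge2(1) R2 by simp
  finally show ?case by simp
qed

lemma odd_prime_int: "prime p \<Longrightarrow> p \<noteq> 2 \<Longrightarrow> odd p" for p :: int
  using prime_odd_int[of p] prime_ge_2_int[of p] by simp

context imaginary_quadratic
begin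

definition roots :: "int \<Rightarrow> int set" where "roots q = {b. 0 \<le> b \<and> b < q \<and> q dvd f b}"
definition root_count :: "nat \<Rightarrow> int" where "root_count n = int (card (roots (int n)))"

lemma finite_roots [simp]: "finite (roots q)"
  unfolding roots_def by (rule finite_subset[of _ "{0..<q}"]) auto

lemma f_mod: "q dvd f (b mod q) \<longleftrightarrow> q dvd f b"
  using f_cong[of q b "- (b div q)"] by (simp add: minus_mult_div_eq_mod)

lemma root_count_mult: "multiplicative root_count"
  unfolding multiplicative_def
proof (intro allI impI)
  fix k n :: nat assume mn: "0 < k" "0 < n" "coprime k n"
  define a b where "a = int k" and "b = int n"
  have ab: "0 < a" "0 < b" "coprime a b" using mn by (simp_all add: a_def b_def)
  have "bij_betw (\<lambda>x. (x mod a, x mod b)) (roots (a * b)) (roots a \<times> roots b)"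
    unfolding bij_betw_def
  proof
    show "inj_on (\<lambda>x. (x mod a, x mod b)) (roots (a * b))"
    proof (rule inj_onI)
      fix x y assume xy: "x \<in> roots (a * b)" "y \<in> roots (a * b)" "(x mod a, x mod b) = (y mod a, y mod b)"
      then have "[x = y] (mod a)" "[x = y] (mod b)" by (simp_all add: Cong.cong_def)
      then have "[x = y] (mod a * b)" using ab(3) coprime_cong_mult by blast
      then show "x = y" using xy(1,2) unfolding roots_def by (simp add: Cong.cong_def)
    qed
    show "(\<lambda>x. (x mod a, x mod b)) ` roots (a * b) = roots a \<times> roots b"
    proof
      show "(\<lambda>x. (x mod a, x mod b)) ` roots (a * b) \<subseteq> roots a \<times> roots b"
      proof
        fix z assume "z \<in> (\<lambda>x. (x mod a, x mod b)) ` roots (a * b)"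
        then obtain x where x: "x \<in> roots (a * b)" "z = (x mod a, x mod b)" by blast
        have "a dvd f x" "b dvd f x" using x(1) unfolding roots_def by (auto intro: dvd_mult_left dvd_mult_right)
        then show "z \<in> roots a \<times> roots b" unfolding x(2) roots_def using ab by (simp add: f_mod)
      qed
      show "roots a \<times> roots b \<subseteq> (\<lambda>x. (x mod a, x mod b)) ` roots (a * b)"
      proof
        fix z assume "z \<in> roots a \<times> roots b"
        then obtain u v where z: "z = (u, v)" "u \<in> roots a" "v \<in> roots b" by blast
        obtain x where x: "[x = u] (mod a)" "[x = v] (mod b)" using binary_chinese_remainder_int[OF ab(3)] by blast
        let ?y = "x mod (a * b)"
        have y: "?y mod a = u" "?y mod b = v"
          using x z(2,3) unfolding roots_def Cong.cong_def by (simp_all add: mod_mod_cancel)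
        have "a dvd f ?y" using f_mod[of a ?y] z(2) unfolding y roots_def by simp
        moreover have "b dvd f ?y" using f_mod[of b ?y] z(3) unfolding y roots_def by simp
        ultimately have "a * b dvd f ?y" using ab(3) by (simp add: divides_mult)
        then have "?y \<in> roots (a * b)" using ab unfolding roots_def by simp
        then show "z \<in> (\<lambda>x. (x mod a, x mod b)) ` roots (a * b)" unfolding z(1) using y by (intro image_eqI[of _ _ ?y]) simp_all
      qed
    qed
  qed
  from bij_betw_same_card[OF this] show "root_count (k * n) = root_count k * root_count n"
    unfolding root_count_def by (simp add: card_cartesian_product a_def b_def)
qed

lemma root_count_1: "root_count 1 = 1"
proof -
  have "roots 1 = {0}" unfolding roots_def by auto
  then show ?thesis by (simp add: root_count_def)
qed

lemma discriminant_f: "(2 * b + s)\<^sup>2 = 4 * f b + D"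
  using four_f[of b] N_eq by simp

lemma f_diff: "f x - f y = (x - y) * (x + y + s)" by (simp add: f_def algebra_simps)

text \<open>Hensel lifting. The identity f'(b)^2 = 4 f(b) + D shows that at a root modulo p the derivative 2 b + s is invertible modulo p, also for p = 2.\<close>

lemma roots_lift:
  fixes p :: int
  assumes p: "prime p" "\<not> p dvd D"
  shows "card (roots (p ^ (e + 2))) = card (roots (p ^ (e + 1)))"
proof -
  define q where "q = p ^ (e + 1)"
  have p1: "1 < p" using p(1) prime_gt_1_int by blast
  have q: "0 < q" "p dvd q" using p1 by (simp_all add: q_def)
  have pq: "p ^ (e + 2) = q * p" unfolding q_def by simp
  have unit: "\<not> p dvd 2 * b + s" if "p dvd f b" for b
  proof
    assume "p dvd 2 * b + s"
    then have "p dvd (2 * b + s)\<^sup>2" by (simp add: power2_eq_square)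
    then have "p dvd 4 * f b + D" unfolding discriminant_f .
    then show False using p(2) that by (metis dvd_add_right_iff dvd_mult)
  qed
  have exp: "f (b + t * q) = f b + q * (t * (2 * b + s) + t * t * q)" for b t
    by (simp add: f_def algebra_simps)
  have "bij_betw (\<lambda>b. b mod q) (roots (q * p)) (roots q)"
    unfolding bij_betw_def
  proof
    show "inj_on (\<lambda>b. b mod q) (roots (q * p))"
    proof (rule inj_onI)
      fix x y assume xy: "x \<in> roots (q * p)" "y \<in> roots (q * p)" "x mod q = y mod q"
      from xy(3)[symmetric] have "q dvd y - x" by (simp only: mod_eq_dvd_iff)
      then obtain t where t: "y - x = q * t" by (elim dvdE)
      then have y: "y = x + t * q" by (simp add: algebra_simps)
      have fx: "q * p dvd f x" "q * p dvd f y" using xy unfolding roots_def by simp_all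
      then have "q * p dvd q * (t * (2 * x + s) + t * t * q)" unfolding y exp using dvd_add_right_iff by blast
      then have "p dvd t * (2 * x + s) + t * t * q" using q by simp
      then have "p dvd t * (2 * x + s)" using dvd_add_left_iff[of p "t * t * q" "t * (2 * x + s)"] q(2) by simp
      moreover have "p dvd f x" using fx(1) by (rule dvd_mult_right)
      ultimately have "p dvd t" using unit p(1) by (simp add: prime_dvd_mult_iff)
      then have "q * p dvd y - x" unfolding t by simp
      then have "x mod (q * p) = y mod (q * p)" by (metis mod_eq_dvd_iff)
      then show "x = y" using xy unfolding roots_def by simp
    qed
    show "(\<lambda>b. b mod q) ` roots (q * p) = roots q"
    proof
      show "(\<lambda>b. b mod q) ` roots (q * p) \<subseteq> roots q"
      proof
        fix z assume "z \<in> (\<lambda>b. b mod q) ` roots (q * p)"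
        then obtain x where x: "q * p dvd f x" "z = x mod q" unfolding roots_def by blast
        have "q dvd f x" using x(1) by (rule dvd_mult_left)
        then show "z \<in> roots q" unfolding x(2) roots_def using q(1) by (simp add: f_mod)
      qed
      show "roots q \<subseteq> (\<lambda>b. b mod q) ` roots (q * p)"
      proof
        fix b assume b: "b \<in> roots q"
        then obtain g where g: "f b = q * g" unfolding roots_def by (auto elim: dvdE)
        have "p dvd f b" unfolding g using q(2) by simp
        then have "coprime (2 * b + s) p" using unit p(1) by (metis coprime_commute prime_imp_coprime)
        then obtain u where "[(2 * b + s) * u = 1] (mod p)" using cong_solve_coprime_int by blast
        then obtain v where v: "(2 * b + s) * u - 1 = p * v" by (metis cong_iff_dvd_diff dvdE)
        have "t * (2 * b + s) + g = p * (- g * v)" if "t = - g * u" for t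
        proof -
          have "t * (2 * b + s) + g = - g * ((2 * b + s) * u - 1)" unfolding that by (simp add: algebra_simps)
          then show ?thesis unfolding v by simp
        qed
        then obtain t where t: "p dvd t * (2 * b + s) + g" by (metis dvd_triv_left)
        have "f (b + t * q) = q * ((t * (2 * b + s) + g) + t * t * q)" unfolding exp g by (simp add: algebra_simps)
        moreover have "p dvd (t * (2 * b + s) + g) + t * t * q" using t q(2) by simp
        ultimately have r: "q * p dvd f (b + t * q)" by simp
        let ?y = "(b + t * q) mod (q * p)"
        have "?y \<in> roots (q * p)" unfolding roots_def using q p1 r by (simp add: f_mod)
        moreover have "?y mod q = b" using b unfolding roots_def by (simp add: mod_mod_cancel)
        ultimately show "b \<in> (\<lambda>b. b mod q) ` roots (q * p)" by (intro image_eqI[of _ _ ?y]) simp_all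
      qed
    qed
  qed
  from bij_betw_same_card[OF this] show ?thesis unfolding pq q_def .
qed

text \<open>If b is a root then so is - b - s, and f x - f b = (x - b) (x + b + s) leaves room for no other root; the two are distinct since p does not divide D.\<close>

lemma card_roots_prime:
  fixes p :: int
  assumes p: "prime p" "\<not> p dvd D"
  shows "card (roots p) = (if \<exists>b. p dvd f b then 2 else 0)"
proof (cases "\<exists>b. p dvd f b")
  case True
  then obtain b where b: "p dvd f b" by blast
  have p1: "1 < p" using p(1) prime_gt_1_int by blast
  define x y where "x = b mod p" and "y = (- b - s) mod p"
  have ne: "x \<noteq> y"
  proof
    assume "x = y"
    then have "p dvd b - (- b - s)" unfolding x_def y_def by (simp add: mod_eq_dvd_iff)
    moreover have "b - (- b - s) = 2 * b + s" by simp
    ultimately have "p dvd 2 * b + s" by metis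
    then have "p dvd (2 * b + s)\<^sup>2" unfolding power2_eq_square by (rule dvd_mult)
    then have "p dvd 4 * f b + D" unfolding discriminant_f .
    then show False using p(2) b by (metis dvd_add_right_iff dvd_mult)
  qed
  have "roots p = {x, y}"
  proof
    show "{x, y} \<subseteq> roots p" unfolding roots_def x_def y_def using p1 b by (simp add: f_mod f_reflect)
    show "roots p \<subseteq> {x, y}"
    proof
      fix z assume z: "z \<in> roots p"
      then have "p dvd f z - f b" using b unfolding roots_def by simp
      then have "p dvd z - b \<or> p dvd z + b + s" unfolding f_diff using p(1) by (simp add: prime_dvd_mult_iff)
      then have "z mod p = x \<or> z mod p = y" unfolding x_def y_def by (auto simp: mod_eq_dvd_iff algebra_simps)
      moreover have "z mod p = z" using z unfolding roots_def by simp
      ultimately show "z \<in> {x, y}" by auto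
    qed
  qed
  then show ?thesis using True ne by simp
next
  case False
  then have "roots p = {}" unfolding roots_def by auto
  then show ?thesis using False by simp
qed

text \<open>For odd p, completing the square turns a root of f into a square root of D modulo p, and D differs from m at most by the square 4. For p = 2, a root exists if and only if the constant coefficient is even.\<close>

lemma root_exists_iff:
  fixes p :: int
  assumes p: "prime p" "\<not> p dvd D"
  shows "(\<exists>b. p dvd f b) \<longleftrightarrow> chi p = 1"
proof (cases "p = 2")
  case True
  have oD: "odd D" using p(2) True by simp
  then have "s = 1" unfolding s_def by (simp add: odd_iff_mod_2_eq_one)
  have ev: "even (f b) \<longleftrightarrow> even c0" for b unfolding f_def \<open>s = 1\<close> by simp
  have "4 * c0 = 1 - D" using c0 \<open>s = 1\<close> by simp
  then have "even c0 \<longleftrightarrow> D mod 8 = 1" by presburger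
  then show ?thesis unfolding True ev chi_2[OF oD] by simp
next
  case False
  have o: "odd p" by (rule odd_prime_int[OF p(1) False])
  have pN: "\<not> p dvd N" using p(2) N_eq by simp
  have chi: "chi p = Legendre m p" by (rule chi_odd_prime[OF p(1) o pN])
  have qD: "QuadRes p D \<longleftrightarrow> QuadRes p m"
  proof (cases "s = 1")
    case True
    then show ?thesis using D_cases by auto
  next
    case False
    then have D: "D = 4 * m" using D_cases by auto
    obtain h where h: "p = 2 * h + 1" using o by (elim oddE)
    show ?thesis
    proof
      assume "QuadRes p m"
      then obtain y where "[y\<^sup>2 = m] (mod p)" unfolding QuadRes_def by blast
      then have "[4 * y\<^sup>2 = 4 * m] (mod p)" by (rule cong_scalar_left)
      then have "[(2 * y)\<^sup>2 = D] (mod p)" unfolding D by (simp add: power2_eq_square)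
      then show "QuadRes p D" unfolding QuadRes_def by blast
    next
      assume "QuadRes p D"
      then obtain y where y: "[y\<^sup>2 = 4 * m] (mod p)" unfolding QuadRes_def D by blast
      have c4: "coprime 4 p" using o by (metis coprime_power_left_iff coprime_left_2_iff_odd mult_2_right numeral_Bit0 power2_eq_square pos2)
      have "[4 * ((h + 1) * y)\<^sup>2 = (p * (p + 2) + 1) * y\<^sup>2] (mod p)" unfolding h by (simp add: power2_eq_square algebra_simps)
      moreover have "[(p * (p + 2) + 1) * y\<^sup>2 = y\<^sup>2] (mod p)" by (simp add: Cong.cong_iff_dvd_diff algebra_simps)
      ultimately have "[4 * ((h + 1) * y)\<^sup>2 = 4 * m] (mod p)" using y by (meson cong_trans)
      then have "[((h + 1) * y)\<^sup>2 = m] (mod p)" using c4 by (simp add: cong_mult_lcancel)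
      then show "QuadRes p m" unfolding QuadRes_def by blast
    qed
  qed
  have pm: "\<not> p dvd m" using p(2) D_cases by auto
  have "(\<exists>b. p dvd f b) \<longleftrightarrow> QuadRes p D"
  proof
    assume "\<exists>b. p dvd f b"
    then obtain b where "p dvd f b" by blast
    then have "[(2 * b + s)\<^sup>2 = D] (mod p)" unfolding discriminant_f by (simp add: cong_iff_dvd_diff)
    then show "QuadRes p D" unfolding QuadRes_def by blast
  next
    assume "QuadRes p D"
    then obtain y where y: "[y\<^sup>2 = D] (mod p)" unfolding QuadRes_def by blast
    obtain h where h: "p = 2 * h + 1" using o by (elim oddE)
    define b where "b = (y - s) * (h + 1)"
    have "2 * b + s = y + p * (y - s)" unfolding b_def h by (simp add: algebra_simps)
    then have "[2 * b + s = y] (mod p)" by (simp add: cong_iff_dvd_diff)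
    then have "[(2 * b + s)\<^sup>2 = D] (mod p)" using y by (meson cong_pow cong_trans)
    then have "p dvd 4 * f b" unfolding discriminant_f by (simp add: cong_iff_dvd_diff)
    moreover have "\<not> p dvd 4"
    proof
      assume "p dvd 4"
      then have "p dvd 2 * 2" by simp
      then have "p dvd 2" using p(1) prime_dvd_mult_iff by blast
      then show False using False p(1) primes_dvd_imp_eq[of p 2] by simp
    qed
    ultimately show "\<exists>b. p dvd f b" using p(1) by (auto simp: prime_dvd_mult_iff)
  qed
  then show ?thesis unfolding chi Legendre_def using qD pm by (simp add: cong_0_iff)
qed

text \<open>At a prime dividing D the polynomial has a double root modulo p. This root does not lift to p^2, because m is squarefree, and for p = 2 because m is 2 or 3 modulo 4.\<close>

lemma ramified_root:
  fixes p :: int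
  assumes p: "prime p" "p dvd D"
  shows "card (roots p) = 1" and "\<not> p\<^sup>2 dvd f b"
proof -
  have p1: "1 < p" using p(1) prime_gt_1_int by blast
  have "\<exists>x. \<forall>b. p dvd f b \<longleftrightarrow> p dvd b - x" and "\<not> p\<^sup>2 dvd f b" for b
  proof -
    have "(\<exists>x. \<forall>b. p dvd f b \<longleftrightarrow> p dvd b - x) \<and> (\<forall>b. \<not> p\<^sup>2 dvd f b)"
    proof (cases "p = 2")
      case True
      have s0: "s = 0" using p(2) True unfolding s_def by (simp add: even_iff_mod_2_eq_zero)
      then have m23: "m mod 4 = 2 \<or> m mod 4 = 3" and "D = 4 * m" using D_cases by auto
      then have c0m: "c0 = - m" using c0 s0 by simp
      have fb: "f b = b * b - m" for b unfolding f_def s0 c0m by simp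
      have "2 dvd f b \<longleftrightarrow> 2 dvd b - m" for b unfolding fb by simp
      moreover have "\<not> 4 dvd f b" for b
      proof
        assume "4 dvd f b"
        then have "(b * b) mod 4 = m mod 4" unfolding fb by (simp add: mod_eq_dvd_iff)
        moreover have "(b * b) mod 4 = 0 \<or> (b * b) mod 4 = 1"
        proof (cases "even b")
          case True
          then obtain y where "b = 2 * y" by (elim evenE)
          then show ?thesis by simp
        next
          case False
          then obtain y where "b = 2 * y + 1" by (elim oddE)
          then have "b * b = 4 * (y * y + y) + 1" by (simp add: algebra_simps)
          then obtain k where "b * b = 4 * k + 1" by blast
          then show ?thesis by simp
        qed
        ultimately show False using m23 by auto
      qed
      ultimately show ?thesis unfolding True by (auto intro!: exI[of _ m])
    next
      case False
      then have nd2: "\<not> p dvd 2" using p(1) primes_dvd_imp_eq[of p 2] by auto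
      have o: "odd p" by (rule odd_prime_int[OF p(1) False])
      have nd4: "\<not> p dvd 4" using nd2 p(1) prime_dvd_mult_iff[of p 2 2] by simp
      obtain h where h: "p = 2 * h + 1" using o by (elim oddE)
      have root: "p dvd f b \<longleftrightarrow> p dvd 2 * b + s" for b
      proof -
        have "p dvd f b \<longleftrightarrow> p dvd 4 * f b" using nd4 p(1) by (simp add: prime_dvd_mult_iff)
        also have "\<dots> \<longleftrightarrow> p dvd (2 * b + s)\<^sup>2" unfolding discriminant_f using p(2) by (simp add: dvd_add_left_iff)
        also have "\<dots> \<longleftrightarrow> p dvd 2 * b + s" using p(1) by (simp add: prime_dvd_power_iff)
        finally show ?thesis .
      qed
      have "p dvd f b \<longleftrightarrow> p dvd b - s * h" for b
      proof -
        have e: "2 * b + s = 2 * (b - s * h) + s * p" unfolding h by (simp add: algebra_simps)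
        have "p dvd 2 * b + s \<longleftrightarrow> p dvd 2 * (b - s * h)" unfolding e by (rule dvd_add_left_iff) simp
        then show ?thesis unfolding root using nd2 prime_dvd_mult_iff[OF p(1), of 2 "b - s * h"] by blast
      qed
      moreover have "\<not> p\<^sup>2 dvd f b" for b
      proof
        assume d: "p\<^sup>2 dvd f b"
        then have "p dvd f b" unfolding power2_eq_square by (rule dvd_mult_left)
        then have "p dvd 2 * b + s" unfolding root .
        then have "p\<^sup>2 dvd (2 * b + s)\<^sup>2" by simp
        then have "p\<^sup>2 dvd 4 * f b + D" unfolding discriminant_f .
        then have "p\<^sup>2 dvd D" using d by (metis dvd_add_right_iff dvd_mult)
        moreover have "coprime (p\<^sup>2) 4" using nd4 p(1) by (simp add: prime_imp_coprime)
        ultimately have "p\<^sup>2 dvd m" using D_cases by (auto simp: coprime_dvd_mult_right_iff)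
        then have "is_unit p" using sqf unfolding squarefree_def by blast
        then show False using p(1) not_prime_unit by blast
      qed
      ultimately show ?thesis by blast
    qed
    then show "\<exists>x. \<forall>b. p dvd f b \<longleftrightarrow> p dvd b - x" and "\<not> p\<^sup>2 dvd f b" by blast+
  qed
  then show "\<not> p\<^sup>2 dvd f b" by blast
  obtain x where x: "\<And>b. p dvd f b \<longleftrightarrow> p dvd b - x" using \<open>\<exists>x. \<forall>b. p dvd f b \<longleftrightarrow> p dvd b - x\<close> by blast
  have "roots p = {x mod p}"
  proof
    show "{x mod p} \<subseteq> roots p" unfolding roots_def using p1 x[of x] by (simp add: f_mod)
    show "roots p \<subseteq> {x mod p}"
    proof
      fix z assume z: "z \<in> roots p"
      then have "p dvd z - x" unfolding roots_def using x[of z] by simp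
      then have "z mod p = x mod p" by (simp only: mod_eq_dvd_iff)
      moreover have "z mod p = z" using z unfolding roots_def by simp
      ultimately show "z \<in> {x mod p}" by simp
    qed
  qed
  then show "card (roots p) = 1" by simp
qed

lemma root_count_prime_power:
  fixes p :: nat
  assumes p: "prime p"
  defines "\<epsilon> \<equiv> chi (int p)"
  shows "root_count (p ^ 1) = 1 + \<epsilon>" and "root_count (p ^ (e + 2)) = \<epsilon> ^ (e + 1) + \<epsilon> ^ (e + 2)"
proof -
  have pi: "prime (int p)" using p by simp
  have "root_count (p ^ 1) = 1 + \<epsilon> \<and> root_count (p ^ (e + 2)) = \<epsilon> ^ (e + 1) + \<epsilon> ^ (e + 2)"
  proof (cases "int p dvd D")
    case True
    have "\<not> coprime (int p) N" using True N_eq pi by (metis coprime_common_divisor dvd_minus_iff dvd_refl not_prime_unit)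
    then have e0: "\<epsilon> = 0" unfolding \<epsilon>_def by (rule chi_not_coprime)
    have "roots (int p ^ (e + 2)) = {}"
    proof -
      have "\<not> int p ^ (e + 2) dvd f b" for b
        using ramified_root(2)[OF pi True, of b] by (metis dvd_trans le_add2 le_imp_power_dvd)
      then show ?thesis unfolding roots_def by simp
    qed
    then show ?thesis using ramified_root(1)[OF pi True] unfolding e0 root_count_def by simp
  next
    case False
    have "coprime (int p) N" using False N_eq pi by (simp add: prime_imp_coprime)
    then have e: "\<epsilon> = 1 \<or> \<epsilon> = -1" unfolding \<epsilon>_def using chi_coprime by auto
    have R1: "int (card (roots (int p))) = 1 + \<epsilon>"
      unfolding card_roots_prime[OF pi False] root_exists_iff[OF pi False] using e unfolding \<epsilon>_def by auto
    have "card (roots (int p ^ (e + 1))) = card (roots (int p))"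
    proof (induction e)
      case (Suc e)
      then show ?case using roots_lift[OF pi False, of e] by simp
    qed simp
    then have "card (roots (int p ^ (e + 2))) = card (roots (int p))" using roots_lift[OF pi False, of e] by simp
    then have "root_count (p ^ (e + 2)) = 1 + \<epsilon>" using R1 unfolding root_count_def by simp
    moreover have "\<epsilon> ^ (e + 1) + \<epsilon> ^ (e + 2) = 1 + \<epsilon>" using e by (auto simp: minus_one_power_iff)
    ultimately show ?thesis using R1 unfolding root_count_def by simp
  qed
  then show "root_count (p ^ 1) = 1 + \<epsilon>" and "root_count (p ^ (e + 2)) = \<epsilon> ^ (e + 1) + \<epsilon> ^ (e + 2)" by blast+
qed

lemma chi_power: "chi (x ^ i) = chi x ^ i"
  by (induction i) (simp_all add: chi_1 chi_mult)

text \<open>Both sides are multiplicative, so it suffices to compare them at prime powers.\<close>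

theorem ideal_count: "0 < n \<Longrightarrow> dconv square_ind root_count n = (\<Sum>d | d dvd n. chi (int d))"
proof -
  assume n: "0 < n"
  have "multiplicative (\<lambda>d. chi (int d))" unfolding multiplicative_def by (simp add: chi_mult)
  moreover have "multiplicative (\<lambda>_. 1)" by (simp add: multiplicative_def)
  ultimately have c: "multiplicative (dconv (\<lambda>d. chi (int d)) (\<lambda>_. 1))" by (rule dconv_mult)
  have "dconv square_ind root_count n = dconv (\<lambda>d. chi (int d)) (\<lambda>_. 1) n"
  proof (rule multiplicative_eqI[OF dconv_mult[OF square_ind_mult root_count_mult] c _ n])
    fix p e :: nat assume p: "prime p"
    have "dconv square_ind root_count (p ^ e) = (\<Sum>i\<le>e. (if even i then 1 else 0) * root_count (p ^ (e - i)))"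
      unfolding divisors_prime_power[OF p] square_ind_prime_power[OF p] ..
    also have "\<dots> = (\<Sum>i\<le>e. chi (int p) ^ i)"
      by (rule prime_power_identity) (use root_count_1 root_count_prime_power[OF p] in simp_all)
    also have "\<dots> = dconv (\<lambda>d. chi (int d)) (\<lambda>_. 1) (p ^ e)"
      unfolding divisors_prime_power[OF p] by (simp add: chi_power)
    finally show "dconv square_ind root_count (p ^ e) = dconv (\<lambda>d. chi (int d)) (\<lambda>_. 1) (p ^ e)" .
  qed
  then show ?thesis unfolding dconv_def by simp
qed

end

section \<open>The theta series of an ideal class\<close>

context imaginary_quadratic
begin

text \<open>A multiplier that maps I onto itself is integral, as it satisfies the characteristic equation of its matrix in a basis of I, and it has absolute value 1 since it preserves the norm of I. For N > 4 the equation (2 x + s y)^2 + N y^2 = 4 forces y = 0.\<close>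

lemma unit_pm1:
  assumes I: "nz_ideal I" and \<gamma>: "(\<lambda>x. \<gamma> * x) ` I = I"
  shows "\<gamma> = 1 \<or> \<gamma> = -1"
proof -
  obtain k a b where kab: "(k, a, b) \<in> triples" "I = ideal_of k a b" using I by (rule nz_ideal_ideal_of)
  have pos: "0 < k" "0 < a" using kab(1) unfolding triples_def by auto
  define U V :: complex where "U = of_int (k * a)" and "V = of_int k * (of_int b + \<omega>)"
  have L: "I = lat U V" unfolding kab(2) ideal_of_def U_def V_def ..
  have U0: "U \<noteq> 0" using pos by (simp add: U_def)
  have V0: "V \<noteq> 0"
  proof
    assume "V = 0"
    then have "Im V = 0" by simp
    then show False using pos Im_\<omega>_pos by (simp add: V_def)
  qed
  have closed: "\<gamma> * x \<in> I" if "x \<in> I" for x using \<gamma> that by (metis imageI)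
  have "U \<in> I" "V \<in> I" unfolding L by (rule lat_gen)+
  have \<gamma>U: "\<gamma> * U \<in> I" by (rule closed[OF \<open>U \<in> I\<close>])
  have \<gamma>V: "\<gamma> * V \<in> I" by (rule closed[OF \<open>V \<in> I\<close>])
  obtain p q where e1: "\<gamma> * U = of_int p * U + of_int q * V" using \<gamma>U unfolding L by (rule lat_E)
  obtain p' q' where e2: "\<gamma> * V = of_int p' * U + of_int q' * V" using \<gamma>V unfolding L by (rule lat_E)
  have "\<gamma> \<noteq> 0"
  proof
    assume "\<gamma> = 0"
    then have "I \<subseteq> {0}" using \<gamma> by auto
    then show False using I unfolding nz_ideal_def by blast
  qed
  have 1: "(\<gamma> - of_int p) * U = of_int q * V" and 2: "(\<gamma> - of_int q') * V = of_int p' * U"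
    using e1 e2 by (simp_all add: algebra_simps)
  have "((\<gamma> - of_int p) * (\<gamma> - of_int q')) * (U * V) = ((\<gamma> - of_int p) * U) * ((\<gamma> - of_int q') * V)" by simp
  also have "\<dots> = (of_int q * of_int p') * (U * V)" unfolding 1 2 by simp
  finally have "(\<gamma> - of_int p) * (\<gamma> - of_int q') = of_int q * of_int p'" using U0 V0 by simp
  then have "\<gamma>\<^sup>2 - of_int (p + q') * \<gamma> + of_int (p * q' - q * p') = 0" by (simp add: power2_eq_square algebra_simps)
  then have ai: "algebraic_int \<gamma>" by (rule quadratic_algebraic_int)
  have "I \<subseteq> OK" using I unfolding nz_ideal_def by blast
  then have "\<gamma> * U \<in> OK" "U \<in> OK" using \<gamma>U \<open>U \<in> I\<close> by blast+
  then have "(\<gamma> * U) / U \<in> KK" by (intro KK_divide OK_subset_KK)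
  then have "\<gamma> \<in> KK" using U0 by simp
  then have "\<gamma> \<in> OK" using ai by (rule algebraic_int_in_OK)
  then obtain x y where xy: "\<gamma> = of_int x + of_int y * \<omega>" by (elim OK_E)
  have "real_of_int (inorm I) = (cmod \<gamma>)\<^sup>2 * real_of_int (inorm I)"
    using inorm_scale[OF I, of \<gamma>] I \<open>\<gamma> \<noteq> 0\<close> unfolding \<gamma> by blast
  then have "(cmod \<gamma>)\<^sup>2 = 1" using inorm_pos[OF I] by simp
  then have "(of_int x + of_int y * (of_int s / 2))\<^sup>2 + (of_int y)\<^sup>2 * (of_int N / 4) = (1 :: real)"
    unfolding xy cmod_power2 using Im_\<omega>_squared by (simp add: Re_\<omega> power_mult_distrib)
  then have "(2 * of_int x + of_int y * of_int s)\<^sup>2 + (of_int y)\<^sup>2 * of_int N = (4 :: real)"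
    by (simp add: power2_eq_square algebra_simps)
  then have "real_of_int ((2 * x + y * s)\<^sup>2 + y\<^sup>2 * N) = real_of_int 4" by simp
  then have n4: "(2 * x + y * s)\<^sup>2 + y\<^sup>2 * N = 4" by (simp only: of_int_eq_iff)
  have "y = 0"
  proof (rule ccontr)
    assume "y \<noteq> 0"
    then have "1 \<le> y\<^sup>2" by (simp add: int_one_le_iff_zero_less)
    then have "1 * N \<le> y\<^sup>2 * N" using N_pos by (intro mult_right_mono) simp_all
    moreover have "0 \<le> (2 * x + y * s)\<^sup>2" by simp
    ultimately show False using n4 N_gt by linarith
  qed
  then have "x\<^sup>2 = 1" using n4 by simp
  then have "x = 1 \<or> x = -1" by (simp add: power2_eq_1_iff)
  then show ?thesis unfolding xy \<open>y = 0\<close> by auto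
qed

text \<open>If n is a positive integer in I, then n alpha lies in OK for every alpha that maps I into OK, and these multiples form an ideal, which has a basis by the classification of ideals.\<close>

lemma inverse_lattice:
  assumes I: "nz_ideal I"
  obtains u v where "area u v \<noteq> 0" "{\<alpha>. \<forall>x\<in>I. \<alpha> * x \<in> OK} = lat u v" "lat u v \<subseteq> KK"
proof -
  obtain k a b where kab: "(k, a, b) \<in> triples" "I = ideal_of k a b" using I by (rule nz_ideal_ideal_of)
  have pos: "0 < k" "0 < a" using kab(1) unfolding triples_def by auto
  define n where "n = k * a"
  have n: "0 < n" using pos by (simp add: n_def)
  have nI: "of_int n \<in> I" unfolding kab(2) ideal_of_def n_def by (rule lat_gen)
  have IO: "I \<subseteq> OK" using I unfolding nz_ideal_def by blast
  define M where "M = {\<beta> \<in> OK. \<forall>x\<in>I. \<exists>y\<in>OK. \<beta> * x = of_int n * y}"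
  have "nz_ideal M"
    unfolding nz_ideal_def
  proof (intro conjI ballI)
    show "M \<subseteq> OK" unfolding M_def by blast
    show "0 \<in> M" unfolding M_def using OK_0 by (auto intro!: bexI[of _ 0])
    have "of_int n \<in> M" unfolding M_def using OK_of_int IO by blast
    moreover have "of_int n \<noteq> (0 :: complex)" using n by simp
    ultimately show "M \<noteq> {0}" by blast
    fix z assume z: "z \<in> M"
    {
      fix w assume w: "w \<in> M"
      have "\<exists>y\<in>OK. (z + w) * x = of_int n * y" if x: "x \<in> I" for x
      proof -
        obtain y y' where "y \<in> OK" "y' \<in> OK" "z * x = of_int n * y" "w * x = of_int n * y'"
          using z w x unfolding M_def by blast
        then show ?thesis using OK_add[of y y'] by (intro bexI[of _ "y + y'"]) (simp_all add: algebra_simps)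
      qed
      then show "z + w \<in> M" using z w OK_add unfolding M_def by blast
    }
    fix \<alpha> assume \<alpha>: "\<alpha> \<in> OK"
    have "\<exists>y\<in>OK. (\<alpha> * z) * x = of_int n * y" if x: "x \<in> I" for x
    proof -
      obtain y where "y \<in> OK" "z * x = of_int n * y" using z x unfolding M_def by blast
      then show ?thesis using OK_mult[OF \<alpha>, of y] by (intro bexI[of _ "\<alpha> * y"]) (simp_all add: mult_ac)
    qed
    then show "\<alpha> * z \<in> M" using z OK_mult[OF \<alpha>] unfolding M_def by blast
  qed
  then obtain k' a' b' where M: "(k', a', b') \<in> triples" "M = ideal_of k' a' b'" by (rule nz_ideal_ideal_of)
  define U V :: complex where "U = of_int (k' * a')" and "V = of_int k' * (of_int b' + \<omega>)"
  have MUV: "M = lat U V" unfolding M(2) ideal_of_def U_def V_def ..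
  define ni :: complex where "ni = inverse (of_int n)"
  have ni: "ni \<noteq> 0" "ni * of_int n = 1" using n by (simp_all add: ni_def)
  have mem: "(\<forall>x\<in>I. \<alpha> * x \<in> OK) \<longleftrightarrow> of_int n * \<alpha> \<in> M" for \<alpha>
  proof
    assume h: "\<forall>x\<in>I. \<alpha> * x \<in> OK"
    then have "of_int n * \<alpha> \<in> OK" using nI by (metis mult.commute)
    moreover have "\<exists>y\<in>OK. (of_int n * \<alpha>) * x = of_int n * y" if "x \<in> I" for x
      using h that by (intro bexI[of _ "\<alpha> * x"]) (simp_all add: mult.assoc)
    ultimately show "of_int n * \<alpha> \<in> M" unfolding M_def by blast
  next
    assume h: "of_int n * \<alpha> \<in> M"
    show "\<forall>x\<in>I. \<alpha> * x \<in> OK"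
    proof
      fix x assume "x \<in> I"
      then obtain y where "y \<in> OK" "(of_int n * \<alpha>) * x = of_int n * y" using h unfolding M_def by blast
      then show "\<alpha> * x \<in> OK" using n by simp
    qed
  qed
  have set: "{\<alpha>. \<forall>x\<in>I. \<alpha> * x \<in> OK} = lat (ni * U) (ni * V)"
    unfolding lat_scale[symmetric] MUV[symmetric]
  proof
    show "{\<alpha>. \<forall>x\<in>I. \<alpha> * x \<in> OK} \<subseteq> (\<lambda>x. ni * x) ` M"
    proof
      fix \<alpha> assume "\<alpha> \<in> {\<alpha>. \<forall>x\<in>I. \<alpha> * x \<in> OK}"
      then have "of_int n * \<alpha> \<in> M" using mem by blast
      moreover have "\<alpha> = ni * (of_int n * \<alpha>)" using ni(2) by (simp add: mult.assoc[symmetric])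
      ultimately show "\<alpha> \<in> (\<lambda>x. ni * x) ` M" by blast
    qed
    show "(\<lambda>x. ni * x) ` M \<subseteq> {\<alpha>. \<forall>x\<in>I. \<alpha> * x \<in> OK}"
    proof
      fix \<alpha> assume "\<alpha> \<in> (\<lambda>x. ni * x) ` M"
      then obtain \<beta> where \<beta>: "\<beta> \<in> M" "\<alpha> = ni * \<beta>" by blast
      have e: "of_int n * (ni * \<beta>) = \<beta>" using ni(2) by (metis mult.assoc mult.commute mult.left_neutral)
      have "of_int n * \<alpha> \<in> M" unfolding \<beta>(2) e by (rule \<beta>(1))
      then show "\<alpha> \<in> {\<alpha>. \<forall>x\<in>I. \<alpha> * x \<in> OK}" using mem by blast
    qed
  qed
  have "area U V = of_int (k' * k' * a') * Im \<omega>" unfolding U_def V_def by (rule area_ideal_of)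
  moreover have "0 < k' * k' * a'" using M(1) unfolding triples_def by simp
  then have "of_int (k' * k' * a') \<noteq> (0 :: real)" by (simp only: of_int_eq_0_iff)
  ultimately have "area (ni * U) (ni * V) \<noteq> 0" unfolding area_scale using ni Im_\<omega>_pos by simp
  moreover have "lat (ni * U) (ni * V) \<subseteq> KK"
  proof -
    have "ni \<in> KK" unfolding ni_def by (intro KK_inverse of_int_KK)
    moreover have "M \<subseteq> KK" unfolding M_def using OK_subset_KK by blast
    ultimately show ?thesis unfolding lat_scale[symmetric] MUV[symmetric] using KK_mult by blast
  qed
  ultimately show ?thesis using set that by blast
qed

text \<open>Completing the square, with Lagrange's identity for the real and imaginary part of the product of v with the conjugate of u.\<close>

lemma lattice_norm_form:
  assumes "area u v \<noteq> 0"
  defines "p \<equiv> (cmod u)\<^sup>2" and "\<rho> \<equiv> Re (cnj u * v) / (cmod u)\<^sup>2" and "\<kappa> \<equiv> (area u v)\<^sup>2 / (cmod u)\<^sup>2"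
  shows "0 < p" "0 < \<kappa>" "(cmod (of_int i * u + of_int j * v))\<^sup>2 = p * (of_int i + \<rho> * of_int j)\<^sup>2 + \<kappa> * (of_int j)\<^sup>2"
proof -
  have u: "u \<noteq> 0" using assms(1) unfolding area_def by auto
  then show p: "0 < p" unfolding p_def by simp
  then show "0 < \<kappa>" using assms(1) unfolding \<kappa>_def p_def by simp
  define R where "R = Re (cnj u * v)"
  have lag: "p * (cmod v)\<^sup>2 = R\<^sup>2 + (area u v)\<^sup>2"
    unfolding p_def R_def area_def cmod_power2[symmetric] by (simp add: norm_mult power_mult_distrib)
  have "(cmod (of_int i * u + of_int j * v))\<^sup>2 = (of_int i)\<^sup>2 * p + 2 * of_int i * of_int j * R + (of_int j)\<^sup>2 * (cmod v)\<^sup>2"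
    unfolding p_def R_def cmod_power2 by (simp add: power2_eq_square algebra_simps)
  then have "p * (cmod (of_int i * u + of_int j * v))\<^sup>2 = (of_int i * p)\<^sup>2 + 2 * of_int i * p * of_int j * R + (of_int j)\<^sup>2 * (p * (cmod v)\<^sup>2)"
    by (simp add: power2_eq_square algebra_simps)
  also have "\<dots> = (of_int i * p + of_int j * R)\<^sup>2 + (of_int j)\<^sup>2 * (area u v)\<^sup>2"
    unfolding lag by (simp add: power2_eq_square algebra_simps)
  also have "\<dots> = p * (p * (of_int i + \<rho> * of_int j)\<^sup>2 + \<kappa> * (of_int j)\<^sup>2)"
  proof -
    have 1: "R = p * \<rho>" "(area u v)\<^sup>2 = p * \<kappa>" using p unfolding \<rho>_def \<kappa>_def R_def p_def[symmetric] by simp_all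
    show ?thesis unfolding 1 by (simp add: power2_eq_square algebra_simps)
  qed
  finally show "(cmod (of_int i * u + of_int j * v))\<^sup>2 = p * (of_int i + \<rho> * of_int j)\<^sup>2 + \<kappa> * (of_int j)\<^sup>2"
    using p by simp
qed

lemma lat_param_bij:
  assumes "area u v \<noteq> 0"
  shows "bij_betw (\<lambda>(j::int, i::int). of_int i * u + of_int j * v) (UNIV - {(0, 0)}) (lat u v - {0})"
proof -
  have inj: "i = 0 \<and> j = 0" if "of_int i * u + of_int j * v = 0" for i j :: int
  proof -
    have "(cmod (of_int i * u + of_int j * v))\<^sup>2 = 0" using that by simp
    then have z: "(cmod u)\<^sup>2 * (of_int i + Re (cnj u * v) / (cmod u)\<^sup>2 * of_int j)\<^sup>2 + (area u v)\<^sup>2 / (cmod u)\<^sup>2 * (of_int j)\<^sup>2 = 0"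
      unfolding lattice_norm_form(3)[OF assms] .
    have pp: "0 < (cmod u)\<^sup>2" "0 < (area u v)\<^sup>2 / (cmod u)\<^sup>2" using lattice_norm_form(1,2)[OF assms] .
    have "(area u v)\<^sup>2 / (cmod u)\<^sup>2 * (of_int j)\<^sup>2 = 0"
      using z pp by (meson add_nonneg_eq_0_iff less_imp_le mult_nonneg_nonneg zero_le_power2)
    then have "(of_int j)\<^sup>2 = (0 :: real)" using pp(2) by (metis mult_eq_0_iff less_irrefl)
    then have j: "j = 0" by simp
    then have "of_int i * u = 0" using that by simp
    then show ?thesis using j pp(1) by auto
  qed
  show ?thesis unfolding bij_betw_def
  proof
    show "inj_on (\<lambda>(j::int, i::int). of_int i * u + of_int j * v) (UNIV - {(0, 0)})"
    proof (rule inj_onI)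
      fix z z' :: "int \<times> int"
      assume e: "(case z of (j, i) \<Rightarrow> of_int i * u + of_int j * v) = (case z' of (j, i) \<Rightarrow> of_int i * u + of_int j * v)"
      obtain j i j' i' where zz: "z = (j, i)" "z' = (j', i')" by (cases z; cases z')
      have "of_int (i - i') * u + of_int (j - j') * v = 0" using e unfolding zz by (simp add: algebra_simps)
      then show "z = z'" unfolding zz using inj[of "i - i'" "j - j'"] by simp
    qed
    show "(\<lambda>(j::int, i::int). of_int i * u + of_int j * v) ` (UNIV - {(0, 0)}) = lat u v - {0}"
    proof
      show "(\<lambda>(j::int, i::int). of_int i * u + of_int j * v) ` (UNIV - {(0, 0)}) \<subseteq> lat u v - {0}"
        using inj lat_I by auto
      show "lat u v - {0} \<subseteq> (\<lambda>(j::int, i::int). of_int i * u + of_int j * v) ` (UNIV - {(0, 0)})"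
      proof
        fix z assume z: "z \<in> lat u v - {0}"
        then obtain i j where ij: "z = of_int i * u + of_int j * v" by (auto elim: lat_E)
        then have "(j, i) \<noteq> (0, 0)" using z by auto
        then show "z \<in> (\<lambda>(j::int, i::int). of_int i * u + of_int j * v) ` (UNIV - {(0, 0)})"
          using ij by (intro image_eqI[of _ _ "(j, i)"]) auto
      qed
    qed
  qed
qed

text \<open>The map alpha \<mapsto> alpha I from the nonzero elements of the inverse lattice to the ideals of the class is onto and two-to-one, and the norm of alpha I is the norm of I times a positive definite form in the coordinates of alpha.\<close>

lemma class_theta:
  assumes "c \<in> ideal_classes"
  shows "\<exists>p \<kappa> \<rho>. 0 < p \<and> 0 < \<kappa> \<and> (\<forall>t>0.
    ((\<lambda>J. exp (- (t * of_int (inorm J)))) has_sum (theta2 p \<kappa> \<rho> t 0 0 - 1) / 2) {J. nz_ideal J \<and> scaling_class J = c})"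
proof -
  obtain I where I: "nz_ideal I" "c = scaling_class I" using assms unfolding ideal_classes_def by blast
  obtain u v where uv: "area u v \<noteq> 0" "{\<alpha>. \<forall>x\<in>I. \<alpha> * x \<in> OK} = lat u v" "lat u v \<subseteq> KK" using inverse_lattice[OF I(1)] by blast
  define n where "n = real_of_int (inorm I)"
  have n: "0 < n" using inorm_pos[OF I(1)] by (simp add: n_def)
  define p \<rho> \<kappa> where "p = (cmod u)\<^sup>2" and "\<rho> = Re (cnj u * v) / (cmod u)\<^sup>2" and "\<kappa> = (area u v)\<^sup>2 / (cmod u)\<^sup>2"
  note form = lattice_norm_form[OF uv(1), folded p_def \<rho>_def \<kappa>_def]
  define A where "A = lat u v - {0}"
  define Js where "Js = {J. nz_ideal J \<and> scaling_class J = c}"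
  have scaled: "(\<lambda>x. \<alpha> * x) ` I \<in> Js" if "\<alpha> \<in> A" for \<alpha>
  proof -
    have \<alpha>: "\<alpha> \<noteq> 0" "\<alpha> \<in> KK" "\<And>x. x \<in> I \<Longrightarrow> \<alpha> * x \<in> OK" using that uv(2,3) unfolding A_def by blast+
    have "nz_ideal ((\<lambda>x. \<alpha> * x) ` I)"
      unfolding nz_ideal_def
    proof (intro conjI ballI)
      show "(\<lambda>x. \<alpha> * x) ` I \<subseteq> OK" using \<alpha>(3) by blast
      show "0 \<in> (\<lambda>x. \<alpha> * x) ` I" using I(1) unfolding nz_ideal_def by (intro image_eqI[of _ _ 0]) simp_all
      show "(\<lambda>x. \<alpha> * x) ` I \<noteq> {0}"
      proof -
        obtain x where "x \<in> I" "x \<noteq> 0" using I(1) unfolding nz_ideal_def by blast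
        then have "\<alpha> * x \<in> (\<lambda>x. \<alpha> * x) ` I" "\<alpha> * x \<noteq> 0" using \<alpha>(1) by simp_all
        then show ?thesis by blast
      qed
      fix z assume "z \<in> (\<lambda>x. \<alpha> * x) ` I"
      then obtain x where x: "x \<in> I" "z = \<alpha> * x" by blast
      {
        fix w assume "w \<in> (\<lambda>x. \<alpha> * x) ` I"
        then obtain y where y: "y \<in> I" "w = \<alpha> * y" by blast
        have "x + y \<in> I" using I(1) x(1) y(1) unfolding nz_ideal_def by blast
        moreover have "z + w = \<alpha> * (x + y)" unfolding x(2) y(2) by (simp add: algebra_simps)
        ultimately show "z + w \<in> (\<lambda>x. \<alpha> * x) ` I" by blast
      }
      fix b assume "b \<in> OK"
      then have "b * x \<in> I" using I(1) x(1) unfolding nz_ideal_def by blast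
      moreover have "b * z = \<alpha> * (b * x)" unfolding x(2) by simp
      ultimately show "b * z \<in> (\<lambda>x. \<alpha> * x) ` I" by blast
    qed
    then show ?thesis unfolding Js_def I(2) using scaling_class_scale \<alpha> by simp
  qed
  define fib where "fib = (\<lambda>J. {\<alpha> \<in> A. (\<lambda>x. \<alpha> * x) ` I = J})"
  have two: "finite (fib J) \<and> card (fib J) = 2" if J: "J \<in> Js" for J
  proof -
    obtain a where a: "a \<in> KK" "a \<noteq> 0" "J = (\<lambda>x. a * x) ` I"
      using J unfolding Js_def I(2) by (auto simp: scaling_class_eq_iff)
    have JO: "J \<subseteq> OK" using J unfolding Js_def nz_ideal_def by blast
    have inA: "\<alpha> \<in> A" if "\<alpha> \<noteq> 0" "(\<lambda>x. \<alpha> * x) ` I = J" for \<alpha>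
    proof -
      have "\<forall>x\<in>I. \<alpha> * x \<in> OK" using that(2) JO by blast
      then have "\<alpha> \<in> lat u v" unfolding uv(2)[symmetric] by simp
      then show ?thesis unfolding A_def using that(1) by simp
    qed
    have aA: "a \<in> A" by (rule inA[OF a(2) a(3)[symmetric]])
    have neg: "(\<lambda>x. - a * x) ` I = J"
    proof
      have m: "- x \<in> I" if "x \<in> I" for x using nz_ideal_minus[OF I(1) that] .
      show "(\<lambda>x. - a * x) ` I \<subseteq> J"
      proof
        fix z assume "z \<in> (\<lambda>x. - a * x) ` I"
        then obtain x where "x \<in> I" "z = a * (- x)" by auto
        then show "z \<in> J" unfolding a(3) using m by blast
      qed
      show "J \<subseteq> (\<lambda>x. - a * x) ` I"
      proof
        fix z assume "z \<in> J"
        then obtain x where x: "x \<in> I" "z = a * x" unfolding a(3) by blast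
        then have "z = - a * (- x)" by simp
        then show "z \<in> (\<lambda>x. - a * x) ` I" using m[OF x(1)] by blast
      qed
    qed
    have naA: "- a \<in> A" by (rule inA[OF _ neg]) (use a(2) in simp)
    have "fib J = {a, - a}"
    proof
      show "{a, - a} \<subseteq> fib J" unfolding fib_def using aA naA a(3) neg by blast
      show "fib J \<subseteq> {a, - a}"
      proof
        fix \<beta> assume "\<beta> \<in> fib J"
        then have \<beta>: "(\<lambda>x. \<beta> * x) ` I = (\<lambda>x. a * x) ` I" unfolding fib_def a(3) by blast
        have "(\<lambda>x. (\<beta> / a) * x) ` I = (\<lambda>x. inverse a * x) ` ((\<lambda>x. \<beta> * x) ` I)"
          unfolding image_mult_image by (simp add: divide_inverse mult_ac)
        also have "\<dots> = I" unfolding \<beta> image_mult_image using a(2) by simp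
        finally have "\<beta> / a = 1 \<or> \<beta> / a = -1" by (rule unit_pm1[OF I(1)])
        then show "\<beta> \<in> {a, - a}" using a(2) by (auto simp: field_simps)
      qed
    qed
    moreover have "a \<noteq> - a" using a(2) by simp
    ultimately show ?thesis by simp
  qed
  have main: "((\<lambda>J. exp (- (t * of_int (inorm J)))) has_sum (theta2 (n * p) (n * \<kappa>) \<rho> t 0 0 - 1) / 2) Js" if t: "0 < t" for t
  proof -
    let ?G = "\<lambda>(j::int, i::int). exp (- (t * (n * p * ((of_int i + 0) + \<rho> * (of_int j + 0))\<^sup>2 + n * \<kappa> * (of_int j + 0)\<^sup>2)))"
    let ?g = "\<lambda>\<alpha>. exp (- (t * ((cmod \<alpha>)\<^sup>2 * n)))"
    have np: "0 < n * p" "0 < n * \<kappa>" using n form(1,2) by simp_all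
    have "(?G has_sum theta2 (n * p) (n * \<kappa>) \<rho> t 0 0) UNIV"
      unfolding theta2_def by (rule has_sum_infsum[OF theta2_has_sum(1)[OF np t]])
    moreover have "(?G has_sum 1) {(0, 0)}" by (rule has_sum_finiteI) simp_all
    ultimately have G: "(?G has_sum (theta2 (n * p) (n * \<kappa>) \<rho> t 0 0 - 1)) (UNIV - {(0, 0)})"
      by (rule has_sum_Diff) simp
    have gG: "?g (case z of (j, i) \<Rightarrow> of_int i * u + of_int j * v) = ?G z" for z :: "int \<times> int"
    proof -
      have "t * ((cmod (of_int i * u + of_int j * v))\<^sup>2 * n) = t * (n * p * ((of_int i + 0) + \<rho> * (of_int j + 0))\<^sup>2 + n * \<kappa> * (of_int j + 0)\<^sup>2)" for i j
        unfolding form(3) by (simp add: algebra_simps)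
      then show ?thesis by (cases z) (simp only: case_prod_conv)
    qed
    have gA: "(?g has_sum (theta2 (n * p) (n * \<kappa>) \<rho> t 0 0 - 1)) A"
      unfolding A_def using G has_sum_reindex_bij_betw[OF lat_param_bij[OF uv(1)], of ?g] unfolding gG by blast
    have bij: "bij_betw (\<lambda>\<alpha>. ((\<lambda>x. \<alpha> * x) ` I, \<alpha>)) A (Sigma Js fib)"
      by (rule bij_betw_byWitness[where f' = snd]) (use scaled in \<open>auto simp: fib_def\<close>)
    \<comment> \<open>Summing over the fibres of the two-to-one map.\<close>
    have gS: "((\<lambda>z. ?g (snd z)) has_sum (theta2 (n * p) (n * \<kappa>) \<rho> t 0 0 - 1)) (Sigma Js fib)"
      using gA has_sum_reindex_bij_betw[OF bij, of "\<lambda>z. ?g (snd z)"] by simp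
    have "((\<lambda>J. 2 * exp (- (t * of_int (inorm J)))) has_sum (theta2 (n * p) (n * \<kappa>) \<rho> t 0 0 - 1)) Js"
    proof (rule has_sum_SigmaD[OF gS])
      fix J assume J: "J \<in> Js"
      have g_eq: "?g \<alpha> = exp (- (t * of_int (inorm J)))" if "\<alpha> \<in> fib J" for \<alpha>
      proof -
        have \<alpha>: "\<alpha> \<noteq> 0" "(\<lambda>x. \<alpha> * x) ` I = J" using that unfolding fib_def A_def by blast+
        have "nz_ideal J" using J unfolding Js_def by blast
        then have "of_int (inorm J) = (cmod \<alpha>)\<^sup>2 * n" using inorm_scale[OF I(1), of \<alpha>] \<alpha> unfolding n_def by simp
        then show ?thesis by simp
      qed
      have "(\<Sum>\<alpha>\<in>fib J. ?g \<alpha>) = (\<Sum>\<alpha>\<in>fib J. exp (- (t * of_int (inorm J))))"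
        by (rule sum.cong[OF refl g_eq])
      also have "\<dots> = 2 * exp (- (t * of_int (inorm J)))" using two[OF J] by simp
      finally have "(\<Sum>\<alpha>\<in>fib J. ?g \<alpha>) = 2 * exp (- (t * of_int (inorm J)))" .
      then show "((\<lambda>y. ?g (snd (J, y))) has_sum 2 * exp (- (t * of_int (inorm J)))) (fib J)"
        using two[OF J] by (intro has_sum_finiteI) simp_all
    qed
    from has_sum_cmult_right[OF this, of "1 / 2"] show ?thesis by simp
  qed
  show ?thesis using main n form(1,2) unfolding Js_def
    by (intro exI[of _ "n * p"] exI[of _ "n * \<kappa>"] exI[of _ \<rho>]) simp
qed

end

section \<open>The class number formula\<close>

context imaginary_quadratic
begin

definition chi_real :: "nat \<Rightarrow> real" where "chi_real d = of_int (chi (int d))"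

lemma chi_le_1: "\<bar>chi x\<bar> \<le> 1"
  using chi_coprime[of x] chi_not_coprime[of x] by (cases "coprime x N") auto

lemma sum_chi_real: "(\<Sum>x = 1..nat N. g (int x) * chi_real x) = (\<Sum>x\<in>reps. g x * of_int (chi x))" for g :: "int \<Rightarrow> real"
proof -
  have "bij_betw int {1..nat N} {1..N}"
    by (rule bij_betw_byWitness[where f' = nat]) auto
  from sum.reindex_bij_betw[OF this, of "\<lambda>x. g x * of_int (chi x)"]
  have "(\<Sum>x = 1..nat N. g (int x) * chi_real x) = (\<Sum>x\<in>{1..N}. g x * of_int (chi x))" by (simp add: chi_real_def)
  also have "\<dots> = (\<Sum>x\<in>reps. g x * of_int (chi x))"
  proof (rule sum.mono_neutral_right)
    show "reps \<subseteq> {1..N}" by (auto simp: reps_iff)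
    show "\<forall>i\<in>{1..N} - reps. g i * of_int (chi i) = 0"
    proof
      fix i assume i: "i \<in> {1..N} - reps"
      have "\<not> coprime i N"
      proof
        assume c: "coprime i N"
        then have "i = N" using i unfolding reps_iff Diff_iff by auto
        then show False using c N_gt by simp
      qed
      then show "g i * of_int (chi i) = 0" by (simp add: chi_not_coprime)
    qed
  qed simp
  finally show ?thesis .
qed

lemma periodic: "periodic_mean_zero chi_real (nat N)"
proof
  show "0 < nat N" using N_pos by simp
  show "chi_real (d + nat N) = chi_real d" for d
    unfolding chi_real_def using chi_cong[of "int d + N" "int d"] N_pos by (simp add: Cong.cong_def)
  have "(\<Sum>x = 1..nat N. chi_real x) = of_int (\<Sum>x\<in>reps. chi x)"
    using sum_chi_real[of "\<lambda>_. 1"] by simp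
  then show "(\<Sum>x = 1..nat N. chi_real x) = 0" unfolding sum_chi_reps by simp
  show "\<bar>chi_real d\<bar> \<le> 1" for d unfolding chi_real_def using chi_le_1[of "int d"] by linarith
qed

definition norm_fibre :: "nat \<Rightarrow> (int \<times> int \<times> int) set" where
  "norm_fibre n = {(k, a, b). (k, a, b) \<in> triples \<and> k * k * a = int n}"

text \<open>A triple of norm n is determined by the square k^2, which divides n, and by the root b modulo the cofactor.\<close>

lemma card_norm_fibre:
  assumes n: "0 < n"
  shows "finite (norm_fibre n)" and "int (card (norm_fibre n)) = dconv square_ind root_count n"
proof -
  let ?S = "{d. d dvd n \<and> is_nth_power 2 d}"
  have finS: "finite ?S" using n by (intro finite_subset[OF _ finite_divisors_nat[of n]]) auto
  have inj: "inj_on (\<lambda>(k, a, b). (nat (k * k), b)) (norm_fibre n)"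
  proof (rule inj_onI)
    fix z w assume z: "z \<in> norm_fibre n" and w: "w \<in> norm_fibre n"
      and e: "(case z of (k, a, b) \<Rightarrow> (nat (k * k), b)) = (case w of (k, a, b) \<Rightarrow> (nat (k * k), b))"
    obtain k a b where zz: "z = (k, a, b)" by (cases z)
    obtain k' a' b' where ww: "w = (k', a', b')" by (cases w)
    have k: "0 < k" "0 < k'" "k * k * a = int n" "k' * k' * a' = int n"
      using z w unfolding zz ww norm_fibre_def triples_def by auto
    have b: "b = b'" and "nat (k * k) = nat (k' * k')" using e unfolding zz ww by auto
    then have "k * k = k' * k'" using k by (simp add: eq_nat_nat_iff)
    then have "k = k'" using k(1,2) by (metis power2_eq_square power2_eq_imp_eq less_imp_le)
    moreover from this have "a = a'" using k by (metis mult_left_cancel mult_eq_0_iff less_irrefl)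
    ultimately show "z = w" unfolding zz ww using b by simp
  qed
  have img: "(\<lambda>(k, a, b). (nat (k * k), b)) ` norm_fibre n = Sigma ?S (\<lambda>d. roots (int (n div d)))"
  proof
    show "(\<lambda>(k, a, b). (nat (k * k), b)) ` norm_fibre n \<subseteq> Sigma ?S (\<lambda>d. roots (int (n div d)))"
    proof
      fix y assume "y \<in> (\<lambda>(k, a, b). (nat (k * k), b)) ` norm_fibre n"
      then obtain k a b where kab: "(k, a, b) \<in> triples" "k * k * a = int n" "y = (nat (k * k), b)"
        unfolding norm_fibre_def by auto
      define k' a' where "k' = nat k" and "a' = nat a"
      have ka: "k = int k'" "a = int a'" "0 < k'" "0 < a'" using kab(1) unfolding triples_def k'_def a'_def by auto
      have "int (k' * k' * a') = int n" using kab(2) unfolding ka by simp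
      then have nn: "n = k' * k' * a'" by (simp only: of_nat_eq_iff)
      have "nat (k * k) = k' * k'" unfolding ka by (simp add: nat_mult_distrib)
      moreover have "is_nth_power 2 (k' * k')" by (metis is_nth_power_def power2_eq_square)
      moreover have "k' * k' dvd n" unfolding nn by simp
      moreover have "n div (k' * k') = a'" unfolding nn using ka by simp
      moreover have "b \<in> roots a" using kab(1) unfolding triples_def roots_def by auto
      ultimately show "y \<in> Sigma ?S (\<lambda>d. roots (int (n div d)))" unfolding kab(3) ka by simp
    qed
    show "Sigma ?S (\<lambda>d. roots (int (n div d))) \<subseteq> (\<lambda>(k, a, b). (nat (k * k), b)) ` norm_fibre n"
    proof
      fix y assume "y \<in> Sigma ?S (\<lambda>d. roots (int (n div d)))"
      then obtain d b where y: "y = (d, b)" "d dvd n" "is_nth_power 2 d" "b \<in> roots (int (n div d))" by blast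
      obtain j where j: "d = j * j" using y(3) by (auto simp: is_nth_power_def power2_eq_square)
      obtain a where a: "n = d * a" using y(2) by (elim dvdE)
      have pos: "0 < j" "0 < a" using n unfolding a j by simp_all
      have "n div d = a" unfolding a j using pos by simp
      then have "(int j, int a, b) \<in> norm_fibre n"
        using y(4) pos unfolding norm_fibre_def triples_def roots_def a j by simp
      moreover have "nat (int j * int j) = d" unfolding j by (simp add: nat_mult_distrib)
      ultimately show "y \<in> (\<lambda>(k, a, b). (nat (k * k), b)) ` norm_fibre n"
        unfolding y(1) by (intro image_eqI[of _ _ "(int j, int a, b)"]) simp_all
    qed
  qed
  have "finite (Sigma ?S (\<lambda>d. roots (int (n div d))))" using finS by (intro finite_SigmaI) simp_all
  then have "finite ((\<lambda>(k, a, b). (nat (k * k), b)) ` norm_fibre n)" unfolding img .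
  then show "finite (norm_fibre n)" by (rule finite_imageD[OF _ inj])
  have "card (norm_fibre n) = (\<Sum>d\<in>?S. card (roots (int (n div d))))"
    using card_image[OF inj] unfolding img using finS by (simp add: card_SigmaI)
  then have "int (card (norm_fibre n)) = (\<Sum>d\<in>?S. root_count (n div d))" unfolding root_count_def by simp
  also have "\<dots> = (\<Sum>d\<in>?S. square_ind d * root_count (n div d))" by (intro sum.cong refl) (simp add: square_ind_def)
  also have "\<dots> = dconv square_ind root_count n"
    unfolding dconv_def
  proof (rule sum.mono_neutral_left)
    show "finite {d. d dvd n}" using n by (rule finite_divisors_nat)
    show "?S \<subseteq> {d. d dvd n}" by blast
    show "\<forall>d\<in>{d. d dvd n} - ?S. square_ind d * root_count (n div d) = 0" by (simp add: square_ind_def)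
  qed
  finally show "int (card (norm_fibre n)) = dconv square_ind root_count n" .
qed

text \<open>The double series defining the Lambert series, grouped by the product n of the two indices.\<close>

lemma lambert_divisor_sum:
  assumes t: "0 < t"
  shows "((\<lambda>n. real_of_int (dconv square_ind root_count n) * exp (- (t * real n))) has_sum lambert chi_real t) {1..}"
proof -
  interpret P: periodic_mean_zero chi_real "nat N" by (rule periodic)
  have bij: "bij_betw (\<lambda>(d::nat, k::nat). (d * k, d)) ({1..} \<times> {1..}) (Sigma {1..} (\<lambda>n. {d::nat. d dvd n}))"
  proof (rule bij_betw_byWitness[where f' = "\<lambda>(n::nat, d::nat). (d, n div d)"])
    show "(\<lambda>(n::nat, d::nat). (d, n div d)) ` (Sigma {1..} (\<lambda>n. {d. d dvd n})) \<subseteq> {1..} \<times> {1..}"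
    proof
      fix z assume "z \<in> (\<lambda>(n::nat, d::nat). (d, n div d)) ` (Sigma {1..} (\<lambda>n. {d. d dvd n}))"
      then obtain d k :: nat where "z = (d, (d * k) div d)" "1 \<le> d * k" by (auto elim!: dvdE)
      moreover from this have "0 < d * k" by linarith
      then have "0 < d" "0 < k" by auto
      ultimately show "z \<in> {1..} \<times> {1..}" by simp
    qed
  qed auto
  let ?F = "\<lambda>(n, d). chi_real d * exp (- (t * real n))"
  have "((\<lambda>(d, k). chi_real d * exp (- (t * real (d * k)))) has_sum lambert chi_real t) ({1..} \<times> {1..})"
    unfolding lambert_def by (rule has_sum_infsum[OF P.lambert_summable(2)[OF t]])
  moreover have "?F ((\<lambda>(d, k). (d * k, d)) z) = (\<lambda>(d, k). chi_real d * exp (- (t * real (d * k)))) z" for z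
    by (cases z) simp
  ultimately have "(?F has_sum lambert chi_real t) (Sigma {1..} (\<lambda>n. {d. d dvd n}))"
    using has_sum_reindex_bij_betw[OF bij, of ?F "lambert chi_real t"] by simp
  then show ?thesis
  proof (rule has_sum_SigmaD)
    fix n :: nat assume "n \<in> {1..}"
    then have n: "0 < n" by simp
    have "real_of_int (dconv square_ind root_count n) * exp (- (t * real n)) = (\<Sum>d | d dvd n. chi_real d * exp (- (t * real n)))"
      unfolding ideal_count[OF n] by (simp add: chi_real_def sum_distrib_right)
    then show "((\<lambda>y. ?F (n, y)) has_sum real_of_int (dconv square_ind root_count n) * exp (- (t * real n))) {d. d dvd n}"
      using n by (intro has_sum_finiteI) (simp_all add: finite_divisors_nat)
  qed
qed

lemma ideal_norm_sum:
  assumes t: "0 < t"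
  shows "((\<lambda>J. exp (- (t * of_int (inorm J)))) has_sum lambert chi_real t) {J. nz_ideal J}"
proof -
  let ?F = "\<lambda>(n::nat, z::int \<times> int \<times> int). exp (- (t * real n))"
  have inner: "((\<lambda>y. ?F (n, y)) has_sum real_of_int (dconv square_ind root_count n) * exp (- (t * real n))) (norm_fibre n)" if "n \<in> {1..}" for n
  proof -
    have n: "0 < n" using that by simp
    have "real_of_int (dconv square_ind root_count n) * exp (- (t * real n)) = (\<Sum>y\<in>norm_fibre n. exp (- (t * real n)))"
      unfolding card_norm_fibre(2)[OF n, symmetric] by simp
    then show ?thesis using card_norm_fibre(1)[OF n] by (intro has_sum_finiteI) simp_all
  qed
  have "?F summable_on Sigma {1..} norm_fibre"
    by (rule summable_on_SigmaI[OF inner has_sum_imp_summable[OF lambert_divisor_sum[OF t]]]) auto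
  then have S: "(?F has_sum lambert chi_real t) (Sigma {1..} norm_fibre)"
    using has_sum_SigmaI[OF inner lambert_divisor_sum[OF t]] by blast
  have bij: "bij_betw (\<lambda>z. case z of (k, a, b) \<Rightarrow> (nat (k * k * a), z)) triples (Sigma {1..} norm_fibre)"
  proof (rule bij_betw_byWitness[where f' = snd])
    show "(\<lambda>z. case z of (k, a, b) \<Rightarrow> (nat (k * k * a), z)) ` triples \<subseteq> Sigma {1..} norm_fibre"
    proof
      fix y assume "y \<in> (\<lambda>z. case z of (k, a, b) \<Rightarrow> (nat (k * k * a), z)) ` triples"
      then obtain k a b where kab: "(k, a, b) \<in> triples" "y = (nat (k * k * a), (k, a, b))" by auto
      have "0 < k * k * a" using kab(1) unfolding triples_def by simp
      then have "1 \<le> nat (k * k * a)" "int (nat (k * k * a)) = k * k * a" by linarith+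
      then show "y \<in> Sigma {1..} norm_fibre" unfolding kab(2) norm_fibre_def using kab(1) by simp
    qed
    show "\<forall>a'\<in>Sigma {1..} norm_fibre. (case snd a' of (k, a, b) \<Rightarrow> (nat (k * k * a), snd a')) = a'"
    proof
      fix z assume "z \<in> Sigma {1..} norm_fibre"
      then obtain n k a b where "z = (n, (k, a, b))" "k * k * a = int n" unfolding norm_fibre_def by auto
      then show "(case snd z of (k, a, b) \<Rightarrow> (nat (k * k * a), snd z)) = z" by simp
    qed
    show "snd ` Sigma {1..} norm_fibre \<subseteq> triples" unfolding norm_fibre_def by auto
  qed (auto split: prod.splits)
  have "((\<lambda>z. ?F (case z of (k, a, b) \<Rightarrow> (nat (k * k * a), z))) has_sum lambert chi_real t) triples"
    using S has_sum_reindex_bij_betw[OF bij, of ?F "lambert chi_real t"] by simp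
  moreover have "?F (case z of (k, a, b) \<Rightarrow> (nat (k * k * a), z)) = exp (- (t * of_int (inorm (case z of (k, a, b) \<Rightarrow> ideal_of k a b))))" if "z \<in> triples" for z
  proof -
    obtain k a b where z: "z = (k, a, b)" by (cases z)
    have "0 < k * k * a" using that unfolding z triples_def by simp
    then have "real (nat (k * k * a)) = of_int (k * k * a)" by simp
    then show ?thesis using inorm_ideal_of[of k a b] that unfolding z by simp
  qed
  then have "((\<lambda>z. ?F (case z of (k, a, b) \<Rightarrow> (nat (k * k * a), z))) has_sum lambert chi_real t) triples
      \<longleftrightarrow> ((\<lambda>z. exp (- (t * of_int (inorm (case z of (k, a, b) \<Rightarrow> ideal_of k a b))))) has_sum lambert chi_real t) triples"
    by (rule has_sum_cong)
  ultimately have "((\<lambda>z. exp (- (t * of_int (inorm (case z of (k, a, b) \<Rightarrow> ideal_of k a b))))) has_sum lambert chi_real t) triples"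
    by (rule iffD1[rotated])
  then show ?thesis
    using has_sum_reindex_bij_betw[OF ideal_of_triples, of "\<lambda>J. exp (- (t * of_int (inorm J)))" "lambert chi_real t"] by blast
qed

text \<open>The two evaluations of the limit of Z(t) - 4 Z(4t), as t tends to 0, for the sum Z over all ideals: it is 3/2 for each of the finitely many classes, and it is the limit for the Lambert series of the character.\<close>

theorem class_number_formula: "N * int (class_number m) = - (\<Sum>x\<in>reps. x * chi x)"
proof -
  interpret P: periodic_mean_zero chi_real "nat N" by (rule periodic)
  have "\<forall>c\<in>ideal_classes. \<exists>z :: real \<times> real \<times> real. 0 < fst z \<and> 0 < fst (snd z) \<and> (\<forall>t>0.
    ((\<lambda>J. exp (- (t * of_int (inorm J)))) has_sum (theta2 (fst z) (fst (snd z)) (snd (snd z)) t 0 0 - 1) / 2) {J. nz_ideal J \<and> scaling_class J = c})"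
    using class_theta by simp
  from bchoice[OF this] obtain q :: "complex set set \<Rightarrow> real \<times> real \<times> real" where
    q: "\<forall>c\<in>ideal_classes. 0 < fst (q c) \<and> 0 < fst (snd (q c)) \<and> (\<forall>t>0.
      ((\<lambda>J. exp (- (t * of_int (inorm J)))) has_sum (theta2 (fst (q c)) (fst (snd (q c))) (snd (snd (q c))) t 0 0 - 1) / 2) {J. nz_ideal J \<and> scaling_class J = c})"
    by (elim exE)
  define th where "th = (\<lambda>c t. theta2 (fst (q c)) (fst (snd (q c))) (snd (snd (q c))) t 0 0)"
  have total: "lambert chi_real t = (\<Sum>c\<in>ideal_classes. (th c t - 1) / 2)" if t: "0 < t" for t
  proof -
    have bij: "bij_betw (\<lambda>J. (scaling_class J, J)) {J. nz_ideal J} (Sigma ideal_classes (\<lambda>c. {J. nz_ideal J \<and> scaling_class J = c}))"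
      by (rule bij_betw_byWitness[where f' = snd]) (auto simp: ideal_classes_def)
    have "((\<lambda>z. exp (- (t * of_int (inorm (snd z))))) has_sum lambert chi_real t) (Sigma ideal_classes (\<lambda>c. {J. nz_ideal J \<and> scaling_class J = c}))"
      using ideal_norm_sum[OF t] has_sum_reindex_bij_betw[OF bij, of "\<lambda>z. exp (- (t * of_int (inorm (snd z))))" "lambert chi_real t"] by simp
    then have "((\<lambda>c. (th c t - 1) / 2) has_sum lambert chi_real t) ideal_classes"
      by (rule has_sum_SigmaD) (use q t in \<open>simp add: th_def\<close>)
    then show ?thesis using finite_ideal_classes by (simp add: has_sum_finite_iff)
  qed
  have "((\<lambda>t. \<Sum>c\<in>ideal_classes. ((th c t - 4 * th c (4 * t)) + 3) / 2) \<longlongrightarrow> (\<Sum>c\<in>ideal_classes. (0 + 3) / 2)) (at_right 0)"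
    unfolding th_def by (intro tendsto_sum tendsto_divide tendsto_add tendsto_const theta2_limit) (use q in auto)
  moreover have "(\<Sum>c\<in>ideal_classes. ((th c t - 4 * th c (4 * t)) + 3) / 2) = lambert chi_real t - 4 * lambert chi_real (4 * t)" if "0 < t" for t
  proof -
    have t4: "0 < 4 * t" using that by simp
    show ?thesis unfolding total[OF that] total[OF t4] sum_distrib_left sum_subtractf[symmetric]
      by (intro sum.cong refl) (simp add: field_simps)
  qed
  then have "\<forall>\<^sub>F t in at_right 0. (\<Sum>c\<in>ideal_classes. ((th c t - 4 * th c (4 * t)) + 3) / 2) = lambert chi_real t - 4 * lambert chi_real (4 * t)"
    unfolding eventually_at_right_field by (intro exI[of _ 1]) simp
  ultimately have "((\<lambda>t. lambert chi_real t - 4 * lambert chi_real (4 * t)) \<longlongrightarrow> (\<Sum>c\<in>ideal_classes. (0 + 3) / 2)) (at_right 0)"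
    by (rule Lim_transform_eventually)
  from tendsto_unique[OF trivial_limit_at_right_real this P.lambert_limit]
  have "(\<Sum>c\<in>ideal_classes. (0 + 3) / 2) = - 3 * (\<Sum>x = 1..nat N. real x * chi_real x) / (2 * real (nat N))" .
  then have "real (card ideal_classes) * (3 / 2) = - 3 * (\<Sum>x = 1..nat N. real x * chi_real x) / (2 * real (nat N))" by simp
  moreover have "real (nat N) = of_int N" using N_pos by simp
  moreover have "(\<Sum>x = 1..nat N. real x * chi_real x) = of_int (\<Sum>x\<in>reps. x * chi x)"
    using sum_chi_real[of of_int] by simp
  ultimately have eq: "real (card ideal_classes) * (3 / 2) = - 3 * real_of_int (\<Sum>x\<in>reps. x * chi x) / (2 * of_int N)"
    by (simp only:)
  have clear: "y * h = - S" if "h * (3 / 2) = - 3 * S / (2 * y)" "0 < y" for h S y :: real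
    using that by (simp add: field_simps)
  have "real_of_int N * real (card ideal_classes) = - real_of_int (\<Sum>x\<in>reps. x * chi x)"
    by (rule clear[OF eq]) (use N_pos in simp)
  then have "of_int (N * int (card ideal_classes)) = (of_int (- (\<Sum>x\<in>reps. x * chi x)) :: real)"
    by (simp only: of_int_mult of_int_minus of_int_of_nat_eq)
  then show ?thesis unfolding class_number_eq by (simp only: of_int_eq_iff)
qed

end

theorem theorem3p2:
  fixes m D N B :: int
  assumes "m < 0" and "squarefree m"
    and "D = quad_disc m" and "D < - 4"
    and "N = \<bar>D\<bar>"
    and "B > 1" and "gcd B N = 1"
  shows "(\<Sum>k = 0..\<lfloor>real_of_int B / 2\<rfloor> - 1. (B - 1 - 2 * k) * E_sum m B k)
           = (B - quad_char m B) * int (class_number m) \<and>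
         (\<forall>B\<^sub>1 B\<^sub>2 :: int. 0 < B\<^sub>1 \<and> 0 < B\<^sub>2 \<and> B = B\<^sub>1 * B\<^sub>2 \<and> 1 < B\<^sub>1 \<and> B\<^sub>1 < B \<longrightarrow>
           (\<Sum>k = 0..\<lfloor>real_of_int B\<^sub>1 / 2\<rfloor> - 1.
              (B\<^sub>1 - 1 - 2 * k) * (\<Sum>j = 0..B\<^sub>2 - 1. E_sum m B (k * B\<^sub>2 + j)))
             = (B\<^sub>1 - quad_char m B\<^sub>1) * int (class_number m))"
proof -
  interpret Q: imaginary_quadratic m using assms(1,2,3,4) by unfold_locales simp_all
  have "N = Q.N" using assms(3,5) by (simp add: Q.N_def Q.D_def)
  then have cop: "coprime B Q.N" using assms(7) by (simp add: coprime_iff_gcd_eq_1)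
  show ?thesis
  proof (intro conjI allI impI)
    show "(\<Sum>k = 0..\<lfloor>real_of_int B / 2\<rfloor> - 1. (B - 1 - 2 * k) * E_sum m B k)
        = (B - quad_char m B) * int (class_number m)"
      by (rule Q.weighted_E_sums[OF assms(6) cop Q.class_number_formula])
  next
    fix B1 B2 :: int
    assume *: "0 < B1 \<and> 0 < B2 \<and> B = B1 * B2 \<and> 1 < B1 \<and> B1 < B"
    then have c: "coprime (B1 * B2) Q.N" "coprime B1 Q.N" using cop by simp_all
    have "(\<Sum>j = 0..B2 - 1. E_sum m B (k * B2 + j)) = E_sum m B1 k" for k
      using Q.E_sum_merge[OF _ _ c(1)] * by simp
    then show "(\<Sum>k = 0..\<lfloor>real_of_int B1 / 2\<rfloor> - 1. (B1 - 1 - 2 * k) * (\<Sum>j = 0..B2 - 1. E_sum m B (k * B2 + j)))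
        = (B1 - quad_char m B1) * int (class_number m)"
      using Q.weighted_E_sums[OF _ c(2) Q.class_number_formula] * by simp
  qed
qed

end
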